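(* There is an absolute constant $C>0$ such that the following holds. Let $d \geq 2$ and $x_0\geq 3$, let $f \in \mathcal{M}(x_0;d)$, let $1 \leq x \leq x_0$ and set $$\Sigma := \min\Big\{P^-(d),\ 2 + \sum_{\substack{p \leq x \\ f(p) \neq 0,1}} \frac1p\Big\}.$$ Then $$\frac{1}{d}\sum_{0 \leq \ell \leq d-1} \Big|\sum_{1\le n \leq x} f^\ell(n)\Big|^2 \leq C\, x^2 \frac{(\log \Sigma)^2}{\Sigma^{1/11}}.$$
   Context: Sums over $p$ are over primes; $P^-(d)$ is the smallest prime factor of $d$; $\mu_d$ is the set of complex $d$-th roots of unity. For $d\in\mathbb{N}$ and $x_0\ge1$, $\mathcal{M}(x_0;d)$ is the set of completely multiplicative functions $f:\mathbb{N}\to\mu_d\cup\{0\}$ such that for every $x\ge x_0$, $\max_{\alpha\in\mu_d}|\{n\le x: f(n)=\alpha\}|\le \frac{100x}{d}\prod_{p\le x,\ f(p)=0}(1-\frac1p)$. For $\ell\ge1$, $f^\ell(n)=f(n)^\ell$; $f^0$ denotes the function equal to $1$ at $n$ with $f(n)\ne0$ and $0$ at $n$ with $f(n)=0$ (as for the principal character). *)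

theory Defs
  imports "HOL-Analysis.Analysis" "HOL-Computational_Algebra.Primes"
begin

definition roots_of_unity :: "nat \<Rightarrow> complex set" where
  "roots_of_unity d = {z. z ^ d = 1}"

definition completely_multiplicative :: "(nat \<Rightarrow> complex) \<Rightarrow> bool" where
  "completely_multiplicative f \<longleftrightarrow>
     f 1 = 1 \<and> (\<forall>m n. m \<ge> 1 \<longrightarrow> n \<ge> 1 \<longrightarrow> f (m * n) = f m * f n)"

definition M_class :: "real \<Rightarrow> nat \<Rightarrow> (nat \<Rightarrow> complex) set" where
  "M_class x0 d = {f. completely_multiplicative f \<and>
     (\<forall>n\<ge>1. f n \<in> roots_of_unity d \<union> {0}) \<and>
     (\<forall>x::real. x \<ge> x0 \<longrightarrow> (\<forall>\<alpha>\<in>roots_of_unity d.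
        real (card {n::nat. 1 \<le> n \<and> real n \<le> x \<and> f n = \<alpha>})
          \<le> 100 * x / real d *
             (\<Prod>p\<in>{p::nat. prime p \<and> real p \<le> x \<and> f p = 0}. 1 - 1 / real p)))}"

definition least_prime_factor :: "nat \<Rightarrow> nat" where
  "least_prime_factor d = (LEAST p. prime p \<and> p dvd d)"

definition fpow :: "(nat \<Rightarrow> complex) \<Rightarrow> nat \<Rightarrow> nat \<Rightarrow> complex" where
  "fpow f l n = (if l = 0 then (if f n \<noteq> 0 then 1 else 0) else f n ^ l)"

end

(*
  By orthogonality the left-hand side counts pairs m, n <= x with f m = f n \<noteq> 0.
  The identity ln n = sum of the von Mangoldt function over divisors, together with Chebyshev's bound,
  dominates this count by the logarithmic count of pairs with m / n within a constant factor, which a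
  Fejer kernel turns into the average over l of the integral over |t| <= 1 of
  |F_l(t)|^2, where F_l(t) = sum_{n <= x} f(n)^l n^(-1-it).

  For a set P of primes with large reciprocal sum, n has about the expected number of prime factors in
  P, and multiplicativity makes F_l(t) (1 - avg_P f(p)^l p^(-it)) small in mean square (Turan-Kubilius).
  Hence only those l matter for which, for some |t| <= 1, f(p)^l is close to p^(it) both for most small
  primes with f(p) \<noteq> 0, 1 and for most primes in a range of much larger primes. The larger primes
  determine t as an approximately additive, bounded function of l, which must then be tiny; so
  f(p)^l is close to 1 on the small primes, and this happens for few l since f(p) has large order.
*)

theory Submission
  imports Defs "HOL-Number_Theory.Number_Theory" "HOL-Real_Asymp.Real_Asymp"
begin

section \<open>Chebyshev's bound\<close>

text \<open>Two ranges of primes are used because each alone is inconclusive. On primes with f(p)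
  \<noteq> 0, 1, closeness of f(p)^l to p^(it) contradicts nothing while t is free. On the large
  primes f is arbitrary, but p^(iu) can correlate with 1 there only if |u| \<le> 1 / ln y, where y
  is the lower end of the range; so they control the relations between the twists t of different l.
  A wide gap between the ranges then makes a twist of that size invisible on the small primes.

  The term P^-(d) enters through coprimality: an exponent 0 < j < P^-(d) is coprime to d, so f(p)^j
  \<noteq> 1 whenever f(p) \<noteq> 0, 1.

  The exponent 1/11 is a balance. With rho = Sigma^(-1/11), exceptional l have density at most rho.
  For the others the closeness threshold is delta = rho^5, and dividing by 1 - avg_P f(p)^l p^(-it)
  costs delta^(-2) = rho^(-10) against a gain of order 1 / Sigma = rho^11 from the reciprocal sums
  over primes. Thus 11 = 1 + 2 * 5.\<close>

lemma ln_fact_eq_sum_ln: "ln (fact n :: real) = (\<Sum>k\<in>{1..n}. ln (real k))"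
proof (induction n)
  case (Suc n)
  have "ln (fact (Suc n) :: real) = ln (real (Suc n)) + ln (fact n)"
    unfolding fact_Suc by (subst ln_mult) auto
  thus ?case using Suc.IH by simp
qed auto

lemma ln_fact_eq_mangoldt_sum:
  "ln (fact n :: real) = (\<Sum>d\<in>{1..n}. mangoldt d * real (n div d))"
proof -
  have "ln (fact n :: real) = (\<Sum>k\<in>{1..n}. ln (real k))"
    by (rule ln_fact_eq_sum_ln)
  also have "\<dots> = (\<Sum>k\<in>{1..n}. \<Sum>d\<in>{1..n}. if d dvd k then mangoldt d else 0)"
  proof (intro sum.cong refl)
    fix k assume k: "k \<in> {1..n}"
    have "ln (real k) = (\<Sum>d | d dvd k. mangoldt d)"
      using k by (subst mangoldt_sum) auto
    also have "{d. d dvd k} = {d\<in>{1..n}. d dvd k}"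
      using k by (auto dest: dvd_imp_le intro!: Nat.gr0I simp: Suc_le_eq)
    finally show "ln (real k) = (\<Sum>d\<in>{1..n}. if d dvd k then mangoldt d else 0)"
      by (simp only: sum.inter_filter[OF finite_atLeastAtMost])
  qed
  also have "\<dots> = (\<Sum>d\<in>{1..n}. \<Sum>k\<in>{1..n}. if d dvd k then mangoldt d else 0)"
    by (rule sum.swap)
  also have "\<dots> = (\<Sum>d\<in>{1..n}. mangoldt d * real (n div d))"
  proof (intro sum.cong refl)
    fix d assume d: "d \<in> {1..n}"
    have "{k\<in>{1..n}. d dvd k} = (\<lambda>j. d * j) ` {1..n div d}"
      using d by (auto simp: dvd_def image_iff less_eq_div_iff_mult_less_eq mult.commute)
    hence "card {k\<in>{1..n}. d dvd k} = n div d"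
      using d by (simp add: card_image inj_on_def)
    thus "(\<Sum>k\<in>{1..n}. if d dvd k then mangoldt d else 0) = mangoldt d * real (n div d)"
      by (simp flip: sum.inter_filter)
  qed
  finally show ?thesis .
qed

definition psi :: "nat \<Rightarrow> real" where
  "psi n = (\<Sum>d\<in>{1..n}. mangoldt d)"

text \<open>The central binomial coefficient is at most 4^n, and its logarithm is the sum of
  \<open>mangoldt d\<close> with weights \<open>2 * n div d - 2 * (n div d)\<close>. These integers
  are nonnegative, and at least 1 for n < d \<le> 2 n.\<close>

lemma psi_double: "psi (2 * n) \<le> psi n + 2 * real n * ln 2"
proof -
  have *: "ln (fact n :: real) = (\<Sum>d\<in>{1..2 * n}. mangoldt d * real (n div d))"
    unfolding ln_fact_eq_mangoldt_sum by (intro sum.mono_neutral_left) auto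
  have "psi (2 * n) - psi n = (\<Sum>d\<in>{1..2*n} - {1..n}. mangoldt d)"
    unfolding psi_def by (subst sum_diff) auto
  also have "\<dots> \<le> (\<Sum>d\<in>{1..2*n} - {1..n}. mangoldt d * (real (2 * n div d) - 2 * real (n div d)))"
  proof (intro sum_mono)
    fix d assume d: "d \<in> {1..2*n} - {1..n}"
    hence "1 \<le> 2 * n div d" "n div d = 0"
      by (auto simp: less_eq_div_iff_mult_less_eq)
    hence "1 \<le> real (2 * n div d) - 2 * real (n div d)"
      by simp
    from mult_left_mono[OF this mangoldt_nonneg[of d]]
    show "mangoldt d \<le> mangoldt d * (real (2 * n div d) - 2 * real (n div d))" by simp
  qed
  also have "\<dots> \<le> (\<Sum>d\<in>{1..2*n}. mangoldt d * (real (2 * n div d) - 2 * real (n div d)))"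
  proof (intro sum_mono2)
    fix d assume "d \<in> {1..2*n} - ({1..2*n} - {1..n})"
    have "2 * (n div d) \<le> 2 * n div d"
    proof (cases "d = 0")
      case False
      have "2 * (n div d) * d \<le> 2 * n"
        using div_times_less_eq_dividend[of n d] by (simp add: mult.assoc)
      thus ?thesis using False by (simp add: less_eq_div_iff_mult_less_eq)
    qed auto
    from of_nat_mono[OF this, where ?'a = real]
    have "0 \<le> real (2 * n div d) - 2 * real (n div d)" by simp
    thus "0 \<le> mangoldt d * (real (2 * n div d) - 2 * real (n div d))"
      by (intro mult_nonneg_nonneg mangoldt_nonneg)
  qed auto
  also have "\<dots> = ln (fact (2 * n)) - 2 * ln (fact n)"
    unfolding * unfolding ln_fact_eq_mangoldt_sum
    by (simp add: algebra_simps sum_subtractf sum_distrib_left)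
  also have "\<dots> = ln (fact (2 * n) / (fact n * fact n))"
    by (simp add: ln_div ln_mult)
  also have "fact (2 * n) / (fact n * fact n :: real) = real (2 * n choose n)"
    by (subst binomial_fact) (auto simp: mult_2)
  also have "ln (real (2 * n choose n)) \<le> ln (2 ^ (2 * n))"
  proof (subst ln_le_cancel_iff)
    have "2 * n choose n \<le> 2 ^ (2 * n)" by (rule binomial_le_pow2)
    thus "real (2 * n choose n) \<le> 2 ^ (2 * n)" using of_nat_mono by fastforce
  qed auto
  also have "\<dots> = 2 * real n * ln 2"
    by (simp add: ln_realpow)
  finally show ?thesis by simp
qed

lemma psi_pow2: "psi (2 ^ k) \<le> 2 ^ Suc k"
proof (induction k)
  case 0
  show ?case by (simp add: psi_def)
next
  case (Suc k)
  have "psi (2 ^ Suc k) \<le> psi (2 ^ k) + 2 * real (2 ^ k) * ln 2"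
    using psi_double[of "2 ^ k"] by simp
  also have "2 * real (2 ^ k) * ln 2 \<le> 2 * 2 ^ k * (1::real)"
    using ln2_le_25_over_36 by (intro mult_mono) auto
  finally show ?case using Suc.IH by simp
qed

text \<open>Keep only the term of index n in the exponential series for e^n.\<close>

lemma ln_fact_lower: "real n * ln (real n) - real n \<le> ln (fact n)"
proof (cases "n = 0")
  case False
  have "real n ^ n / fact n \<le> exp (real n)"
  proof -
    have "(\<Sum>i\<in>{n}. real n ^ i /\<^sub>R fact i) \<le> (\<Sum>i. real n ^ i /\<^sub>R fact i)"
      by (intro sum_le_suminf summable_exp_generic) auto
    thus ?thesis by (simp add: exp_def divide_inverse mult.commute)
  qed
  hence "ln (real n ^ n / fact n) \<le> ln (exp (real n))"
    using False by (subst ln_le_cancel_iff) auto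
  thus ?thesis using False by (simp add: ln_div ln_realpow)
qed auto

text \<open>Minkowski's inequality for finitely many summands; the coordinates will be the exponents
  l.\<close>

lemma L2_set_sum_le:
  fixes v :: "'i \<Rightarrow> 'b \<Rightarrow> 'c::real_normed_vector"
  assumes "finite I"
  shows "L2_set (\<lambda>x. norm (\<Sum>i\<in>I. v i x)) A \<le> (\<Sum>i\<in>I. L2_set (\<lambda>x. norm (v i x)) A)"
  using assms
proof (induction I rule: finite_induct)
  case (insert i I)
  have "L2_set (\<lambda>x. norm (\<Sum>i\<in>insert i I. v i x)) A \<le> L2_set (\<lambda>x. norm (v i x) + norm (\<Sum>i\<in>I. v i x)) A"
    using insert by (intro L2_set_mono) (auto intro: norm_triangle_ineq)
  also have "\<dots> \<le> L2_set (\<lambda>x. norm (v i x)) A + L2_set (\<lambda>x. norm (\<Sum>i\<in>I. v i x)) A"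
    by (rule L2_set_triangle_ineq)
  finally show ?case using insert by simp
qed (simp add: L2_set_def)

text \<open>For 2^j \<le> q < 2^(j+1), monotonicity replaces \<open>N div q\<close> by
  \<open>N div 2 ^ j\<close>, and Chebyshev's bound gives such q the total mass at most
  \<open>psi (2 ^ (j+1))\<close>, hence at most 2^(j+2).\<close>

lemma mangoldt_sum_le_dyadic_sum:
  fixes g :: "nat \<Rightarrow> real"
  assumes mono: "\<And>a b. a \<le> b \<Longrightarrow> g a \<le> g b" and g0: "\<And>a. 0 \<le> g a" "g 0 = 0"
  shows "(\<Sum>q\<in>{1..N}. mangoldt q * g (N div q)) \<le> (\<Sum>j\<le>N. 2 ^ (j+2) * g (N div 2 ^ j))"
proof -
  let ?J = "\<lambda>q::nat. floor_log q"
  have "(\<Sum>q\<in>{1..N}. mangoldt q * g (N div q)) \<le> (\<Sum>q\<in>{1..N}. mangoldt q * g (N div 2 ^ floor_log q))"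
  proof (intro sum_mono mult_left_mono mono mangoldt_nonneg)
    fix q assume "q \<in> {1..N}"
    thus "N div q \<le> N div 2 ^ floor_log q"
      by (intro div_le_mono2 floor_log_exp2_le) auto
  qed
  also have "\<dots> = (\<Sum>j\<le>N. \<Sum>q\<in>{q\<in>{1..N}. floor_log q = j}. mangoldt q * g (N div 2 ^ floor_log q))"
  proof (rule sum.group[symmetric])
    show "floor_log ` {1..N} \<subseteq> {..N}"
    proof (clarsimp)
      fix q assume q: "Suc 0 \<le> q" "q \<le> N"
      have "floor_log q < 2 ^ floor_log q" by simp
      also have "\<dots> \<le> q" using q by (intro floor_log_exp2_le) auto
      finally show "floor_log q \<le> N" using q by simp
    qed
  qed auto
  also have "\<dots> \<le> (\<Sum>j\<le>N. 2 ^ (j+2) * g (N div 2 ^ j))"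
  proof (intro sum_mono)
    fix j
    have "(\<Sum>q\<in>{q\<in>{1..N}. floor_log q = j}. mangoldt q * g (N div 2 ^ floor_log q)) =
          (\<Sum>q\<in>{q\<in>{1..N}. floor_log q = j}. mangoldt q) * g (N div 2 ^ j)"
      by (simp add: sum_distrib_right)
    also have "(\<Sum>q\<in>{q\<in>{1..N}. floor_log q = j}. mangoldt q) \<le> psi (2 ^ (j + 1))"
      unfolding psi_def
    proof (intro sum_mono2)
      show "{q \<in> {1..N}. floor_log q = j} \<subseteq> {1..2 ^ (j + 1)}"
        using floor_log_exp2_gt less_imp_le by fastforce
    qed (auto simp: mangoldt_nonneg)
    also have "\<dots> \<le> 2 ^ (j + 2)" using psi_pow2[of "j+1"] by simp
    finally show "(\<Sum>q\<in>{q\<in>{1..N}. floor_log q = j}. mangoldt q * g (N div 2 ^ floor_log q))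
                    \<le> 2 ^ (j+2) * g (N div 2 ^ j)"
      by (simp add: mult_right_mono g0)
  qed
  finally show ?thesis .
qed

section \<open>Powers of a root-of-unity valued multiplicative function\<close>

text \<open>Exponents are integers so that differences of exponents make sense. The separate value
  at zeros of f also covers the convention for the power with exponent 0.\<close>

definition fchar :: "(nat \<Rightarrow> complex) \<Rightarrow> int \<Rightarrow> nat \<Rightarrow> complex" where
  "fchar f l n = (if f n = 0 then 0 else f n powi l)"

locale root_valued =
  fixes f :: "nat \<Rightarrow> complex" and d :: nat
  assumes mult: "completely_multiplicative f"
    and vals: "\<And>n. n \<ge> 1 \<Longrightarrow> f n \<in> roots_of_unity d \<union> {0}"
    and d_pos: "d > 0"
begin

lemma f_mult: "m \<ge> 1 \<Longrightarrow> n \<ge> 1 \<Longrightarrow> f (m * n) = f m * f n"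
  using mult by (auto simp: completely_multiplicative_def)

lemma f_power_d: "n \<ge> 1 \<Longrightarrow> f n \<noteq> 0 \<Longrightarrow> f n ^ d = 1"
  using vals[of n] by (auto simp: roots_of_unity_def)

lemma norm_f: "n \<ge> 1 \<Longrightarrow> f n \<noteq> 0 \<Longrightarrow> cmod (f n) = 1"
  using f_power_d[of n] d_pos by (metis norm_one norm_power norm_ge_zero power_eq_1_iff less_numeral_extra(3) neq0_conv)

lemma norm_fchar_le: "n \<ge> 1 \<Longrightarrow> cmod (fchar f l n) \<le> 1"
  by (auto simp: fchar_def norm_power_int norm_f)

lemma fchar_mult: "m \<ge> 1 \<Longrightarrow> n \<ge> 1 \<Longrightarrow> fchar f l (m * n) = fchar f l m * fchar f l n"
  by (auto simp: fchar_def f_mult power_int_mult_distrib)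

lemma fchar_add: "fchar f (k + l) n = fchar f k n * fchar f l n"
  by (auto simp: fchar_def power_int_add)

lemma fchar_minus: "n \<ge> 1 \<Longrightarrow> fchar f (- l) n = cnj (fchar f l n)"
proof -
  assume n: "n \<ge> 1"
  show ?thesis
  proof (cases "f n = 0")
    case False
    have "cnj (f n powi l) = inverse (f n powi l)"
      using norm_f[OF n False]
      by (metis complex_cnj_cnj complex_cnj_inverse complex_mod_cnj divide_conv_cnj inverse_eq_divide mult_1 norm_power_int power_int_1_left)
    thus ?thesis using False by (simp add: fchar_def power_int_minus)
  qed (simp add: fchar_def)
qed

lemma fchar_period:
  assumes "n \<ge> 1" shows "fchar f (l + int d * k) n = fchar f l n"
proof (cases "f n = 0")
  case False
  have "f n powi (int d * k) = (f n powi int d) powi k" by (simp add: power_int_mult)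
  also have "f n powi int d = 1" using f_power_d[OF assms False] by simp
  finally show ?thesis using False by (simp add: fchar_def power_int_add)
qed (simp add: fchar_def)

lemma fchar_cong:
  assumes "n \<ge> 1" "[k = l] (mod int d)" shows "fchar f k n = fchar f l n"
proof -
  from assms(2) obtain j where "k = l + int d * j"
    by (metis cong_iff_lin cong_sym)
  thus ?thesis using fchar_period[OF assms(1)] by simp
qed

lemma fpow_eq_fchar: "fpow f l n = fchar f (int l) n"
  by (auto simp: fpow_def fchar_def)

lemma sum_powers_root:
  assumes "z ^ d = (1::complex)"
  shows "(\<Sum>l<d. z ^ l) = (if z = 1 then of_nat d else 0)"
  using assms by (auto simp: geometric_sum)

lemma orthogonality:
  assumes "m \<ge> 1" "n \<ge> 1"
  shows "(\<Sum>l<d. fchar f (int l) m * cnj (fchar f (int l) n)) = (if f m = f n \<and> f m \<noteq> 0 then of_nat d else 0)"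
proof (cases "f m = 0 \<or> f n = 0")
  case False
  hence nz: "f m \<noteq> 0" "f n \<noteq> 0" by auto
  have inv: "cnj (f n) = inverse (f n)"
    using norm_f[OF assms(2) nz(2)] by (metis complex_mod_cnj divide_conv_cnj inverse_eq_divide mult_1)
  have "(\<Sum>l<d. fchar f (int l) m * cnj (fchar f (int l) n)) = (\<Sum>l<d. (f m / f n) ^ l)"
    using nz by (intro sum.cong refl) (simp add: fchar_def inv divide_inverse power_mult_distrib)
  also have "\<dots> = (if f m / f n = 1 then of_nat d else 0)"
    using f_power_d assms nz by (intro sum_powers_root) (simp add: power_divide)
  finally show ?thesis using nz by auto
qed (auto simp: fchar_def)

lemma sum_norm_square_fchar:
  fixes c :: "nat \<Rightarrow> real"
  assumes "finite A" "\<And>n. n \<in> A \<Longrightarrow> n \<ge> 1"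
  shows "(\<Sum>l<d. (cmod (\<Sum>n\<in>A. of_real (c n) * fchar f (int l) n))\<^sup>2) =
           d * (\<Sum>m\<in>A. \<Sum>n\<in>A. if f m = f n \<and> f m \<noteq> 0 then c m * c n else 0)"
proof -
  have "complex_of_real (\<Sum>l<d. (cmod (\<Sum>n\<in>A. of_real (c n) * fchar f (int l) n))\<^sup>2) =
        (\<Sum>l<d. (\<Sum>n\<in>A. of_real (c n) * fchar f (int l) n) * cnj (\<Sum>n\<in>A. of_real (c n) * fchar f (int l) n))"
    by (simp add: complex_norm_square del: cnj_sum of_real_power flip: of_real_power)
  also have "\<dots> = (\<Sum>l<d. \<Sum>m\<in>A. \<Sum>n\<in>A. of_real (c m * c n) * (fchar f (int l) m * cnj (fchar f (int l) n)))"
    by (simp add: sum_product algebra_simps)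
  also have "\<dots> = (\<Sum>m\<in>A. \<Sum>n\<in>A. of_real (c m * c n) * (\<Sum>l<d. fchar f (int l) m * cnj (fchar f (int l) n)))"
    (is "?lhs = ?rhs")
  proof -
    have "?lhs = (\<Sum>m\<in>A. \<Sum>l<d. \<Sum>n\<in>A. of_real (c m * c n) * (fchar f (int l) m * cnj (fchar f (int l) n)))"
      by (rule sum.swap)
    also have "\<dots> = ?rhs"
      unfolding sum_distrib_left by (rule sum.cong[OF refl], rule sum.swap)
    finally show ?thesis .
  qed
  also have "\<dots> = (\<Sum>m\<in>A. \<Sum>n\<in>A. of_real (d * (if f m = f n \<and> f m \<noteq> 0 then c m * c n else 0)))"
    by (intro sum.cong refl) (subst orthogonality, use assms in auto)
  also have "\<dots> = of_real (d * (\<Sum>m\<in>A. \<Sum>n\<in>A. if f m = f n \<and> f m \<noteq> 0 then c m * c n else 0))"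
    by (simp add: sum_distrib_left)
  finally show ?thesis using of_real_eq_iff by blast
qed

text \<open>Its square is d times the quantity to be bounded when A = {1..N}. As a norm in the
  variable l it obeys the triangle inequality.\<close>

definition fnorm :: "nat set \<Rightarrow> real" where
  "fnorm A = L2_set (\<lambda>l. cmod (\<Sum>n\<in>A. fchar f (int l) n)) {..<d}"

lemma fnorm_square:
  assumes "finite A" "\<And>n. n \<in> A \<Longrightarrow> n \<ge> 1"
  shows "(fnorm A)\<^sup>2 = d * (\<Sum>m\<in>A. \<Sum>n\<in>A. if f m = f n \<and> f m \<noteq> 0 then 1 else (0::real))"
proof -
  have "(\<Sum>l<d. (cmod (\<Sum>n\<in>A. fchar f (int l) n))\<^sup>2) =
          d * (\<Sum>m\<in>A. \<Sum>n\<in>A. if f m = f n \<and> f m \<noteq> 0 then 1 else (0::real))"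
    using sum_norm_square_fchar[OF assms, of "\<lambda>_. 1"] by (simp cong: if_cong)
  thus ?thesis
    unfolding fnorm_def L2_set_def by (subst real_sqrt_pow2) (auto intro!: sum_nonneg mult_nonneg_nonneg)
qed

lemma fnorm_nonneg [simp]: "fnorm A \<ge> 0" by (simp add: fnorm_def)

text \<open>By orthogonality the square counts pairs with equal nonzero values, and this count grows
  with the set, although the individual sums over n need not.\<close>

lemma fnorm_mono:
  assumes "finite B" "A \<subseteq> B" "\<And>n. n \<in> B \<Longrightarrow> n \<ge> 1"
  shows "fnorm A \<le> fnorm B"
proof (rule power2_le_imp_le)
  show "(fnorm A)\<^sup>2 \<le> (fnorm B)\<^sup>2"
    using assms finite_subset[of A B]
    by (subst (1 2) fnorm_square) (auto intro!: mult_left_mono sum_mono2 order.trans[OF sum_mono2 sum_mono] sum_nonneg)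
qed simp

lemma L2_fchar_le: "n \<ge> 1 \<Longrightarrow> L2_set (\<lambda>l. cmod (fchar f (int l) n)) {..<d} \<le> sqrt d"
  using L2_set_mono[of "{..<d}" "\<lambda>l. cmod (fchar f (int l) n)" "\<lambda>_. 1"] norm_fchar_le
  by (simp add: L2_set_constant)

text \<open>Write ln N = ln n + ln (N/n) and expand ln n over the divisors q of n. Multiplicativity
  splits off f(q)^l, of modulus at most 1, from the sum up to N/q, and Minkowski's inequality in l
  does the rest. The terms ln (N/n) add up to N ln N - ln N! \<le> N, so they cost no
  logarithm.\<close>

lemma fnorm_ln_le:
  "fnorm {1..N} * ln N \<le> (\<Sum>q\<in>{1..N}. mangoldt q * fnorm {1..N div q}) + sqrt d * N"
proof (cases "N = 0")
  case False
  let ?v = "\<lambda>n l. fchar f (int l) n"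
  have eq: "of_real (ln N) * (\<Sum>n\<in>{1..N}. ?v n l) =
      (\<Sum>q\<in>{1..N}. mangoldt q * ?v q l * (\<Sum>n\<in>{1..N div q}. ?v n l)) +
      (\<Sum>n\<in>{1..N}. of_real (ln (N / n)) * ?v n l)" for l
  proof -
    have "(\<Sum>n\<in>{1..N}. of_real (ln n) * ?v n l) = (\<Sum>n\<in>{1..N}. \<Sum>q | q dvd n. mangoldt q * ?v n l)"
      by (intro sum.cong refl, subst mangoldt_sum [symmetric]) (auto simp: sum_distrib_right)
    also have "\<dots> = (\<Sum>(n,q)\<in>Sigma {1..N} (\<lambda>n. {q. q dvd n}). mangoldt q * ?v n l)"
      by (subst sum.Sigma) auto
    also have "\<dots> = (\<Sum>(q,k)\<in>Sigma {1..N} (\<lambda>q. {1..N div q}). mangoldt q * (?v q l * ?v k l))"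
    proof (rule sum.reindex_bij_witness[of _ "\<lambda>(q,k). (q * k, q)" "\<lambda>(n,q). (q, n div q)"], goal_cases)
      case (2 a)
      then obtain n q where a: "a = (n, q)" "n \<in> {1..N}" "q dvd n" by auto
      hence "q \<le> n" "q \<ge> 1" by (auto dest: dvd_imp_le intro!: Nat.gr0I simp: Suc_le_eq)
      moreover have "n div q \<ge> 1" using a by (auto intro!: Nat.gr0I simp: Suc_le_eq dvd_div_eq_0_iff)
      ultimately show ?case using a by (auto intro!: div_le_mono)
    next
      case (4 b)
      thus ?case by (auto simp: less_eq_div_iff_mult_less_eq Suc_le_eq mult.commute)
    next
      case (5 a)
      then obtain n q where a: "a = (n, q)" "n \<in> {1..N}" "q dvd n" by auto
      hence "q \<ge> 1" "n div q \<ge> 1" by (auto intro!: Nat.gr0I simp: Suc_le_eq dvd_div_eq_0_iff)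
      hence "?v (q * (n div q)) l = ?v q l * ?v (n div q) l"
        by (rule fchar_mult)
      thus ?case using a by simp
    qed auto
    also have "\<dots> = (\<Sum>q\<in>{1..N}. mangoldt q * ?v q l * (\<Sum>n\<in>{1..N div q}. ?v n l))"
      by (subst sum.Sigma [symmetric]) (auto simp: sum_distrib_left mult.assoc)
    finally have *: "(\<Sum>n\<in>{1..N}. of_real (ln n) * ?v n l) = \<dots>" .
    have "of_real (ln N) * (\<Sum>n\<in>{1..N}. ?v n l) = (\<Sum>n\<in>{1..N}. (of_real (ln n) + of_real (ln (N / n))) * ?v n l)"
      unfolding sum_distrib_left using False by (intro sum.cong refl) (simp add: ln_div flip: of_real_add)
    also have "\<dots> = (\<Sum>n\<in>{1..N}. of_real (ln n) * ?v n l) + (\<Sum>n\<in>{1..N}. of_real (ln (N / n)) * ?v n l)"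
      by (simp add: distrib_right sum.distrib)
    finally show ?thesis using * by simp
  qed
  have lnN: "ln N \<ge> 0" using False by simp
  have "fnorm {1..N} * ln N = L2_set (\<lambda>l. cmod (of_real (ln N) * (\<Sum>n\<in>{1..N}. ?v n l))) {..<d}"
    using lnN by (simp add: fnorm_def norm_mult L2_set_left_distrib L2_set_right_distrib mult.commute)
  also have "\<dots> \<le> L2_set (\<lambda>l. cmod (\<Sum>q\<in>{1..N}. mangoldt q * ?v q l * (\<Sum>n\<in>{1..N div q}. ?v n l)) +
        cmod (\<Sum>n\<in>{1..N}. of_real (ln (N / n)) * ?v n l)) {..<d}"
    unfolding eq by (intro L2_set_mono) (auto intro: norm_triangle_ineq)
  also have "\<dots> \<le> L2_set (\<lambda>l. cmod (\<Sum>q\<in>{1..N}. mangoldt q * ?v q l * (\<Sum>n\<in>{1..N div q}. ?v n l))) {..<d} +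
        L2_set (\<lambda>l. cmod (\<Sum>n\<in>{1..N}. of_real (ln (N / n)) * ?v n l)) {..<d}"
    by (rule L2_set_triangle_ineq)
  also have "\<dots> \<le> (\<Sum>q\<in>{1..N}. L2_set (\<lambda>l. cmod (mangoldt q * ?v q l * (\<Sum>n\<in>{1..N div q}. ?v n l))) {..<d}) +
        (\<Sum>n\<in>{1..N}. L2_set (\<lambda>l. cmod (of_real (ln (N / n)) * ?v n l)) {..<d})"
    by (intro add_mono L2_set_sum_le) auto
  also have "\<dots> \<le> (\<Sum>q\<in>{1..N}. mangoldt q * fnorm {1..N div q}) + (\<Sum>n\<in>{1..N}. ln (N / n) * sqrt d)"
  proof (intro add_mono sum_mono)
    fix q assume q: "q \<in> {1..N}"
    have "L2_set (\<lambda>l. cmod (mangoldt q * ?v q l * (\<Sum>n\<in>{1..N div q}. ?v n l))) {..<d} \<le>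
          L2_set (\<lambda>l. mangoldt q * cmod (\<Sum>n\<in>{1..N div q}. ?v n l)) {..<d}"
      using norm_fchar_le[of q] q mangoldt_nonneg[of q]
      by (intro L2_set_mono) (auto simp: norm_mult intro!: mult_right_mono mult_left_le)
    also have "\<dots> = mangoldt q * fnorm {1..N div q}"
      by (simp add: fnorm_def L2_set_right_distrib mangoldt_nonneg)
    finally show "L2_set (\<lambda>l. cmod (mangoldt q * ?v q l * (\<Sum>n\<in>{1..N div q}. ?v n l))) {..<d} \<le> \<dots>" .
  next
    fix n assume n: "n \<in> {1..N}"
    have "L2_set (\<lambda>l. cmod (of_real (ln (N / n)) * ?v n l)) {..<d} = ln (N / n) * L2_set (\<lambda>l. cmod (?v n l)) {..<d}"
      using n by (simp add: norm_mult L2_set_right_distrib del: of_real_divide)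
    also have "\<dots> \<le> ln (N / n) * sqrt d"
      using n by (intro mult_left_mono L2_fchar_le) auto
    finally show "L2_set (\<lambda>l. cmod (of_real (ln (N / n)) * ?v n l)) {..<d} \<le> \<dots>" .
  qed
  also have "(\<Sum>n\<in>{1..N}. ln (N / n) * sqrt d) = (N * ln N - ln (fact N)) * sqrt d"
  proof -
    have "(\<Sum>n\<in>{1..N}. ln (real N / n)) = (\<Sum>n\<in>{1..N}. ln N - ln n)"
      by (intro sum.cong) (auto simp: ln_div)
    also have "\<dots> = N * ln N - (\<Sum>n\<in>{1..N}. ln (real n))" by (simp add: sum_subtractf)
    also have "(\<Sum>n\<in>{1..N}. ln (real n)) = ln (fact N)" by (simp add: ln_fact_eq_sum_ln)
    finally show ?thesis by (simp flip: sum_distrib_right)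
  qed
  also have "\<dots> \<le> N * sqrt d"
    using ln_fact_lower[of N] by (intro mult_right_mono) auto
  finally show ?thesis by (simp add: mult.commute)
qed (simp add: fnorm_def L2_set_def)

end

lemma div_power2_less: "N < k \<Longrightarrow> N div 2 ^ k = (0::nat)"
  by (meson div_less less_exp less_trans)

lemma power2_sum_le: "(x + y)\<^sup>2 \<le> 2 * x\<^sup>2 + 2 * (y::real)\<^sup>2"
  using sum_squares_bound[of x y] by (simp add: power2_sum)

section \<open>Dyadic blocks and the logarithmic count of close pairs\<close>

context root_valued
begin

lemma fnorm_blocks:
  assumes "M \<le> N"
  shows "fnorm {1..M} \<le> (\<Sum>i\<le>N. fnorm {M div 2 ^ Suc i + 1..M div 2 ^ i})"
proof -
  have split: "(\<Sum>n\<in>{1..M}. h n) = (\<Sum>i\<le>K. \<Sum>n\<in>{M div 2 ^ Suc i + 1..M div 2 ^ i}. h n) + (\<Sum>n\<in>{1..M div 2 ^ Suc K}. h n)"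
    for h :: "nat \<Rightarrow> complex" and K
  proof (induction K)
    case 0
    have "{1..M} = {1..M div 2} \<union> {M div 2 + 1..M}" by auto
    thus ?case by (simp only:) (subst sum.union_disjoint, auto)
  next
    case (Suc K)
    have *: "M div 2 ^ Suc (Suc K) \<le> M div 2 ^ Suc K"
      by (intro div_le_mono2) auto
    have "{1..M div 2 ^ Suc K} = {1..M div 2 ^ Suc (Suc K)} \<union> {M div 2 ^ Suc (Suc K) + 1..M div 2 ^ Suc K}"
      using * by auto
    hence "(\<Sum>n\<in>{1..M div 2 ^ Suc K}. h n) = (\<Sum>n\<in>{1..M div 2 ^ Suc (Suc K)}. h n) + (\<Sum>n\<in>{M div 2 ^ Suc (Suc K) + 1..M div 2 ^ Suc K}. h n)"
      by (simp only:) (subst sum.union_disjoint, auto)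
    thus ?case using Suc.IH by (simp add: add_ac)
  qed
  \<comment> \<open>Blocks up to index N exhaust {1..M} because M \<le> N < 2^(N+1); a number of
    blocks independent of M eases the later exchange of sums.\<close>
  have "M div 2 ^ Suc N = 0" using assms by (intro div_power2_less) auto
  hence "(\<Sum>n\<in>{1..M}. h n) = (\<Sum>i\<le>N. \<Sum>n\<in>{M div 2 ^ Suc i + 1..M div 2 ^ i}. h n)" for h :: "nat \<Rightarrow> complex"
    using split[of h N] by simp
  thus ?thesis unfolding fnorm_def
    by (simp only: L2_set_sum_le finite_atMost)
qed

text \<open>The weights 1/(m n) fit Dirichlet polynomials on the line of real part 1, and the bound
  1 on the logarithm is the range where the Fejer kernel is at least 1/2.\<close>

definition close_pairs :: "nat \<Rightarrow> real" where
  "close_pairs N = (\<Sum>m\<in>{1..N}. \<Sum>n\<in>{1..N}.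
     if f m = f n \<and> f m \<noteq> 0 \<and> \<bar>ln (real m / real n)\<bar> \<le> 1 then 1 / (real m * real n) else 0)"

text \<open>Two elements of a block differ by a factor of at most 2, so they form a close pair, and
  both are at most N / 2^k, so their weight is at least (2^k / N)^2. The blocks being disjoint, no
  pair is counted twice.\<close>

lemma sum_fnorm_blocks_square:
  "(\<Sum>k\<le>N. (2 ^ k * fnorm {N div 2 ^ Suc k + 1..N div 2 ^ k})\<^sup>2) \<le> d * (real N)\<^sup>2 * close_pairs N"
proof -
  define I where "I = (\<lambda>k. {N div 2 ^ Suc k + 1..N div 2 ^ k})"
  define g where "g = (\<lambda>(m,n). if f m = f n \<and> f m \<noteq> 0 \<and> \<bar>ln (real m / real n)\<bar> \<le> 1 then 1 / (real m * real n) else (0::real))"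
  have g_nonneg: "g x \<ge> 0" for x by (auto simp: g_def split: prod.splits)
  have I_sub: "I k \<subseteq> {1..N}" for k
    unfolding I_def using div_le_dividend[of N "2 ^ k"] by (auto intro: order.trans)
  have I_disj: "I j \<inter> I k = {}" if "j < k" for j k
  proof -
    have "N div 2 ^ k \<le> N div 2 ^ Suc j" using that by (intro div_le_mono2 power_increasing) auto
    thus ?thesis by (auto simp: I_def)
  qed
  have "(2 ^ k * fnorm (I k))\<^sup>2 \<le> d * (real N)\<^sup>2 * (\<Sum>x\<in>I k \<times> I k. g x)" for k
  proof -
    have "(2 ^ k * fnorm (I k))\<^sup>2 = d * (\<Sum>m\<in>I k. \<Sum>n\<in>I k. if f m = f n \<and> f m \<noteq> 0 then (2 ^ k)\<^sup>2 else (0::real))"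
      unfolding power_mult_distrib
      by (subst fnorm_square) (auto simp: I_def sum_distrib_left mult_ac intro!: sum.cong)
    also have "\<dots> \<le> d * (\<Sum>m\<in>I k. \<Sum>n\<in>I k. (real N)\<^sup>2 * g (m, n))"
    proof (intro mult_left_mono sum_mono)
      fix m n assume mn: "m \<in> I k" "n \<in> I k"
      have pos: "m > 0" "n > 0" using mn by (auto simp: I_def)
      \<comment> \<open>An odd quotient exceeds twice its half by 1; this is harmless, since
        elements of the block are at least \<open>N div 2 ^ Suc k + 1\<close>.\<close>
      have half: "N div 2 ^ k \<le> 2 * (N div 2 ^ Suc k) + 1"
        unfolding power_Suc2 div_mult2_eq by linarith
      have le: "m \<le> 2 * n" "n \<le> 2 * m" using mn half by (auto simp: I_def)
      have "ln (real m / real n) \<le> ln 2"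
        using le pos by (subst ln_le_cancel_iff) (auto simp: field_simps simp flip: of_nat_mult)
      moreover have "- ln (real m / real n) = ln (real n / real m)" using pos by (simp add: ln_div)
      moreover have "ln (real n / real m) \<le> ln 2"
        using le pos by (subst ln_le_cancel_iff) (auto simp: field_simps simp flip: of_nat_mult)
      ultimately have close: "\<bar>ln (real m / real n)\<bar> \<le> 1" using ln2_le_25_over_36 by linarith
      have "m * 2 ^ k \<le> N" "n * 2 ^ k \<le> N"
        using mn by (auto simp: I_def less_eq_div_iff_mult_less_eq)
      hence "(m * 2 ^ k) * (n * 2 ^ k) \<le> N * N" by (intro mult_mono) auto
      from of_nat_mono[OF this, where ?'a = real]
      have "(2 ^ k)\<^sup>2 \<le> (real N)\<^sup>2 * (1 / (real m * real n))"
        using pos by (simp add: field_simps power2_eq_square)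
      thus "(if f m = f n \<and> f m \<noteq> 0 then (2 ^ k)\<^sup>2 else 0) \<le> (real N)\<^sup>2 * g (m, n)"
        using close by (auto simp: g_def)
    qed auto
    also have "\<dots> = d * (real N)\<^sup>2 * (\<Sum>x\<in>I k \<times> I k. g x)"
      by (simp add: sum_distrib_left sum.cartesian_product I_def mult.assoc split_def)
    finally show ?thesis .
  qed
  hence "(\<Sum>k\<le>N. (2 ^ k * fnorm (I k))\<^sup>2) \<le> d * (real N)\<^sup>2 * (\<Sum>k\<le>N. \<Sum>x\<in>I k \<times> I k. g x)"
    unfolding sum_distrib_left by (intro sum_mono)
  also have "(\<Sum>k\<le>N. \<Sum>x\<in>I k \<times> I k. g x) = (\<Sum>x\<in>(\<Union>k\<in>{..N}. I k \<times> I k). g x)"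
  proof (rule sum.UNION_disjoint[symmetric])
    show "\<forall>i\<in>{..N}. \<forall>j\<in>{..N}. i \<noteq> j \<longrightarrow> I i \<times> I i \<inter> I j \<times> I j = {}"
      using I_disj by (metis Int_commute Times_Int_Times Times_empty linorder_neqE_nat)
  qed (auto simp: I_def)
  also have "\<dots> \<le> (\<Sum>x\<in>{1..N} \<times> {1..N}. g x)"
    using I_sub g_nonneg by (intro sum_mono2) blast+
  also have "\<dots> = close_pairs N"
    unfolding close_pairs_def by (simp add: sum.cartesian_product g_def split_def)
  finally show ?thesis by (simp add: I_def mult_left_mono)
qed

lemma close_pairs_nonneg: "close_pairs N \<ge> 0"
  unfolding close_pairs_def by (intro sum_nonneg) auto

text \<open>The logarithm of \<open>fnorm_ln_le\<close> gains (ln N)^2 after squaring. Only about ln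
  N dyadic blocks are nonempty, so Cauchy-Schwarz over the blocks loses one factor ln N, and one
  remains.\<close>

lemma fnorm_bound_close_pairs:
  assumes "N \<ge> 2"
  shows "(fnorm {1..N})\<^sup>2 \<le> d * (real N)\<^sup>2 * (600 / ln N * close_pairs N + 2 / (ln N)\<^sup>2)"
proof -
  define g where "g = (\<lambda>k. fnorm {N div 2 ^ Suc k + 1..N div 2 ^ k})"
  define J where "J = floor_log N"
  have lnN: "ln N > 0" using assms by simp
  have g0: "g k \<ge> 0" for k by (simp add: g_def)
  have g_big: "g k = 0" if "k > J" for k
  proof -
    have "N < 2 ^ k" using that floor_log_exp2_gt[of N] unfolding J_def
      by (metis Suc_leI less_le_trans one_less_numeral_iff power_increasing_iff semiring_norm(76) mult_2 power_Suc)
    thus ?thesis by (simp add: g_def fnorm_def L2_set_def)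
  qed
  have "fnorm {1..N} * ln N \<le> (\<Sum>q\<in>{1..N}. mangoldt q * fnorm {1..N div q}) + sqrt d * N"
    by (rule fnorm_ln_le)
  also have "(\<Sum>q\<in>{1..N}. mangoldt q * fnorm {1..N div q}) \<le> (\<Sum>j\<le>N. 2 ^ (j+2) * fnorm {1..N div 2 ^ j})"
    by (rule mangoldt_sum_le_dyadic_sum) (auto intro!: fnorm_mono, simp add: fnorm_def L2_set_def)
  also have "\<dots> \<le> (\<Sum>j\<le>N. 2 ^ (j+2) * (\<Sum>i\<le>N. g (j + i)))"
  proof (intro sum_mono mult_left_mono)
    fix j
    have "N div 2 ^ j \<le> N" by simp
    from fnorm_blocks[OF this] show "fnorm {1..N div 2 ^ j} \<le> (\<Sum>i\<le>N. g (j + i))"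
      by (simp add: g_def div_mult2_eq[symmetric] power_add mult.left_commute)
  qed auto
  also have "\<dots> \<le> (\<Sum>j\<le>N. 2 ^ (j+2) * (\<Sum>k\<in>{j..N}. g k))"
  proof (intro sum_mono mult_left_mono)
    fix j
    have "(\<Sum>i\<le>N. g (j + i)) = (\<Sum>k\<in>{j..j+N}. g k)"
      by (rule sum.reindex_bij_witness[of _ "\<lambda>k. k - j" "\<lambda>i. j + i"]) auto
    also have "\<dots> = (\<Sum>k\<in>{j..N}. g k)"
    proof (rule sum.mono_neutral_right)
      have "J \<le> N"
      proof -
        have "J < 2 ^ J" by simp
        also have "\<dots> \<le> N" unfolding J_def using assms by (intro floor_log_exp2_le) auto
        finally show ?thesis by simp
      qed
      thus "\<forall>i\<in>{j..j + N} - {j..N}. g i = 0" by (auto intro!: g_big)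
    qed auto
    finally show "(\<Sum>i\<le>N. g (j + i)) \<le> (\<Sum>k\<in>{j..N}. g k)" by simp
  qed auto
  \<comment> \<open>After the exchange the powers of 2 from the von Mangoldt weights form a
    geometric sum dominated by its last term, so the double dyadic sum collapses to a single
    one.\<close>
  also have "\<dots> = (\<Sum>k\<le>N. (\<Sum>j\<le>k. 2 ^ (j+2)) * g k)"
  proof -
    have "(\<Sum>j\<le>N. 2 ^ (j+2) * (\<Sum>k\<in>{j..N}. g k)) = (\<Sum>j\<le>N. \<Sum>k\<le>N. if j \<le> k then 2 ^ (j+2) * g k else 0)"
    proof (intro sum.cong refl)
      fix j
      have "{j..N} = {k\<in>{..N}. j \<le> k}" by auto
      thus "2 ^ (j+2) * (\<Sum>k\<in>{j..N}. g k) = (\<Sum>k\<le>N. if j \<le> k then 2 ^ (j+2) * g k else 0)"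
        by (simp only: sum_distrib_left sum.inter_filter finite_atMost if_distrib mult_zero_right cong: if_cong)
    qed
    also have "\<dots> = (\<Sum>k\<le>N. \<Sum>j\<le>N. if j \<le> k then 2 ^ (j+2) * g k else 0)" by (rule sum.swap)
    also have "\<dots> = (\<Sum>k\<le>N. (\<Sum>j\<le>k. 2 ^ (j+2)) * g k)"
    proof (intro sum.cong refl)
      fix k assume "k \<in> {..N}"
      hence "{..k} = {j\<in>{..N}. j \<le> k}" by auto
      thus "(\<Sum>j\<le>N. if j \<le> k then 2 ^ (j+2) * g k else 0) = (\<Sum>j\<le>k. 2 ^ (j+2)) * g k"
        by (simp only: sum_distrib_right sum.inter_filter finite_atMost if_distrib[of "\<lambda>x. x * g k"] mult_zero_left cong: if_cong)
    qed
    finally show ?thesis .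
  qed
  also have "\<dots> \<le> (\<Sum>k\<le>N. 8 * (2 ^ k * g k))"
  proof (intro sum_mono)
    fix k
    have "(\<Sum>j\<le>k. 2 ^ (j+2)) \<le> (8 * 2 ^ k :: real)" by (induction k) auto
    from mult_right_mono[OF this g0[of k]] show "(\<Sum>j\<le>k. 2 ^ (j+2)) * g k \<le> 8 * (2 ^ k * g k)"
      by (simp add: mult.assoc)
  qed
  also have "\<dots> = 8 * (\<Sum>k\<le>N. 2 ^ k * g k)" by (simp add: sum_distrib_left)
  finally have main: "fnorm {1..N} * ln N \<le> 8 * (\<Sum>k\<le>N. 2 ^ k * g k) + sqrt d * N" by simp
  have "(\<Sum>k\<le>N. 2 ^ k * g k)\<^sup>2 \<le> (Suc J) * (\<Sum>k\<le>N. (2 ^ k * g k)\<^sup>2)"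
  proof -
    have "(\<Sum>k\<le>N. 2 ^ k * g k) = (\<Sum>k\<in>{..N}\<inter>{..J}. 2 ^ k * g k)"
      by (intro sum.mono_neutral_right) (auto intro!: g_big)
    also have "\<dots>\<^sup>2 \<le> (\<Sum>k\<in>{..N}\<inter>{..J}. (2 ^ k * g k)\<^sup>2) * card ({..N}\<inter>{..J})"
      using Cauchy_Schwarz_ineq_sum[of "\<lambda>k. 2 ^ k * g k" "\<lambda>_. 1" "{..N}\<inter>{..J}"] by simp
    also have "\<dots> \<le> (\<Sum>k\<le>N. (2 ^ k * g k)\<^sup>2) * card {..J}"
      by (intro mult_mono sum_mono2 of_nat_mono card_mono sum_nonneg) auto
    finally show ?thesis by (simp add: mult.commute)
  qed
  also have "\<dots> \<le> (Suc J) * (d * (real N)\<^sup>2 * close_pairs N)"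
    unfolding g_def by (intro mult_left_mono sum_fnorm_blocks_square) auto
  also have "Suc J \<le> 3 * ln N / ln 2"
  proof -
    have "2 ^ J \<le> N" unfolding J_def using assms by (intro floor_log_exp2_le) auto
    hence "ln (2 ^ J) \<le> ln N" using assms by (subst ln_le_cancel_iff) (auto simp: of_nat_le_iff[of "2 ^ J", where ?'a = real, simplified])
    hence "J * ln 2 \<le> ln N" by (simp add: ln_realpow)
    moreover have "ln 2 \<le> ln N" using assms by (subst ln_le_cancel_iff) auto
    ultimately have "(Suc J) * ln 2 \<le> 3 * ln N" using lnN by (simp add: algebra_simps)
    thus ?thesis by (simp add: field_simps)
  qed
  also have "3 * ln N / ln 2 \<le> 4.5 * ln N"
  proof -
    have "ln (2::real) \<ge> 2/3" using ln2_ge_two_thirds by simp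
    thus ?thesis using lnN by (simp add: field_simps)
  qed
  finally have sq: "(\<Sum>k\<le>N. 2 ^ k * g k)\<^sup>2 \<le> 4.5 * ln N * (d * (real N)\<^sup>2 * close_pairs N)"
    by (simp add: close_pairs_nonneg mult_right_mono)
  have "(fnorm {1..N} * ln N)\<^sup>2 \<le> (8 * (\<Sum>k\<le>N. 2 ^ k * g k) + sqrt d * N)\<^sup>2"
    using main lnN by (intro power_mono) auto
  also have "\<dots> \<le> 2 * (8 * (\<Sum>k\<le>N. 2 ^ k * g k))\<^sup>2 + 2 * (sqrt d * N)\<^sup>2"
    by (rule power2_sum_le)
  also have "\<dots> \<le> 128 * (4.5 * ln N * (d * (real N)\<^sup>2 * close_pairs N)) + 2 * (d * (real N)\<^sup>2)"
  proof -
    have "2 * (8 * (\<Sum>k\<le>N. 2 ^ k * g k))\<^sup>2 + 2 * (sqrt d * N)\<^sup>2 = 128 * (\<Sum>k\<le>N. 2 ^ k * g k)\<^sup>2 + 2 * (d * (real N)\<^sup>2)"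
      by (simp add: power_mult_distrib)
    also have "\<dots> \<le> 128 * (4.5 * ln N * (d * (real N)\<^sup>2 * close_pairs N)) + 2 * (d * (real N)\<^sup>2)"
      by (intro add_mono mult_left_mono sq) auto
    finally show ?thesis .
  qed
  \<comment> \<open>Here 128 * 4.5 = 576.\<close>
  also have "\<dots> \<le> 600 * ln N * (d * (real N)\<^sup>2 * close_pairs N) + 2 * (d * (real N)\<^sup>2)"
    using lnN close_pairs_nonneg[of N] by (simp add: mult_right_mono)
  also have "\<dots> = (d * (real N)\<^sup>2 * (600 / ln N * close_pairs N + 2 / (ln N)\<^sup>2)) * (ln N)\<^sup>2"
    using lnN by (simp add: field_simps power2_eq_square)
  finally show ?thesis using lnN unfolding power_mult_distrib by (simp add: mult_le_cancel_right)
qed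

end

section \<open>Euler's product\<close>

text \<open>This is n^(-s), with the minus sign built in. The real logarithm makes it multiplicative
  in n without choosing branches.\<close>

definition npow :: "complex \<Rightarrow> nat \<Rightarrow> complex" where
  "npow s n = exp (- (s * of_real (ln (real n))))"

lemma npow_mult: "m \<ge> 1 \<Longrightarrow> n \<ge> 1 \<Longrightarrow> npow s (m * n) = npow s m * npow s n"
  by (simp add: npow_def ln_mult algebra_simps flip: exp_add)

lemma npow_1 [simp]: "npow s (Suc 0) = 1"
  by (simp add: npow_def)

lemma norm_npow: "n \<ge> 1 \<Longrightarrow> cmod (npow s n) = real n powr (- Re s)"
  by (simp add: npow_def powr_def)

definition zeta_sum :: "complex \<Rightarrow> complex" where
  "zeta_sum s = (\<Sum>n. npow s (Suc n))"

lemma summable_norm_npow: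
  assumes "Re s > 1" shows "summable (\<lambda>n. cmod (npow s (Suc n)))"
proof -
  have "summable (\<lambda>n. real n powr (- Re s))"
    using assms by (simp add: summable_real_powr_iff)
  hence "summable (\<lambda>n. real (Suc n) powr (- Re s))" by (subst summable_Suc_iff)
  thus ?thesis by (simp only: norm_npow le_add1 Suc_eq_plus1_left)
qed

lemma npow_has_sum:
  assumes "Re s > 1" shows "(npow s has_sum zeta_sum s) {1..}"
proof -
  have "((\<lambda>n. npow s (Suc n)) has_sum zeta_sum s) UNIV"
    using norm_summable_imp_has_sum[OF summable_norm_npow[OF assms]]
      summable_sums[OF summable_norm_cancel[OF summable_norm_npow[OF assms]]]
    by (simp add: zeta_sum_def)
  hence "((npow s \<circ> Suc) has_sum zeta_sum s) UNIV" by (simp add: o_def)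
  hence "(npow s has_sum zeta_sum s) (range Suc)"
    by (subst has_sum_reindex) auto
  also have "range Suc = {1..}" by (auto simp: image_iff Suc_le_eq gr0_conv_Suc)
  finally show ?thesis .
qed

definition sifted :: "nat set \<Rightarrow> nat set" where
  "sifted P = {n. n \<ge> 1 \<and> (\<forall>p\<in>P. \<not> p dvd n)}"

text \<open>Sieving by one more prime p removes exactly p times the current sifted set, which
  multiplies the sum by 1 - p^(-s).\<close>

lemma npow_has_sum_sifted:
  assumes s: "Re s > 1" and P: "finite P" "\<And>p. p \<in> P \<Longrightarrow> prime p"
  shows "(npow s has_sum (zeta_sum s * (\<Prod>p\<in>P. 1 - npow s p))) (sifted P)"
  using P
proof (induction P rule: finite_induct)
  case empty
  have "sifted {} = {1..}" by (auto simp: sifted_def)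
  thus ?case using npow_has_sum[OF s] by simp
next
  case (insert p P)
  let ?S = "zeta_sum s * (\<Prod>p\<in>P. 1 - npow s p)"
  have p: "prime p" "p \<ge> 1" using insert.prems prime_gt_0_nat[of p] by (auto simp: Suc_le_eq)
  have IH: "(npow s has_sum ?S) (sifted P)" using insert by auto
  have "((\<lambda>n. npow s p * npow s n) has_sum (npow s p * ?S)) (sifted P)"
    by (rule has_sum_cmult_right[OF IH])
  hence "((npow s \<circ> (\<lambda>n. p * n)) has_sum (npow s p * ?S)) (sifted P)"
    by (rule has_sum_cong[THEN iffD1, rotated]) (use p in \<open>auto simp: sifted_def npow_mult\<close>)
  hence "(npow s has_sum (npow s p * ?S)) ((\<lambda>n. p * n) ` sifted P)"
    using p by (subst has_sum_reindex) (auto simp: inj_on_def)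
  moreover have sub: "(\<lambda>n. p * n) ` sifted P \<subseteq> sifted P"
  proof safe
    fix n assume n: "n \<in> sifted P"
    have "\<not> q dvd p * n" if q: "q \<in> P" for q
    proof
      assume "q dvd p * n"
      hence "q dvd p \<or> q dvd n" using insert.prems q by (simp add: prime_dvd_mult_iff)
      hence "q = p" using n q insert.prems primes_dvd_imp_eq[of q p] by (auto simp: sifted_def)
      thus False using q insert.hyps by simp
    qed
    thus "p * n \<in> sifted P" using n p by (auto simp: sifted_def)
  qed
  ultimately have "(npow s has_sum (?S - npow s p * ?S)) (sifted P - (\<lambda>n. p * n) ` sifted P)"
    using IH by (intro has_sum_Diff)
  also have "sifted P - (\<lambda>n. p * n) ` sifted P = sifted (insert p P)"
  proof (intro equalityI subsetI)
    fix n assume n: "n \<in> sifted P - (\<lambda>n. p * n) ` sifted P"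
    have "\<not> p dvd n"
    proof
      assume "p dvd n"
      then obtain k where k: "n = p * k" by blast
      hence "k \<in> sifted P" using n by (auto simp: sifted_def)
      thus False using n k by auto
    qed
    thus "n \<in> sifted (insert p P)" using n by (auto simp: sifted_def)
  qed (auto simp: sifted_def)
  also have "?S - npow s p * ?S = zeta_sum s * (\<Prod>p\<in>insert p P. 1 - npow s p)"
    using insert.hyps by (simp add: algebra_simps)
  finally show ?case .
qed

text \<open>After sieving by all primes up to K only n = 1 and some n > K survive, so the distance
  to 1 is at most a tail of the absolutely convergent series.\<close>

lemma euler_product_limit:
  assumes s: "Re s > 1"
  shows "(\<lambda>K. zeta_sum s * (\<Prod>p | prime p \<and> p \<le> K. 1 - npow s p)) \<longlonglongrightarrow> 1"
proof (rule LIMSEQ_I)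
  fix r :: real assume r: "r > 0"
  have "\<exists>N. \<forall>n\<ge>N. norm (\<Sum>i. cmod (npow s (Suc (i + n)))) < r"
    using suminf_exist_split[OF r summable_norm_npow[OF s]] by simp
  then obtain N where N: "\<And>n. n \<ge> N \<Longrightarrow> norm (\<Sum>i. cmod (npow s (Suc (i + n)))) < r" by blast
  show "\<exists>no. \<forall>n\<ge>no. norm (zeta_sum s * (\<Prod>p | prime p \<and> p \<le> n. 1 - npow s p) - 1) < r"
  proof (intro exI allI impI)
    fix K assume K: "K \<ge> Suc N"
    define P where "P = {p. prime p \<and> p \<le> K}"
    have finP: "finite P" unfolding P_def by (rule finite_subset[of _ "{..K}"]) auto
    let ?S = "zeta_sum s * (\<Prod>p\<in>P. 1 - npow s p)"
    have "(npow s has_sum ?S) (sifted P)"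
      using finP by (intro npow_has_sum_sifted s) (auto simp: P_def)
    moreover have "1 \<in> sifted P" by (auto simp: sifted_def P_def)
    ultimately have hs: "(npow s has_sum (?S - 1)) (sifted P - {1})"
      using has_sum_Diff[of "npow s" "sifted P" ?S "{1}" 1] has_sum_finite[of "{1}" "npow s"] by simp
    have sub: "sifted P - {1} \<subseteq> (\<lambda>i. Suc (i + K)) ` UNIV"
    proof
      fix n assume n: "n \<in> sifted P - {1}"
      then obtain p where p: "prime p" "p dvd n" using prime_factor_nat[of n] by auto
      hence "p > K" using n by (auto simp: sifted_def P_def)
      moreover have "p \<le> n" using p n by (auto intro!: dvd_imp_le simp: sifted_def)
      ultimately show "n \<in> (\<lambda>i. Suc (i + K)) ` UNIV"
        by (intro image_eqI[of _ _ "n - Suc K"]) auto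
    qed
    have sm: "summable (\<lambda>i. cmod (npow s (Suc (i + K))))"
      using summable_norm_npow[OF s] summable_iff_shift[of "\<lambda>n. cmod (npow s (Suc n))" K] by simp
    have "((\<lambda>i. cmod (npow s (Suc (i + K)))) has_sum (\<Sum>i. cmod (npow s (Suc (i + K))))) UNIV"
      using norm_summable_imp_has_sum[of "\<lambda>i. cmod (npow s (Suc (i + K)))"] sm summable_sums[OF sm] by simp
    hence "(((\<lambda>n. cmod (npow s n)) \<circ> (\<lambda>i. Suc (i + K))) has_sum (\<Sum>i. cmod (npow s (Suc (i + K))))) UNIV"
      by (simp add: o_def)
    hence hs2: "((\<lambda>n. cmod (npow s n)) has_sum (\<Sum>i. cmod (npow s (Suc (i + K))))) (range (\<lambda>i. Suc (i + K)))"
      by (subst has_sum_reindex) (auto simp: inj_on_def)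
    hence "(\<lambda>n. cmod (npow s n)) summable_on (sifted P - {1})"
      using sub summable_on_subset_banach summable_on_def by blast
    then obtain b where b: "((\<lambda>n. cmod (npow s n)) has_sum b) (sifted P - {1})"
      by (auto simp: summable_on_def)
    have "cmod (?S - 1) \<le> b" using norm_has_sum_bound[OF b hs] .
    also have "b \<le> (\<Sum>i. cmod (npow s (Suc (i + K))))"
      using has_sum_mono2[OF b hs2 sub] by simp
    also have "\<dots> < r" using N[of K] K by simp
    finally show "norm (zeta_sum s * (\<Prod>p | prime p \<and> p \<le> K. 1 - npow s p) - 1) < r"
      by (simp add: P_def)
  qed
qed

lemma ln_norm_one_minus:
  fixes z :: complex
  assumes "norm z \<le> 1/2"
  shows "\<bar>ln (cmod (1 - z)) + Re z\<bar> \<le> 2 * (cmod z)\<^sup>2"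
proof -
  have "1 - z \<noteq> 0" using assms by auto
  hence "ln (cmod (1 - z)) = Re (Ln (1 + (- z)))" by simp
  hence "\<bar>ln (cmod (1 - z)) + Re z\<bar> \<le> cmod (Ln (1 + (- z)) - (- z))"
    using abs_Re_le_cmod[of "Ln (1 + (- z)) - (- z)"] by simp
  also have "\<dots> \<le> (cmod z)\<^sup>2 / (1 - cmod z)"
    using Ln_approx_linear[of "-z"] assms by simp
  also have "\<dots> \<le> (cmod z)\<^sup>2 / (1/2)"
    using assms by (intro divide_left_mono) auto
  finally show ?thesis by simp
qed

lemma sum_inverse_squares_le: 
  assumes "finite A" "\<And>n. n \<in> A \<Longrightarrow> n \<ge> 2"
  shows "(\<Sum>n\<in>A. 1 / (real n)\<^sup>2) \<le> 1"
proof -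
  have *: "(\<Sum>n\<in>{2..K}. 1 / (real n)\<^sup>2) \<le> 1 - 1 / K" if "K \<ge> 1" for K
    using that
  proof (induction K rule: nat_induct_at_least)
    case (Suc K)
    have "1 / (real (Suc K))\<^sup>2 \<le> 1 / K - 1 / Suc K"
    proof -
      have "1 / (real (Suc K))\<^sup>2 \<le> 1 / (real K * real (Suc K))"
        unfolding power2_eq_square using Suc.hyps by (intro divide_left_mono mult_right_mono) auto
      also have "\<dots> = 1 / K - 1 / Suc K" using Suc.hyps by (simp add: field_simps)
      finally show ?thesis .
    qed
    thus ?case using Suc by simp
  qed auto
  define K where "K = Max (insert 1 A)"
  have "K \<ge> 1" using assms by (auto simp: K_def)
  have "(\<Sum>n\<in>A. 1 / (real n)\<^sup>2) \<le> (\<Sum>n\<in>{2..K}. 1 / (real n)\<^sup>2)"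
    using assms by (intro sum_mono2) (auto simp: K_def)
  also have "\<dots> \<le> 1 - 1 / K" using *[OF \<open>K \<ge> 1\<close>] .
  also have "\<dots> \<le> 1" by simp
  finally show ?thesis .
qed

text \<open>Once the sifted sum is within 1/2 of 1 it is nonzero and its logarithm has size at most
  1; replacing ln |1 - p^(-s)| by - Re p^(-s) costs at most 2 / p^2 per prime, hence 2 in total. The
  bound 3 is uniform in s, and cutting off at a large K avoids infinite sums over primes.\<close>

lemma ln_zeta_prime_sum:
  assumes s: "Re s > 1"
  shows "zeta_sum s \<noteq> 0"
    and "\<forall>\<^sub>F K in sequentially. \<bar>ln (cmod (zeta_sum s)) - (\<Sum>p | prime p \<and> p \<le> K. Re (npow s p))\<bar> \<le> 3"
proof -
  have "\<forall>\<^sub>F K in sequentially. dist (zeta_sum s * (\<Prod>p | prime p \<and> p \<le> K. 1 - npow s p)) 1 < 1/2"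
    using euler_product_limit[OF s] by (rule tendstoD) auto
  hence ev: "\<forall>\<^sub>F K in sequentially. zeta_sum s \<noteq> 0 \<and> \<bar>ln (cmod (zeta_sum s)) - (\<Sum>p | prime p \<and> p \<le> K. Re (npow s p))\<bar> \<le> 3"
  proof eventually_elim
    case (elim K)
    define P where "P = {p. prime p \<and> p \<le> K}"
    have finP: "finite P" unfolding P_def by (rule finite_subset[of _ "{..K}"]) auto
    have P2: "p \<ge> 2" if "p \<in> P" for p using that prime_ge_2_nat by (auto simp: P_def)
    define w where "w = zeta_sum s * (\<Prod>p\<in>P. 1 - npow s p)"
    have w: "cmod (w - 1) < 1/2" using elim by (simp add: w_def P_def dist_norm)
    have lower: "cmod w \<ge> 1/2" using w norm_triangle_ineq2[of 1 "1 - w"] by (simp add: norm_minus_commute)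
    have upper: "cmod w \<le> 2" using w norm_triangle_ineq2[of w 1] by simp
    have "w \<noteq> 0" using lower by auto
    hence nz: "zeta_sum s \<noteq> 0" "\<And>p. p \<in> P \<Longrightarrow> 1 - npow s p \<noteq> 0"
      using finP by (auto simp: w_def)
    have npw: "cmod (npow s p) \<le> 1 / p" if "p \<in> P" for p
    proof -
      have "cmod (npow s p) = real p powr (- Re s)" using P2[OF that] by (intro norm_npow) auto
      also have "\<dots> \<le> real p powr (-1)" using P2[OF that] s by (intro powr_mono) auto
      also have "\<dots> = 1 / p" using P2[OF that] by (simp add: powr_minus_divide)
      finally show ?thesis .
    qed
    have "ln (cmod w) = ln (cmod (zeta_sum s)) + (\<Sum>p\<in>P. ln (cmod (1 - npow s p)))"
    proof -
      have "cmod w = cmod (zeta_sum s) * (\<Prod>p\<in>P. cmod (1 - npow s p))"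
        by (simp add: w_def norm_mult prod_norm)
      moreover have "(\<Prod>p\<in>P. cmod (1 - npow s p)) > 0" using nz by (intro prod_pos) auto
      ultimately have "ln (cmod w) = ln (cmod (zeta_sum s)) + ln (\<Prod>p\<in>P. cmod (1 - npow s p))"
        using nz by (simp add: ln_mult)
      also have "ln (\<Prod>p\<in>P. cmod (1 - npow s p)) = (\<Sum>p\<in>P. ln (cmod (1 - npow s p)))"
        using nz finP by (intro ln_prod) auto
      finally show ?thesis .
    qed
    hence "ln (cmod (zeta_sum s)) - (\<Sum>p\<in>P. Re (npow s p)) =
             ln (cmod w) - (\<Sum>p\<in>P. ln (cmod (1 - npow s p)) + Re (npow s p))"
      by (simp add: sum.distrib)
    moreover have "\<bar>ln (cmod w)\<bar> \<le> 1"
    proof -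
      have "ln (cmod w) \<le> ln 2" using upper lower by (subst ln_le_cancel_iff) auto
      moreover have "ln (1/2) \<le> ln (cmod w)" using lower by (subst ln_le_cancel_iff) auto
      ultimately show ?thesis using ln2_le_25_over_36 by (simp add: ln_div)
    qed
    moreover have "\<bar>\<Sum>p\<in>P. ln (cmod (1 - npow s p)) + Re (npow s p)\<bar> \<le> 2"
    proof -
      have "\<bar>\<Sum>p\<in>P. ln (cmod (1 - npow s p)) + Re (npow s p)\<bar> \<le> (\<Sum>p\<in>P. \<bar>ln (cmod (1 - npow s p)) + Re (npow s p)\<bar>)"
        by (rule sum_abs)
      also have "\<dots> \<le> (\<Sum>p\<in>P. 2 * (1 / (real p)\<^sup>2))"
      proof (intro sum_mono)
        fix p assume p: "p \<in> P"
        have "1 / real p \<le> 1/2" using P2[OF p] by (simp add: field_simps)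
        hence "\<bar>ln (cmod (1 - npow s p)) + Re (npow s p)\<bar> \<le> 2 * (cmod (npow s p))\<^sup>2"
          using npw[OF p] by (intro ln_norm_one_minus) auto
        also have "\<dots> \<le> 2 * (1 / real p)\<^sup>2"
          using npw[OF p] by (intro mult_left_mono power_mono) auto
        finally show "\<bar>ln (cmod (1 - npow s p)) + Re (npow s p)\<bar> \<le> 2 * (1 / (real p)\<^sup>2)" by (simp add: power_divide)
      qed
      also have "\<dots> = 2 * (\<Sum>p\<in>P. 1 / (real p)\<^sup>2)" by (simp add: sum_distrib_left)
      also have "\<dots> \<le> 2 * 1" using sum_inverse_squares_le[OF finP P2] by (intro mult_left_mono) auto
      finally show ?thesis by simp
    qed
    ultimately show ?case using nz(1) unfolding P_def by linarith
  qed
  show "\<forall>\<^sub>F K in sequentially. \<bar>ln (cmod (zeta_sum s)) - (\<Sum>p | prime p \<and> p \<le> K. Re (npow s p))\<bar> \<le> 3"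
    using ev by eventually_elim auto
  from ev have "\<exists>K. zeta_sum s \<noteq> 0"
    using eventually_happens'[OF sequentially_bot ev] by blast
  thus "zeta_sum s \<noteq> 0" by simp
qed

section \<open>The zeta function near the line of real part 1\<close>

text \<open>This is (s - 1) times the difference between n^(-s) and the integral of u^(-s) over
  [n, n+1], written without a division by s - 1.\<close>

definition zeta_term :: "nat \<Rightarrow> complex \<Rightarrow> complex" where
  "zeta_term n s = (s - 1) * npow s n - npow (s - 1) n + npow (s - 1) (Suc n)"

text \<open>The function (s - 1) zeta(s), in a form that converges on the line of real part 1 as
  well. The terms n^(1-s) telescope to -1 where Re s > 1, which the leading 1 compensates.\<close>

definition zeta_reg :: "complex \<Rightarrow> complex" where
  "zeta_reg s = 1 + (\<Sum>n. zeta_term (Suc n) s)"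

definition zeta_term_deriv :: "nat \<Rightarrow> complex \<Rightarrow> complex" where
  "zeta_term_deriv n s = npow s n - (s - 1) * of_real (ln n) * npow s n
     + of_real (ln n) * npow (s - 1) n - of_real (ln (Suc n)) * npow (s - 1) (Suc n)"

lemma has_field_derivative_npow [derivative_intros]:
  assumes "(g has_field_derivative g') (at s within A)"
  shows "((\<lambda>s. npow (g s) n) has_field_derivative - (g' * of_real (ln n) * npow (g s) n)) (at s within A)"
proof -
  have "((\<lambda>s. - (g s * of_real (ln n))) has_field_derivative - (g' * of_real (ln n))) (at s within A)"
    using assms by (intro DERIV_minus DERIV_cmult_right)
  from DERIV_chain2[OF DERIV_exp this] show ?thesis by (simp add: npow_def mult_ac)
qed

lemma zeta_term_has_deriv: "(zeta_term n has_field_derivative zeta_term_deriv n s) (at s within A)"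
proof -
  have 1: "((\<lambda>s. s - 1) has_field_derivative 1) (at s within A)"
    by (intro derivative_eq_intros) auto
  have "(zeta_term n has_field_derivative
          (1 * npow s n + - (1 * of_real (ln n) * npow s n) * (s - 1)) -
          - (1 * of_real (ln n) * npow (s - 1) n) + - (1 * of_real (ln (Suc n)) * npow (s - 1) (Suc n))) (at s within A)"
    unfolding zeta_term_def
    by (intro DERIV_add DERIV_diff DERIV_mult has_field_derivative_npow 1 DERIV_ident)
  thus ?thesis by (simp add: zeta_term_deriv_def algebra_simps)
qed

lemma npow_0 [simp]: "npow 0 n = 1"
  by (simp add: npow_def)

lemma zeta_term_1 [simp]: "zeta_term n 1 = 0"
  by (simp add: zeta_term_def)

text \<open>The derivative is a first-order Taylor remainder, from n to n + 1, of the function u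
  \<mapsto> - u^(1-s) ln u. The second derivative of that function is of order u^(-2) (1 + ln u) for
  bounded s, and half a power of u absorbs the logarithm.\<close>

lemma norm_zeta_term_deriv_le:
  assumes n: "n \<ge> 1" and s: "Re s \<ge> 1" "cmod s \<le> B"
  shows "cmod (zeta_term_deriv n s) \<le> 6 * (1 + B)\<^sup>2 * real n powr (-3/2)"
proof -
  define g :: "nat \<Rightarrow> complex \<Rightarrow> complex" where
    "g = (\<lambda>i z. if i = 0 then - (Ln z * exp ((1 - s) * Ln z))
            else if i = 1 then - (exp (- s * Ln z) * (1 + (1 - s) * Ln z))
            else - (exp ((- s - 1) * Ln z) * (- s * (1 + (1 - s) * Ln z) + (1 - s))))"
  define S where "S = closed_segment (complex_of_real n) (complex_of_real (Suc n))"
  have S: "\<exists>u. z = of_real u \<and> real n \<le> u \<and> u \<le> real (Suc n)" if "z \<in> S" for z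
  proof -
    from that obtain u where u: "0 \<le> u" "u \<le> 1" "z = (1 - u) *\<^sub>R complex_of_real n + u *\<^sub>R complex_of_real (Suc n)"
      by (auto simp: S_def closed_segment_def)
    have "z = of_real (real n + u)" by (simp add: u(3) scaleR_conv_of_real algebra_simps)
    thus ?thesis using u by (intro exI[of _ "real n + u"]) auto
  qed
  have exp_shift: "exp ((c - 1) * Ln z) = exp (c * Ln z) / z" if "z \<noteq> 0" for c z
    using that by (simp add: left_diff_distrib exp_diff)
  have "cmod (g 0 (of_nat (Suc n)) - (\<Sum>i\<le>1. g i (of_nat n) * (of_nat (Suc n) - of_nat n) ^ i / fact i))
          \<le> (6 * (1 + B)\<^sup>2 * real n powr (-3/2)) * cmod (of_nat (Suc n) - of_nat n) ^ Suc 1 / fact 1"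
  proof (rule complex_Taylor)
    show "convex S" by (simp add: S_def)
    show "of_nat n \<in> S" "of_nat (Suc n) \<in> S" by (simp_all add: S_def)
    fix i z assume z: "z \<in> S" and i: "i \<le> (1::nat)"
    from S[OF z] obtain u where u: "z = of_real u" "real n \<le> u" by blast
    have z0: "z \<notin> \<real>\<^sub>\<le>\<^sub>0" "z \<noteq> 0" using u n by auto
    from i consider "i = 0" | "i = 1" by linarith
    thus "(g i has_field_derivative g (Suc i) z) (at z within S)"
    proof cases
      case 1
      have "((\<lambda>z. - (Ln z * exp ((1 - s) * Ln z))) has_field_derivative
              - (inverse z * exp ((1 - s) * Ln z) + Ln z * (exp ((1 - s) * Ln z) * ((1 - s) * inverse z)))) (at z within S)"
        using z0 by (auto intro!: derivative_eq_intros simp: field_simps)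
      also have "- (inverse z * exp ((1 - s) * Ln z) + Ln z * (exp ((1 - s) * Ln z) * ((1 - s) * inverse z))) = g 1 z"
        using exp_shift[OF z0(2), of "1 - s"] by (simp add: g_def divide_inverse algebra_simps)
      finally show ?thesis using 1 by (simp add: g_def)
    next
      case 2
      have "((\<lambda>z. - (exp (- s * Ln z) * (1 + (1 - s) * Ln z))) has_field_derivative
              - (exp (- s * Ln z) * (- s * inverse z) * (1 + (1 - s) * Ln z) + exp (- s * Ln z) * ((1 - s) * inverse z))) (at z within S)"
        using z0 by (auto intro!: derivative_eq_intros simp: field_simps)
      also have "- (exp (- s * Ln z) * (- s * inverse z) * (1 + (1 - s) * Ln z) + exp (- s * Ln z) * ((1 - s) * inverse z)) = g 2 z"
        using exp_shift[OF z0(2), of "- s"] by (simp add: g_def divide_inverse algebra_simps)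
      finally show ?thesis using 2 by (simp add: g_def numeral_2_eq_2)
    qed
  next
    fix z assume z: "z \<in> S"
    from S[OF z] obtain u where u: "z = of_real u" "real n \<le> u" "u \<le> real (Suc n)" by blast
    have u1: "u \<ge> 1" using u n by linarith
    have Ln: "Ln z = of_real (ln u)" using u u1 by (simp add: Ln_of_real)
    \<comment> \<open>From ln v \<le> v - 1 at v = sqrt u, together with u \<le> 2 n.\<close>
    have sq: "1 + ln u \<le> 3 * sqrt n"
    proof -
      have "ln (sqrt u) \<le> sqrt u - 1" using u1 by (intro ln_le_minus_one) auto
      hence "1 + ln u \<le> 2 * sqrt u" using u1 by (simp add: ln_sqrt)
      also have "\<dots> \<le> 2 * sqrt (2 * n)" using u n by (intro mult_left_mono real_sqrt_le_mono) auto
      also have "\<dots> \<le> 3 * sqrt n"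
        by (rule power2_le_imp_le) (auto simp: power_mult_distrib)
      finally show ?thesis .
    qed
    have B: "B \<ge> 1" using s complex_Re_le_cmod[of s] by linarith
    have s1: "cmod (1 - s) \<le> 1 + B" using norm_triangle_ineq4[of 1 s] s by simp
    have "cmod (exp ((- s - 1) * Ln z)) = u powr (- Re s - 1)"
      using u1 by (simp add: Ln powr_def algebra_simps)
    also have "\<dots> \<le> u powr (-2)" using u1 s by (intro powr_mono) auto
    also have "\<dots> \<le> real n powr (-2)" using u n by (intro powr_mono2') auto
    finally have 1: "cmod (exp ((- s - 1) * Ln z)) \<le> real n powr (-2)" .
    have "cmod (- s * (1 + (1 - s) * Ln z) + (1 - s)) \<le> cmod s * (1 + cmod (1 - s) * ln u) + cmod (1 - s)"
      using norm_triangle_ineq[of "- s * (1 + (1 - s) * Ln z)" "1 - s"] norm_triangle_ineq[of 1 "(1 - s) * Ln z"] u1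
      by (simp add: norm_mult Ln) (smt (verit) mult_left_mono norm_ge_zero)
    also have "\<dots> \<le> B * (1 + (1 + B) * ln u) + (1 + B)"
      using s s1 u1 B by (intro add_mono mult_mono order_refl) auto
    also have "\<dots> \<le> (1 + B) * ((1 + B) * (1 + ln u)) + (1 + B) * ((1 + B) * (1 + ln u))"
    proof (intro add_mono mult_mono)
      show "1 + (1 + B) * ln u \<le> (1 + B) * (1 + ln u)" using B by (simp add: algebra_simps)
      have "(1 + B) * 1 \<le> (1 + B) * ((1 + B) * (1 + ln u))"
        using B u1 mult_mono[of 1 "1 + B" 1 "1 + ln u"] by (intro mult_left_mono) auto
      thus "1 + B \<le> (1 + B) * ((1 + B) * (1 + ln u))" by simp
    qed (use B u1 in auto)
    also have "\<dots> = 2 * (1 + B)\<^sup>2 * (1 + ln u)" by (simp add: power2_eq_square)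
    also have "\<dots> \<le> 2 * (1 + B)\<^sup>2 * (3 * sqrt n)" using sq by (intro mult_left_mono) auto
    finally have 2: "cmod (- s * (1 + (1 - s) * Ln z) + (1 - s)) \<le> 2 * (1 + B)\<^sup>2 * (3 * sqrt n)" .
    have "cmod (g (Suc 1) z) = cmod (exp ((- s - 1) * Ln z)) * cmod (- s * (1 + (1 - s) * Ln z) + (1 - s))"
      by (simp add: g_def norm_mult)
    also have "\<dots> \<le> real n powr (-2) * (2 * (1 + B)\<^sup>2 * (3 * sqrt n))"
      by (intro mult_mono 1 2) auto
    also have "\<dots> = 6 * (1 + B)\<^sup>2 * (real n powr (-2) * real n powr (1/2))"
      using n by (simp add: powr_half_sqrt)
    also have "real n powr (-2) * real n powr (1/2) = real n powr (-3/2)"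
      by (simp flip: powr_add)
    finally show "cmod (g (Suc 1) z) \<le> 6 * (1 + B)\<^sup>2 * real n powr (-3/2)" .
  qed
  also have "g 0 (of_nat (Suc n)) - (\<Sum>i\<le>1. g i (of_nat n) * (of_nat (Suc n) - of_nat n) ^ i / fact i) = zeta_term_deriv n s"
  proof -
    have L: "Ln (of_nat k) = of_real (ln k)" if "k \<ge> 1" for k :: nat
      using that Ln_of_real[of k] by simp
    have L': "Ln (1 + of_nat n) = of_real (ln (1 + real n))" using L[of "Suc n"] by simp
    show ?thesis using n
      by (simp add: g_def zeta_term_deriv_def npow_def L L' algebra_simps)
  qed
  finally show ?thesis by simp
qed

lemma summable_powr_3_2: "summable (\<lambda>n. real (Suc n) powr (-3/2))"
proof -
  have "summable (\<lambda>n. real n powr (-3/2))"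
    unfolding summable_real_powr_iff by simp
  thus ?thesis by (subst summable_Suc_iff)
qed

lemma zeta_term_lipschitz:
  assumes n: "n \<ge> 1" and s: "Re s \<ge> 1" "cmod s \<le> B" and w: "Re w \<ge> 1" "cmod w \<le> B"
  shows "cmod (zeta_term n s - zeta_term n w) \<le> 6 * (1 + B)\<^sup>2 * real n powr (-3/2) * cmod (s - w)"
proof (rule field_differentiable_bound)
  let ?S = "{s. Re s \<ge> 1} \<inter> cball 0 B"
  show "convex ?S" by (intro convex_Int convex_halfspace_Re_ge convex_cball)
  show "s \<in> ?S" "w \<in> ?S" using assms by auto
  show "(zeta_term n has_field_derivative zeta_term_deriv n z) (at z within ?S)" for z
    by (rule zeta_term_has_deriv)
  show "cmod (zeta_term_deriv n z) \<le> 6 * (1 + B)\<^sup>2 * real n powr (-3/2)" if "z \<in> ?S" for z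
    using that n by (intro norm_zeta_term_deriv_le) auto
qed

lemma summable_zeta_term:
  assumes "Re s \<ge> 1" shows "summable (\<lambda>n. zeta_term (Suc n) s)"
proof (rule summable_comparison_test)
  define B where "B = cmod s + 1"
  show "summable (\<lambda>n. 6 * (1 + B)\<^sup>2 * cmod (s - 1) * real (Suc n) powr (-3/2))"
    by (intro summable_mult summable_powr_3_2)
  show "\<exists>N. \<forall>n\<ge>N. norm (zeta_term (Suc n) s) \<le> 6 * (1 + B)\<^sup>2 * cmod (s - 1) * real (Suc n) powr (-3/2)"
    using zeta_term_lipschitz[of "Suc n" s B 1 for n] assms by (auto simp: B_def mult_ac)
qed

text \<open>The quadratic growth in B becomes the term \<open>2 * ln (3 + \<bar>t\<bar>)\<close> in
  the bound for cosine sums over primes.\<close>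

lemma zeta_reg_lipschitz:
  obtains C where "C \<ge> 1" "\<And>s w B. Re s \<ge> 1 \<Longrightarrow> cmod s \<le> B \<Longrightarrow> Re w \<ge> 1 \<Longrightarrow> cmod w \<le> B \<Longrightarrow>
    cmod (zeta_reg s - zeta_reg w) \<le> C * (1 + B)\<^sup>2 * cmod (s - w)"
proof -
  define D where "D = (\<Sum>n. real (Suc n) powr (-3/2))"
  have "cmod (zeta_reg s - zeta_reg w) \<le> max 1 (6 * D) * (1 + B)\<^sup>2 * cmod (s - w)"
    if *: "Re s \<ge> 1" "cmod s \<le> B" "Re w \<ge> 1" "cmod w \<le> B" for s w B
  proof -
    let ?b = "\<lambda>n. 6 * (1 + B)\<^sup>2 * cmod (s - w) * real (Suc n) powr (-3/2)"
    have "zeta_reg s - zeta_reg w = (\<Sum>n. zeta_term (Suc n) s - zeta_term (Suc n) w)"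
      using suminf_diff[OF summable_zeta_term summable_zeta_term] * by (simp add: zeta_reg_def)
    also have "cmod \<dots> \<le> suminf ?b"
    proof (rule norm_suminf_le)
      show "summable ?b" by (intro summable_mult summable_powr_3_2)
      show "norm (zeta_term (Suc n) s - zeta_term (Suc n) w) \<le> ?b n" for n
        using zeta_term_lipschitz[of "Suc n" s B w] * by (simp add: mult_ac)
    qed
    also have "\<dots> = 6 * D * ((1 + B)\<^sup>2 * cmod (s - w))"
      unfolding D_def by (subst suminf_mult[OF summable_powr_3_2]) simp
    also have "\<dots> \<le> max 1 (6 * D) * ((1 + B)\<^sup>2 * cmod (s - w))"
      by (intro mult_right_mono) auto
    finally show ?thesis by (simp add: mult.assoc)
  qed
  thus ?thesis using that[of "max 1 (6 * D)"] by auto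
qed

lemma zeta_reg_1 [simp]: "zeta_reg 1 = 1"
  by (simp add: zeta_reg_def)

lemma zeta_reg_eq:
  assumes "Re s > 1" shows "zeta_reg s = (s - 1) * zeta_sum s"
proof -
  have "(\<lambda>n. npow s (Suc n)) sums zeta_sum s"
    unfolding zeta_sum_def by (rule summable_sums[OF summable_norm_cancel[OF summable_norm_npow[OF assms]]])
  from sums_mult[OF this, of "s - 1"]
  have 1: "(\<lambda>n. (s - 1) * npow s (Suc n)) sums ((s - 1) * zeta_sum s)" .
  have "(\<lambda>n. npow (s - 1) (Suc n)) \<longlonglongrightarrow> 0"
  proof (rule tendsto_norm_zero_cancel)
    have "filterlim (\<lambda>n. real (Suc n)) at_top sequentially"
      using filterlim_real_sequentially by (simp only: filterlim_sequentially_Suc)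
    hence "(\<lambda>n. real (Suc n) powr (- (Re s - 1))) \<longlonglongrightarrow> 0"
      using assms by (intro tendsto_neg_powr) auto
    thus "(\<lambda>n. norm (npow (s - 1) (Suc n))) \<longlonglongrightarrow> 0" by (simp add: norm_npow)
  qed
  from telescope_sums[OF this] have "(\<lambda>n. npow (s - 1) (Suc (Suc n)) - npow (s - 1) (Suc n)) sums (0 - 1)" by simp
  from sums_add[OF 1 this] have "(\<lambda>n. zeta_term (Suc n) s) sums ((s - 1) * zeta_sum s - 1)"
    by (simp add: zeta_term_def algebra_simps)
  thus ?thesis by (simp add: zeta_reg_def sums_unique[symmetric])
qed

section \<open>Sums over primes\<close>

definition primes_le :: "real \<Rightarrow> nat set" where
  "primes_le y = {p. prime p \<and> real p \<le> y}"

lemma finite_primes_le [simp]: "finite (primes_le y)"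
  unfolding primes_le_def by (rule finite_subset[of _ "{..nat \<lfloor>y\<rfloor>}"]) (auto simp: le_nat_floor)

lemma Re_npow: "n \<ge> 1 \<Longrightarrow> Re (npow s n) = real n powr (- Re s) * cos (Im s * ln n)"
  by (simp add: npow_def Re_exp powr_def)

text \<open>At y = e^(1/a) the factor p^(-a) equals 1/e, so the sum of p^(-1-a) cos (t ln p) over
  all primes behaves like the sum of cos (t ln p) / p cut off at y. The cost of the sharp cutoff
  does not depend on t, and is estimated by real values of the zeta function alone.\<close>

lemma zeta_prime_sum_compare:
  obtains C a0 where "C \<ge> 1" "0 < a0" "a0 \<le> 1"
    "\<And>a y t. 0 < a \<Longrightarrow> a \<le> a0 \<Longrightarrow> y = exp (1 / a) \<Longrightarrow>
       \<bar>(\<Sum>p\<in>primes_le y. cos (t * ln p) / p) - ln (cmod (zeta_sum (Complex (1 + a) t)))\<bar> \<le> C"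
    "\<And>a. 0 < a \<Longrightarrow> a \<le> a0 \<Longrightarrow> \<bar>ln (cmod (zeta_sum (Complex (1 + a) 0))) - ln (1 / a)\<bar> \<le> 1"
proof -
  obtain K where K: "K \<ge> 1" "\<And>s w B. Re s \<ge> 1 \<Longrightarrow> cmod s \<le> B \<Longrightarrow> Re w \<ge> 1 \<Longrightarrow> cmod w \<le> B \<Longrightarrow>
    cmod (zeta_reg s - zeta_reg w) \<le> K * (1 + B)\<^sup>2 * cmod (s - w)"
    using zeta_reg_lipschitz by blast
  \<comment> \<open>Keeps the Lipschitz error 9 K a below 1/2, so that a zeta(1 + a) lies between
    1/2 and 2.\<close>
  define a1 where "a1 = 1 / (32 * K)"
  have a1: "0 < a1" "a1 \<le> 1 / 2" using K(1) by (auto simp: a1_def field_simps)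
  have zreal: "\<bar>ln (cmod (zeta_sum (Complex (1 + a) 0))) - ln (1 / a)\<bar> \<le> 1" if a: "0 < a" "a \<le> a1" for a
  proof -
    let ?s = "Complex (1 + a) 0"
    have s: "?s = of_real (1 + a)" by (simp add: complex_eq_iff)
    have "cmod (zeta_reg ?s - zeta_reg 1) \<le> K * (1 + 2)\<^sup>2 * cmod (?s - 1)"
      using a a1 by (intro K(2)) (auto simp: s simp del: of_real_add)
    also have "cmod (?s - 1) = a" using a by (simp add: s)
    also have "K * (1 + 2)\<^sup>2 * a \<le> K * (1 + 2)\<^sup>2 * a1" using a K(1) by (intro mult_left_mono) auto
    also have "\<dots> \<le> 1/2" using K(1) by (simp add: a1_def)
    finally have 1: "cmod (zeta_reg ?s - 1) \<le> 1/2" by simp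
    have 2: "cmod (zeta_reg ?s) = a * cmod (zeta_sum ?s)"
      using a by (subst zeta_reg_eq) (auto simp: norm_mult s)
    have z0: "zeta_sum ?s \<noteq> 0" using a by (intro ln_zeta_prime_sum) auto
    have "ln (cmod (zeta_sum ?s)) - ln (1 / a) = ln (a * cmod (zeta_sum ?s))"
      using a z0 by (simp add: ln_mult ln_div)
    moreover have "1/2 \<le> a * cmod (zeta_sum ?s)" "a * cmod (zeta_sum ?s) \<le> 2"
      using 1 norm_triangle_ineq2[of 1 "1 - zeta_reg ?s"] norm_triangle_ineq2[of "zeta_reg ?s" 1]
      by (simp_all add: norm_minus_commute flip: 2)
    hence "ln (1/2) \<le> ln (a * cmod (zeta_sum ?s))" "ln (a * cmod (zeta_sum ?s)) \<le> ln 2"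
      by (subst ln_le_cancel_iff; use a z0 in auto)+
    ultimately show ?thesis using ln2_le_25_over_36 by (simp add: ln_div abs_le_iff)
  qed
  \<comment> \<open>Halved because the real zeta value is also needed at 2 a.\<close>
  define a0 where "a0 = a1 / 2"
  have main: "\<bar>(\<Sum>p\<in>primes_le y. cos (t * ln p) / p) - ln (cmod (zeta_sum (Complex (1 + a) t)))\<bar> \<le> 63"
    if a: "0 < a" "a \<le> a0" and y: "y = exp (1 / a)" for a y t
  proof -
    define P where "P = (\<lambda>K. {p::nat. prime p \<and> p \<le> K})"
    have finP: "finite (P K)" for K unfolding P_def by (rule finite_subset[of _ "{..K}"]) auto
    have P1: "p \<ge> 1" "p \<ge> 2" if "p \<in> P K" for p K using that prime_ge_2_nat[of p] by (auto simp: P_def)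
    have "\<forall>\<^sub>F K in sequentially.
        \<bar>ln (cmod (zeta_sum (Complex (1 + a) t))) - (\<Sum>p\<in>P K. Re (npow (Complex (1 + a) t) p))\<bar> \<le> 3 \<and>
        \<bar>ln (cmod (zeta_sum (Complex (1 + a) 0))) - (\<Sum>p\<in>P K. Re (npow (Complex (1 + a) 0) p))\<bar> \<le> 3 \<and>
        \<bar>ln (cmod (zeta_sum (Complex (1 + 2 * a) 0))) - (\<Sum>p\<in>P K. Re (npow (Complex (1 + 2 * a) 0) p))\<bar> \<le> 3 \<and>
        K \<ge> nat \<lceil>y\<rceil>"
      unfolding P_def using a by (intro eventually_conj ln_zeta_prime_sum eventually_ge_at_top) simp_all
    then obtain K where K: "\<bar>ln (cmod (zeta_sum (Complex (1 + a) t))) - (\<Sum>p\<in>P K. Re (npow (Complex (1 + a) t) p))\<bar> \<le> 3"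
      "\<bar>ln (cmod (zeta_sum (Complex (1 + a) 0))) - (\<Sum>p\<in>P K. Re (npow (Complex (1 + a) 0) p))\<bar> \<le> 3"
      "\<bar>ln (cmod (zeta_sum (Complex (1 + 2 * a) 0))) - (\<Sum>p\<in>P K. Re (npow (Complex (1 + 2 * a) 0) p))\<bar> \<le> 3"
      "K \<ge> nat \<lceil>y\<rceil>"
      using eventually_happens'[OF sequentially_bot] by (smt (verit, best))
    have sub: "primes_le y \<subseteq> P K" using K(4) by (auto simp: primes_le_def P_def)
    \<comment> \<open>The one weight p^(-1-a) - p^(-1-2a) controls both errors. For p > y it is at
      least half of p^(-1-a), and for p \<le> y the difference 1/p - p^(-1-a) is p^a \<le> e times
      it. Its total is ln zeta(1+a) - ln zeta(1+2a) up to a constant, which is bounded because the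
      poles contribute ln (1/a) - ln (1/(2a)) = ln 2.\<close>
    let ?w = "\<lambda>p. real p powr (- (1 + a)) * (1 - real p powr (- a))"
    have w0: "?w p \<ge> 0" if "p \<in> P K" for p
    proof -
      have "real p powr (- a) \<le> 1" using P1[OF that] a powr_mono[of "-a" 0 "real p"] by simp
      thus ?thesis by simp
    qed
    have "(\<Sum>p\<in>P K. ?w p) = (\<Sum>p\<in>P K. Re (npow (Complex (1 + a) 0) p)) - (\<Sum>p\<in>P K. Re (npow (Complex (1 + 2 * a) 0) p))"
      unfolding sum_subtractf[symmetric]
    proof (intro sum.cong refl)
      fix p assume p: "p \<in> P K"
      have "real p powr (- (1 + a)) * real p powr (- a) = real p powr (- (1 + 2 * a))"
        by (simp add: algebra_simps flip: powr_add)
      thus "?w p = Re (npow (Complex (1 + a) 0) p) - Re (npow (Complex (1 + 2 * a) 0) p)"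
        using P1[OF p] by (simp add: Re_npow right_diff_distrib)
    qed
    also have "\<dots> \<le> 6 + ln (cmod (zeta_sum (Complex (1 + a) 0))) - ln (cmod (zeta_sum (Complex (1 + 2 * a) 0)))"
      using K(2,3) by linarith
    also have "\<dots> \<le> 8 + ln (1 / a) - ln (1 / (2 * a))"
      using zreal[of a] zreal[of "2 * a"] a a1 by (simp add: a0_def)
    also have "\<dots> = 8 + ln 2" using a by (simp add: ln_div ln_mult)
    finally have W: "(\<Sum>p\<in>P K. ?w p) \<le> 9" using ln2_le_25_over_36 by linarith
    have e1: "1 - exp (-1::real) \<ge> 1/2"
      using exp_ge_add_one_self[of "1::real"] by (simp add: exp_minus field_simps)
    have alny: "a * ln y = 1" using a y by simp
    have y0: "y > 0" by (simp add: y)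
    have 1: "\<bar>\<Sum>p\<in>P K - primes_le y. Re (npow (Complex (1 + a) t) p)\<bar> \<le> 2 * 9"
    proof -
      have "\<bar>\<Sum>p\<in>P K - primes_le y. Re (npow (Complex (1 + a) t) p)\<bar> \<le> (\<Sum>p\<in>P K - primes_le y. \<bar>Re (npow (Complex (1 + a) t) p)\<bar>)"
        by (rule sum_abs)
      also have "\<dots> \<le> (\<Sum>p\<in>P K - primes_le y. 2 * ?w p)"
      proof (intro sum_mono)
        fix p assume p: "p \<in> P K - primes_le y"
        hence py: "real p > y" and p1: "p \<ge> 1" using P1[of p K] by (auto simp: P_def primes_le_def)
        have "ln y \<le> ln p" using py y0 by (subst ln_le_cancel_iff) auto
        hence "a * ln p \<ge> 1" using a alny mult_left_mono[of "ln y" "ln p" a] by simp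
        hence "real p powr (-a) \<le> exp (-1)" using p1 by (simp add: powr_def)
        hence "1 - real p powr (-a) \<ge> 1/2" using e1 by linarith
        have "\<bar>Re (npow (Complex (1 + a) t) p)\<bar> \<le> real p powr (- (1 + a)) * 1"
          using p1 by (simp add: Re_npow abs_mult mult_left_le)
        also have "\<dots> \<le> real p powr (- (1 + a)) * (2 * (1 - real p powr (-a)))"
          using \<open>1 - real p powr (-a) \<ge> 1/2\<close> by (intro mult_left_mono) auto
        also have "\<dots> = 2 * ?w p" by (rule mult.left_commute)
        finally show "\<bar>Re (npow (Complex (1 + a) t) p)\<bar> \<le> 2 * ?w p" .
      qed
      also have "\<dots> \<le> (\<Sum>p\<in>P K. 2 * ?w p)"
        using finP w0 by (intro sum_mono2) auto
      also have "\<dots> = 2 * (\<Sum>p\<in>P K. ?w p)" by (simp add: sum_distrib_left)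
      finally show ?thesis using W by linarith
    qed
    have 2: "\<bar>\<Sum>p\<in>primes_le y. cos (t * ln p) / p - Re (npow (Complex (1 + a) t) p)\<bar> \<le> 3 * 9"
    proof -
      have "\<bar>\<Sum>p\<in>primes_le y. cos (t * ln p) / p - Re (npow (Complex (1 + a) t) p)\<bar> \<le>
              (\<Sum>p\<in>primes_le y. \<bar>cos (t * ln p) / p - Re (npow (Complex (1 + a) t) p)\<bar>)"
        by (rule sum_abs)
      also have "\<dots> \<le> (\<Sum>p\<in>primes_le y. 3 * ?w p)"
      proof (intro sum_mono)
        fix p assume p: "p \<in> primes_le y"
        hence py: "real p \<le> y" and p1: "p \<ge> 1" using sub P1[of p K] by (auto simp: primes_le_def)
        have "ln p \<le> ln y" using py p1 by (subst ln_le_cancel_iff) auto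
        hence "a * ln p \<le> 1" using a alny mult_left_mono[of "ln p" "ln y" a] by simp
        hence "real p powr a \<le> exp 1" using p1 by (simp add: powr_def)
        hence e3: "real p powr a \<le> 3" using exp_le by linarith
        have pos: "1 - real p powr (-a) \<ge> 0" using p1 a powr_mono[of "-a" 0 "real p"] by simp
        have eq1: "1 / real p = real p powr (- (1 + a)) * real p powr a"
          using p1 by (simp add: powr_minus_divide flip: powr_add)
        have "cos (t * ln p) / p - Re (npow (Complex (1 + a) t) p) = cos (t * ln p) * (1 / p - real p powr (- (1 + a)))"
          using p1 by (simp add: Re_npow algebra_simps)
        also have "1 / real p - real p powr (- (1 + a)) = real p powr a * ?w p"
          using p1 by (simp add: eq1 algebra_simps powr_minus)
        finally have "\<bar>cos (t * ln p) / p - Re (npow (Complex (1 + a) t) p)\<bar> \<le> 1 * (real p powr a * ?w p)"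
          using pos by (simp add: abs_mult mult_left_le_one_le)
        also have "\<dots> \<le> 3 * ?w p" using e3 pos by (simp add: mult_right_mono)
        finally show "\<bar>cos (t * ln p) / p - Re (npow (Complex (1 + a) t) p)\<bar> \<le> 3 * ?w p" .
      qed
      also have "\<dots> \<le> (\<Sum>p\<in>P K. 3 * ?w p)"
        using finP w0 sub by (intro sum_mono2) auto
      also have "\<dots> = 3 * (\<Sum>p\<in>P K. ?w p)" by (simp add: sum_distrib_left)
      finally show ?thesis using W by linarith
    qed
    have "(\<Sum>p\<in>P K. Re (npow (Complex (1 + a) t) p)) = (\<Sum>p\<in>primes_le y. Re (npow (Complex (1 + a) t) p)) + (\<Sum>p\<in>P K - primes_le y. Re (npow (Complex (1 + a) t) p))"
      using sum.subset_diff[OF sub finP] by (simp add: add.commute)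
    thus ?thesis using 1 2 K(1) by (simp add: sum_subtractf)
  qed
  show ?thesis
    using that[of 63 a0] main zreal a1 by (auto simp: a0_def)
qed

lemma cmod_Complex_minus_1: "cmod (Complex (1 + a) t - 1) = cmod (Complex a t)"
  by (rule arg_cong[of _ _ cmod]) (simp add: complex_eq_iff)

text \<open>The cosine bound is one-sided: moving from \<open>1 + 1 / ln y\<close> to \<open>1 + 1 / ln z\<close> changes the
  zeta function by a Lipschitz amount, while Euler's product trivially keeps it above \<open>c / ln y\<close> at
  the first point. No zero-free region is involved.\<close>

lemma prime_sum_estimates:
  obtains C Y where "C \<ge> 0" "Y > exp 1"
    "\<And>y z. Y \<le> y \<Longrightarrow> y \<le> z \<Longrightarrow>
       \<bar>(\<Sum>p\<in>primes_le z - primes_le y. 1 / p) - ln (ln z / ln y)\<bar> \<le> C"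
    "\<And>y. Y \<le> y \<Longrightarrow> (\<Sum>p\<in>primes_le y. 1 / p) \<le> ln (ln y) + C"
    "\<And>y z t. Y \<le> y \<Longrightarrow> y \<le> z \<Longrightarrow> 1 / ln y \<le> \<bar>t\<bar> \<Longrightarrow>
       (\<Sum>p\<in>primes_le z - primes_le y. cos (t * ln p) / p) \<le> C + 2 * ln (3 + \<bar>t\<bar>)"
proof -
  obtain C a0 where C: "C \<ge> 1" "0 < a0" "a0 \<le> 1"
    "\<And>a y t. 0 < a \<Longrightarrow> a \<le> a0 \<Longrightarrow> y = exp (1 / a) \<Longrightarrow>
       \<bar>(\<Sum>p\<in>primes_le y. cos (t * ln p) / p) - ln (cmod (zeta_sum (Complex (1 + a) t)))\<bar> \<le> C"
    "\<And>a. 0 < a \<Longrightarrow> a \<le> a0 \<Longrightarrow> \<bar>ln (cmod (zeta_sum (Complex (1 + a) 0))) - ln (1 / a)\<bar> \<le> 1"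
    by (rule zeta_prime_sum_compare) (rule that; assumption)
  obtain K where K: "K \<ge> 1" "\<And>s w B. Re s \<ge> 1 \<Longrightarrow> cmod s \<le> B \<Longrightarrow> Re w \<ge> 1 \<Longrightarrow> cmod w \<le> B \<Longrightarrow>
    cmod (zeta_reg s - zeta_reg w) \<le> K * (1 + B)\<^sup>2 * cmod (s - w)"
    using zeta_reg_lipschitz by blast
  define Y where "Y = exp (1 + 1 / a0)"
  have lnY: "ln y > 1" "y > 1" "1 / ln y \<le> a0" "0 < 1 / ln y" "y = exp (1 / (1 / ln y))" if "y \<ge> Y" for y
  proof -
    have y0: "y > 0" using that less_le_trans[OF exp_gt_zero] by (auto simp: Y_def)
    have "ln y \<ge> 1 + 1 / a0" using that y0 by (simp add: Y_def ln_ge_iff)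
    moreover have "1 / a0 > 0" using C by simp
    ultimately show 1: "ln y > 1" by linarith
    thus "y > 1" using y0 ln_gt_zero_iff[of y] by linarith
    have "ln y \<ge> 1 / a0" using \<open>ln y \<ge> 1 + 1 / a0\<close> by linarith
    thus "1 / ln y \<le> a0" using 1 C by (simp add: field_simps)
    show "0 < 1 / ln y" using 1 by simp
    show "y = exp (1 / (1 / ln y))" using y0 by simp
  qed
  have sub: "primes_le y \<subseteq> primes_le z" if "y \<le> z" for y z using that by (auto simp: primes_le_def)
  have diff: "(\<Sum>p\<in>primes_le z - primes_le y. g p) = (\<Sum>p\<in>primes_le z. g p) - (\<Sum>p\<in>primes_le y. g p)"
    if "y \<le> z" for y z and g :: "nat \<Rightarrow> real"
    using sum_diff[OF finite_primes_le sub[OF that]] by simp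
  \<comment> \<open>Mertens' estimate is the case t = 0, the zeta value at 1 + 1 / ln y being about
    ln y.\<close>
  have mert: "\<bar>(\<Sum>p\<in>primes_le y. 1 / p) - ln (ln y)\<bar> \<le> C + 1" if "y \<ge> Y" for y
    using C(4)[of "1 / ln y" y 0] C(5)[of "1 / ln y"] lnY[OF that] by simp
  define D where "D = max 2 (64 * K * exp (2 * C + 1))"
  have D: "D \<ge> 2" by (simp add: D_def)
  have cosb: "(\<Sum>p\<in>primes_le z - primes_le y. cos (t * ln p) / p) \<le> 2 * C + ln (2 + 2 * K * D) + 2 * ln (3 + \<bar>t\<bar>)"
    if yz: "Y \<le> y" "y \<le> z" and t: "1 / ln y \<le> \<bar>t\<bar>" for y z t
  proof -
    have z: "Y \<le> z" using yz by simp
    define a where "a = 1 / ln z"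
    define b where "b = 1 / ln y"
    have a: "0 < a" "a \<le> a0" "z = exp (1 / a)" using lnY[OF z] by (auto simp: a_def)
    have b: "0 < b" "b \<le> a0" "y = exp (1 / b)" using lnY[OF yz(1)] by (auto simp: b_def)
    have b1: "b \<le> 1" using b C by simp
    have ab: "a \<le> b" unfolding a_def b_def
      using lnY[OF yz(1)] lnY[OF z] yz by (intro divide_left_mono) auto
    have tb: "b \<le> \<bar>t\<bar>" using t by (simp add: b_def)
    hence t0: "\<bar>t\<bar> > 0" using b(1) by linarith
    let ?s = "Complex (1 + a) t" and ?w = "Complex (1 + b) t"
    have zs0: "zeta_sum ?s \<noteq> 0" "zeta_sum ?w \<noteq> 0" using a b by (auto intro!: ln_zeta_prime_sum)
    have regs: "cmod (zeta_reg ?s) = cmod (Complex a t) * cmod (zeta_sum ?s)"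
      "cmod (zeta_reg ?w) = cmod (Complex b t) * cmod (zeta_sum ?w)"
      using a b by (auto simp: zeta_reg_eq norm_mult cmod_Complex_minus_1)
    have lows: "\<bar>t\<bar> \<le> cmod (Complex a t)" "\<bar>t\<bar> \<le> cmod (Complex b t)"
      using abs_Im_le_cmod[of "Complex a t"] abs_Im_le_cmod[of "Complex b t"] by auto
    have upw: "cmod (Complex b t) \<le> 2 * \<bar>t\<bar>"
      using cmod_le[of "Complex b t"] tb b by simp
    have w0: "cmod (zeta_reg ?w) > 0"
      unfolding regs using zs0 lows t0 by (intro mult_pos_pos) auto
    \<comment> \<open>For |t| \<le> 1 / (64 K) the regularised value is within 1/2 of its value 1 at
      the pole. For larger |t| the trivial bound for the prime sum gives |zeta| \<ge> e^(-2C-1) b,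
      and the factor |t| is bounded below.\<close>
    have low: "b / cmod (zeta_reg ?w) \<le> D"
    proof (cases "\<bar>t\<bar> \<le> 1 / (64 * K)")
      case True
      have t1: "\<bar>t\<bar> \<le> 1"
        using True K(1) by (smt (verit) divide_le_eq_1 mult_le_cancel_left1)
      have "cmod (zeta_reg ?w - zeta_reg 1) \<le> K * (1 + 3)\<^sup>2 * cmod (?w - 1)"
        using b b1 t1 cmod_le[of ?w] by (intro K(2)) auto
      also have "\<dots> \<le> K * (1 + 3)\<^sup>2 * (2 * (1 / (64 * K)))"
        unfolding cmod_Complex_minus_1 using upw True K(1) by (intro mult_left_mono) auto
      also have "\<dots> = 1 / 2" using K(1) by simp
      finally have "cmod (zeta_reg ?w) \<ge> 1 / 2"
        using norm_triangle_ineq2[of 1 "1 - zeta_reg ?w"] by (simp add: norm_minus_commute)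
      hence "b / cmod (zeta_reg ?w) \<le> 1 / (1/2)" using b1 b by (intro frac_le) auto
      thus ?thesis by (simp add: D_def)
    next
      case False
      have "(\<Sum>p\<in>primes_le y. - (1 / real p)) \<le> (\<Sum>p\<in>primes_le y. cos (t * ln p) / p)"
      proof (intro sum_mono)
        fix p assume "p \<in> primes_le y"
        have "(-1) / real p \<le> cos (t * ln p) / p" by (intro divide_right_mono) auto
        thus "- (1 / real p) \<le> cos (t * ln p) / p" by simp
      qed
      moreover have "(\<Sum>p\<in>primes_le y. 1 / real p) \<le> C + 1 + ln (ln y)" using mert[OF yz(1)] by linarith
      ultimately have "ln (cmod (zeta_sum ?w)) \<ge> - (2 * C + 1 + ln (ln y))"
        using C(4)[OF b(1,2,3), of t] by (simp add: sum_negf)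
      hence "exp (- (2 * C + 1 + ln (ln y))) \<le> cmod (zeta_sum ?w)"
        using zs0 by (simp add: ln_ge_iff)
      also have "exp (- (2 * C + 1 + ln (ln y))) = exp (- (2 * C + 1)) * b"
        using lnY[OF yz(1)] by (simp only: minus_add_distrib exp_add) (simp add: exp_minus b_def field_simps)
      finally have low1: "inverse (exp (2 * C + 1)) * b \<le> cmod (zeta_sum ?w)" by (simp only: exp_minus)
      have "1 / (64 * K) * (inverse (exp (2 * C + 1)) * b) \<le> \<bar>t\<bar> * cmod (zeta_sum ?w)"
        using False low1 b by (intro mult_mono) auto
      also have "\<dots> \<le> cmod (zeta_reg ?w)" unfolding regs using lows by (intro mult_right_mono) auto
      finally have "b \<le> (64 * K * exp (2 * C + 1)) * cmod (zeta_reg ?w)"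
        using K(1) by (simp add: field_simps)
      also have "\<dots> \<le> D * cmod (zeta_reg ?w)" by (intro mult_right_mono) (auto simp: D_def)
      finally show ?thesis using w0 by (simp add: pos_divide_le_eq)
    qed
    have "cmod (zeta_reg ?s) \<le> cmod (zeta_reg ?w) + cmod (zeta_reg ?s - zeta_reg ?w)"
      using norm_triangle_ineq[of "zeta_reg ?w" "zeta_reg ?s - zeta_reg ?w"] by simp
    also have "cmod (zeta_reg ?s - zeta_reg ?w) \<le> K * (1 + (2 + \<bar>t\<bar>))\<^sup>2 * cmod (?s - ?w)"
      using a b b1 ab cmod_le[of ?s] cmod_le[of ?w] by (intro K(2)) auto
    also have "?s - ?w = of_real (a - b)" by (simp add: complex_eq_iff)
    also have "cmod (of_real (a - b)) \<le> b" unfolding norm_of_real using ab a(1) by simp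
    finally have "cmod (zeta_reg ?s) \<le> cmod (zeta_reg ?w) + K * (3 + \<bar>t\<bar>)\<^sup>2 * b"
      using K(1) by (simp add: mult_left_mono add.commute)
    \<comment> \<open>The Lipschitz error is a multiple of b, and b \<le> D |zeta_reg w| turns the
      additive error into a multiplicative one.\<close>
    also have "cmod (zeta_reg ?w) + K * (3 + \<bar>t\<bar>)\<^sup>2 * b \<le> cmod (zeta_reg ?w) + K * (3 + \<bar>t\<bar>)\<^sup>2 * (D * cmod (zeta_reg ?w))"
      using low w0 K(1) by (intro add_left_mono mult_left_mono) (auto simp: pos_divide_le_eq)
    also have "cmod (zeta_reg ?w) + K * (3 + \<bar>t\<bar>)\<^sup>2 * (D * cmod (zeta_reg ?w)) \<le>
        (3 + \<bar>t\<bar>)\<^sup>2 * cmod (zeta_reg ?w) + K * (3 + \<bar>t\<bar>)\<^sup>2 * (D * cmod (zeta_reg ?w))"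
      using mult_right_mono[OF one_le_power[of "3 + \<bar>t\<bar>" 2], of "cmod (zeta_reg ?w)"] by simp
    also have "\<dots> = (1 + K * D) * (3 + \<bar>t\<bar>)\<^sup>2 * cmod (zeta_reg ?w)" by (simp add: algebra_simps)
    finally have "cmod (zeta_reg ?s) \<le> (1 + K * D) * (3 + \<bar>t\<bar>)\<^sup>2 * cmod (zeta_reg ?w)"
      using K(1) by (simp add: mult_left_mono)
    \<comment> \<open>The hypothesis on t acts here: from b \<le> |t| follows |w - 1| \<le> 2 |t|,
      while |s - 1| \<ge> |t|, so the factors that distinguish \<open>zeta_reg\<close> from
      \<open>zeta_sum\<close> cancel up to a constant.\<close>
    hence "\<bar>t\<bar> * cmod (zeta_sum ?s) \<le> (1 + K * D) * (3 + \<bar>t\<bar>)\<^sup>2 * (2 * \<bar>t\<bar> * cmod (zeta_sum ?w))"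
      unfolding regs
      by (rule order.trans[OF order.trans[rotated]]) (use lows upw K(1) D in \<open>auto intro!: mult_right_mono mult_left_mono\<close>)
    hence "\<bar>t\<bar> * cmod (zeta_sum ?s) \<le> \<bar>t\<bar> * ((2 + 2 * K * D) * (3 + \<bar>t\<bar>)\<^sup>2 * cmod (zeta_sum ?w))"
      by (simp add: algebra_simps)
    hence "cmod (zeta_sum ?s) \<le> (2 + 2 * K * D) * (3 + \<bar>t\<bar>)\<^sup>2 * cmod (zeta_sum ?w)"
      using t0 by (simp only: mult_le_cancel_left_pos)
    hence "ln (cmod (zeta_sum ?s)) \<le> ln ((2 + 2 * K * D) * (3 + \<bar>t\<bar>)\<^sup>2 * cmod (zeta_sum ?w))"
      using zs0 K(1) D by (subst ln_le_cancel_iff) (auto intro!: mult_pos_pos add_pos_nonneg)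
    also have "\<dots> = ln (2 + 2 * K * D) + 2 * ln (3 + \<bar>t\<bar>) + ln (cmod (zeta_sum ?w))"
    proof -
      have "2 + 2 * K * D > 0" using K(1) D by (intro add_pos_nonneg) auto
      moreover have "3 + \<bar>t\<bar> > 0" by simp
      ultimately show ?thesis using zs0 by (simp add: ln_mult ln_realpow)
    qed
    finally show ?thesis
      unfolding diff[OF yz(2)] using C(4)[OF a, of t] C(4)[OF b, of t] by linarith
  qed
  have KD: "ln (2 + 2 * K * D) \<ge> 0" using K(1) D by (intro ln_ge_zero) auto
  show ?thesis
  proof (rule that[of "2 * C + 2 + ln (2 + 2 * K * D)" Y])
    show "\<bar>(\<Sum>p\<in>primes_le z - primes_le y. 1 / p) - ln (ln z / ln y)\<bar> \<le> 2 * C + 2 + ln (2 + 2 * K * D)"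
      if "Y \<le> y" "y \<le> z" for y z
    proof -
      have "ln (ln z / ln y) = ln (ln z) - ln (ln y)" using lnY[of y] lnY[of z] that by (simp add: ln_div)
      thus ?thesis unfolding diff[OF that(2)] using mert[of y] mert[of z] that KD by linarith
    qed
    show "(\<Sum>p\<in>primes_le y. 1 / p) \<le> ln (ln y) + (2 * C + 2 + ln (2 + 2 * K * D))" if "Y \<le> y" for y
      using mert[OF that] KD C by linarith
    show "(\<Sum>p\<in>primes_le z - primes_le y. cos (t * ln p) / p) \<le> 2 * C + 2 + ln (2 + 2 * K * D) + 2 * ln (3 + \<bar>t\<bar>)"
      if "Y \<le> y" "y \<le> z" "1 / ln y \<le> \<bar>t\<bar>" for y z t
      using cosb[OF that] by linarith
    show "exp 1 < Y" using C by (simp add: Y_def)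
    show "2 * C + 2 + ln (2 + 2 * K * D) \<ge> 0" using KD C by linarith
  qed
qed

section \<open>The Fejer kernel and Dirichlet polynomials\<close>

text \<open>Equal to (sin (w/2) / (w/2))^2, the Fourier transform of the tent 1 - |t| on [-1, 1];
  the value at 0 is the limit.\<close>

definition fejer :: "real \<Rightarrow> real" where
  "fejer w = (if w = 0 then 1 else 2 * (1 - cos w) / w\<^sup>2)"

lemma fejer_nonneg: "fejer w \<ge> 0"
  by (simp add: fejer_def)

lemma fejer_minus: "fejer (- w) = fejer w"
  by (simp add: fejer_def)

lemma one_minus_cos_le: "2 * (1 - cos w) \<le> (w::real)\<^sup>2"
proof -
  have "2 * (1 - cos w) = 4 * (sin (w / 2))\<^sup>2"
    using cos_double_sin[of "w / 2"] by simp
  also have "(sin (w / 2))\<^sup>2 \<le> (w / 2)\<^sup>2"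
    using abs_sin_x_le_abs_x[of "w / 2"] by (simp only: abs_le_square_iff)
  finally show ?thesis by (simp add: power_divide)
qed

lemma fejer_le: "fejer w \<le> 5 / (1 + w\<^sup>2)"
proof (cases "w = 0")
  case False
  have "2 * (1 - cos w) \<le> 2 * (1 - (-1))"
    by (intro mult_left_mono diff_mono cos_ge_minus_one order_refl) auto
  moreover have "fejer w * (1 + w\<^sup>2) = 2 * (1 - cos w) / w\<^sup>2 + 2 * (1 - cos w)"
    using False by (simp add: fejer_def field_simps)
  moreover have "2 * (1 - cos w) / w\<^sup>2 \<le> 1"
    using one_minus_cos_le[of w] False by (simp add: divide_le_eq)
  ultimately have "fejer w * (1 + w\<^sup>2) \<le> 1 + 2 * (1 - (-1))"
    by (simp only: add_mono)
  thus ?thesis by (simp add: pos_le_divide_eq add_pos_nonneg)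
qed (simp add: fejer_def)

lemma has_integral_fejer:
  "((\<lambda>t. of_real (1 - \<bar>t\<bar>) * exp (\<i> * of_real (t * w))) has_integral complex_of_real (fejer w)) {-1..1}"
proof (cases "w = 0")
  case True
  have 1: "((\<lambda>t::real. 1 - \<bar>t\<bar>) has_integral (1 - 1\<^sup>2/2) - (0 - 0\<^sup>2/2)) {0..1}"
    by (rule fundamental_theorem_of_calculus) (auto intro!: derivative_eq_intros simp flip: has_real_derivative_iff_has_vector_derivative)
  have 2: "((\<lambda>t::real. 1 - \<bar>t\<bar>) has_integral (0 + 0\<^sup>2/2) - (-1 + (-1)\<^sup>2/2)) {-1..0}"
    by (rule fundamental_theorem_of_calculus) (auto intro!: derivative_eq_intros simp flip: has_real_derivative_iff_has_vector_derivative)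
  from has_integral_combine[OF _ _ 2 1] have "((\<lambda>t::real. 1 - \<bar>t\<bar>) has_integral 1) {-1..1}" by simp
  from has_integral_linear[OF this bounded_linear_of_real] show ?thesis
    using True by (simp add: fejer_def o_def)
next
  case False
  \<comment> \<open>Primitives of (1 - z) e^(izw) and (1 + z) e^(izw), obtained by integration by
    parts; the tent is linear on each half of the interval.\<close>
  define H1 where "H1 = (\<lambda>z::complex. (1 - z) * exp (\<i> * (z * of_real w)) / (\<i> * of_real w) + exp (\<i> * (z * of_real w)) / (\<i> * of_real w)\<^sup>2)"
  define H2 where "H2 = (\<lambda>z::complex. (1 + z) * exp (\<i> * (z * of_real w)) / (\<i> * of_real w) - exp (\<i> * (z * of_real w)) / (\<i> * of_real w)\<^sup>2)"
  have "(H1 has_field_derivative ((1 - z) * exp (\<i> * (z * of_real w)))) (at z)" for z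
    unfolding H1_def using False
    by (auto intro!: derivative_eq_intros simp: field_simps power2_eq_square)
  hence H1: "((\<lambda>t. H1 (of_real t)) has_vector_derivative ((1 - of_real t) * exp (\<i> * (of_real t * of_real w)))) (at t within S)" for t S
    by (auto intro: has_vector_derivative_real_field has_vector_derivative_at_within)
  have "(H2 has_field_derivative ((1 + z) * exp (\<i> * (z * of_real w)))) (at z)" for z
    unfolding H2_def using False
    by (auto intro!: derivative_eq_intros simp: field_simps power2_eq_square)
  hence H2: "((\<lambda>t. H2 (of_real t)) has_vector_derivative ((1 + of_real t) * exp (\<i> * (of_real t * of_real w)))) (at t within S)" for t S
    by (auto intro: has_vector_derivative_real_field has_vector_derivative_at_within)
  have "((\<lambda>t. (1 - of_real t) * exp (\<i> * (of_real t * of_real w))) has_integral (H1 (of_real 1) - H1 (of_real 0))) {0..1}"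
    by (rule fundamental_theorem_of_calculus) (auto intro: H1)
  hence "((\<lambda>t. (1 - of_real t) * exp (\<i> * (of_real t * of_real w))) has_integral (H1 1 - H1 0)) {0..1}" by simp
  hence 1: "((\<lambda>t. of_real (1 - \<bar>t\<bar>) * exp (\<i> * of_real (t * w))) has_integral (H1 1 - H1 0)) {0..1}"
    by (rule has_integral_eq[rotated]) auto
  have "((\<lambda>t. (1 + of_real t) * exp (\<i> * (of_real t * of_real w))) has_integral (H2 (of_real 0) - H2 (of_real (-1)))) {-1..0}"
    by (rule fundamental_theorem_of_calculus) (auto intro: H2)
  hence "((\<lambda>t. (1 + of_real t) * exp (\<i> * (of_real t * of_real w))) has_integral (H2 0 - H2 (-1))) {-1..0}" by simp
  hence 2: "((\<lambda>t. of_real (1 - \<bar>t\<bar>) * exp (\<i> * of_real (t * w))) has_integral (H2 0 - H2 (-1))) {-1..0}"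
    by (rule has_integral_eq[rotated]) auto
  have "exp (\<i> * of_real w) + exp (- (\<i> * of_real w)) = of_real (2 * cos w)"
    by (simp add: complex_eq_iff Re_exp Im_exp)
  hence "(H2 0 - H2 (-1)) + (H1 1 - H1 0) = (of_real (2 * cos w) - 2) / (\<i> * of_real w)\<^sup>2"
    by (simp add: H1_def H2_def diff_divide_distrib flip: add_divide_distrib,
        simp add: add_divide_distrib diff_divide_distrib, simp add: add.commute)
  also have "\<dots> = of_real (fejer w)"
    using False by (simp add: fejer_def power_mult_distrib field_simps)
  finally have "(H2 0 - H2 (-1)) + (H1 1 - H1 0) = of_real (fejer w)" .
  thus ?thesis using has_integral_combine[OF _ _ 2 1] by simp
qed

text \<open>In the integral representation |t w| \<le> 1 < pi/3, so the cosine is at least 1/2, and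
  the tent has mass 1.\<close>

lemma fejer_ge_half:
  assumes "\<bar>w\<bar> \<le> 1" shows "fejer w \<ge> 1 / 2"
proof -
  have "((\<lambda>t. Re (of_real (1 - \<bar>t\<bar>) * exp (\<i> * of_real (t * w)))) has_integral Re (of_real (fejer w))) {-1..1}"
    using has_integral_linear[OF has_integral_fejer bounded_linear_Re] by (simp add: o_def)
  hence 1: "((\<lambda>t. (1 - \<bar>t\<bar>) * cos (t * w)) has_integral fejer w) {-1..1}"
    by (simp add: Re_exp)
  have "((\<lambda>t. Re (of_real (1 - \<bar>t\<bar>) * exp (\<i> * of_real (t * 0)))) has_integral Re (of_real (fejer 0))) {-1..1}"
    using has_integral_linear[OF has_integral_fejer bounded_linear_Re] by (simp only: o_def)
  hence "((\<lambda>t. 1 - \<bar>t\<bar>) has_integral 1) {-1..1::real}"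
    by (simp add: fejer_def)
  from has_integral_mult_left[OF this, of "1/2"]
  have 2: "((\<lambda>t. (1 - \<bar>t\<bar>) * (1/2)) has_integral 1/2) {-1..1::real}" by simp
  show ?thesis
  proof (rule has_integral_le[OF 2 1])
    fix t :: real assume t: "t \<in> {-1..1}"
    have "\<bar>t\<bar> \<le> 1" using t by auto
    hence "\<bar>t * w\<bar> \<le> 1" using assms by (simp add: abs_mult mult_le_one)
    hence "cos (pi / 3) \<le> cos \<bar>t * w\<bar>"
      using pi_gt3 by (intro cos_monotone_0_pi_le) auto
    hence "1/2 \<le> cos (t * w)" by (simp add: cos_60)
    thus "(1 - \<bar>t\<bar>) * (1/2) \<le> (1 - \<bar>t\<bar>) * cos (t * w)"
      using t by (intro mult_left_mono) auto
  qed
qed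

definition dirichlet :: "(nat \<Rightarrow> complex) \<Rightarrow> nat set \<Rightarrow> real \<Rightarrow> complex" where
  "dirichlet c A t = (\<Sum>n\<in>A. c n * npow (Complex 1 t) n)"

lemma npow_product:
  assumes "m \<ge> 1" "n \<ge> 1"
  shows "npow (Complex 1 t) m * cnj (npow (Complex 1 t) n) = of_real (1 / (real m * real n)) * exp (\<i> * of_real (t * (- ln (m / n))))"
proof -
  have C: "Complex 1 t = 1 + \<i> * of_real t" by (simp add: complex_eq_iff)
  have "npow (Complex 1 t) m * cnj (npow (Complex 1 t) n) =
          exp (of_real (- (ln m + ln n)) + \<i> * of_real (t * (- ln (m / n))))"
    using assms by (simp add: npow_def exp_cnj ln_div C algebra_simps flip: exp_add)
  also have "\<dots> = of_real (exp (- (ln m + ln n))) * exp (\<i> * of_real (t * (- ln (m / n))))"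
    by (simp only: exp_add exp_of_real)
  also have "exp (- (ln m + ln n)) = 1 / (real m * real n)"
    unfolding minus_add_distrib exp_add exp_minus using assms by (simp add: divide_inverse)
  finally show ?thesis .
qed

text \<open>When the square is expanded, the pair (m, n) contributes the Fourier transform of the
  tent at ln (m/n).\<close>

lemma has_integral_dirichlet:
  assumes "finite A" "\<And>n. n \<in> A \<Longrightarrow> n \<ge> 1"
  shows "((\<lambda>t. (1 - \<bar>t\<bar>) * (cmod (dirichlet c A t))\<^sup>2) has_integral
           (\<Sum>m\<in>A. \<Sum>n\<in>A. Re (c m * cnj (c n)) * (fejer (ln (m / n)) / (real m * real n)))) {-1..1}"
proof -
  have eq: "of_real ((1 - \<bar>t\<bar>) * (cmod (dirichlet c A t))\<^sup>2) =
     (\<Sum>m\<in>A. \<Sum>n\<in>A. (c m * cnj (c n) * of_real (1 / (real m * real n))) * (of_real (1 - \<bar>t\<bar>) * exp (\<i> * of_real (t * (- ln (m / n))))))" for t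
  proof -
    have "of_real ((1 - \<bar>t\<bar>) * (cmod (dirichlet c A t))\<^sup>2) = of_real (1 - \<bar>t\<bar>) * (dirichlet c A t * cnj (dirichlet c A t))"
      by (simp only: of_real_mult complex_norm_square)
    also have "\<dots> = (\<Sum>m\<in>A. \<Sum>n\<in>A. of_real (1 - \<bar>t\<bar>) * (c m * cnj (c n) * (npow (Complex 1 t) m * cnj (npow (Complex 1 t) n))))"
      unfolding dirichlet_def cnj_sum sum_product unfolding sum_distrib_left
      by (intro sum.cong refl) (simp add: mult_ac)
    also have "\<dots> = (\<Sum>m\<in>A. \<Sum>n\<in>A. (c m * cnj (c n) * of_real (1 / (real m * real n))) * (of_real (1 - \<bar>t\<bar>) * exp (\<i> * of_real (t * (- ln (m / n))))))"
      using assms by (intro sum.cong refl, subst npow_product) (simp_all add: mult_ac)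
    finally show ?thesis .
  qed
  have "((\<lambda>t. complex_of_real ((1 - \<bar>t\<bar>) * (cmod (dirichlet c A t))\<^sup>2)) has_integral
          (\<Sum>m\<in>A. \<Sum>n\<in>A. (c m * cnj (c n) * of_real (1 / (real m * real n))) * of_real (fejer (- ln (m / n))))) {-1..1}"
    unfolding eq by (intro has_integral_sum has_integral_mult_right has_integral_fejer assms)
  from has_integral_linear[OF this bounded_linear_Re]
  have "((\<lambda>t. (1 - \<bar>t\<bar>) * (cmod (dirichlet c A t))\<^sup>2) has_integral
          Re (\<Sum>m\<in>A. \<Sum>n\<in>A. (c m * cnj (c n) * of_real (1 / (real m * real n))) * of_real (fejer (- ln (m / n))))) {-1..1}"
    by (simp only: o_def Re_complex_of_real)
  also have "Re (\<Sum>m\<in>A. \<Sum>n\<in>A. (c m * cnj (c n) * of_real (1 / (real m * real n))) * of_real (fejer (- ln (m / n)))) =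
    (\<Sum>m\<in>A. \<Sum>n\<in>A. Re (c m * cnj (c n)) * (fejer (ln (m / n)) / (real m * real n)))"
    unfolding Re_sum fejer_minus mult.assoc[of "c _ * cnj (c _)"] of_real_mult[symmetric]
    by (intro sum.cong refl) (simp only: Re_complex_of_real times_complex.sel Im_complex_of_real, simp)
  finally show ?thesis .
qed

text \<open>With L(u) = ln u - ln m, the summand 1/h(u) is the derivative of arctan (L(u)), and h
  increases because its derivative is (1 + L(u))^2. Each term after the first is thus at most an
  increment of the arctangent, whose total variation is pi < 4.\<close>

lemma sum_cauchy_kernel_le:
  assumes m: "m \<ge> (1::nat)"
  shows "(\<Sum>n\<in>{1..N}. 1 / (1 + (ln (m / n))\<^sup>2) / real n) \<le> 5"
proof -
  define L where "L = (\<lambda>u. ln u - ln (real m))"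
  define h where "h = (\<lambda>u. u * (1 + (L u)\<^sup>2))"
  have h_pos: "h u > 0" if "u > 0" for u using that by (auto simp: h_def intro!: mult_pos_pos add_pos_nonneg)
  have h_mono: "h u \<le> h v" if "0 < u" "u \<le> v" for u v
  proof (rule DERIV_nonneg_imp_nondecreasing[OF that(2)])
    fix x assume x: "u \<le> x" "x \<le> v"
    have "(h has_real_derivative (1 + L x)\<^sup>2) (at x)"
      unfolding h_def L_def using x that
      by (auto intro!: derivative_eq_intros simp: field_simps power2_eq_square)
    thus "\<exists>y. (h has_real_derivative y) (at x) \<and> 0 \<le> y" by (intro exI conjI) auto
  qed
  have step: "1 / h (Suc n) \<le> arctan (L (Suc n)) - arctan (L n)" if n: "n \<ge> 1" for n :: nat
  proof -
    have "\<exists>z>real n. z < real (Suc n) \<and> arctan (L (Suc n)) - arctan (L n) = (real (Suc n) - real n) * (1 / h z)"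
    proof (rule MVT2)
      fix x assume x: "real n \<le> x" "x \<le> real (Suc n)"
      thus "((\<lambda>x. arctan (L x)) has_real_derivative 1 / h x) (at x)"
        unfolding h_def L_def using n
        by (auto intro!: derivative_eq_intros simp: field_simps)
    qed auto
    then obtain z where z: "real n < z" "z < real (Suc n)" "arctan (L (Suc n)) - arctan (L n) = 1 / h z" by auto
    have "1 / h (Suc n) \<le> 1 / h z" using z n h_pos h_mono[of z "Suc n"] by (intro divide_left_mono mult_pos_pos) auto
    thus ?thesis using z by simp
  qed
  have "(\<Sum>n\<in>{1..Suc N}. 1 / h n) \<le> 1 + (arctan (L (Suc N)) - arctan (L 1))" for N
  proof (induction N)
    case 0
    show ?case by (simp add: h_def divide_le_eq_1 add_pos_nonneg)
  next
    case (Suc N)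
    thus ?case using step[of "Suc N"] by simp
  qed
  moreover have "arctan (L (Suc N)) - arctan (L 1) \<le> 4"
    using arctan_ubound[of "L (Suc N)"] arctan_lbound[of "L 1"] pi_less_4 by linarith
  ultimately have "(\<Sum>n\<in>{1..Suc N}. 1 / h n) \<le> 5" by (smt (verit))
  moreover have "(\<Sum>n\<in>{1..N}. 1 / h n) \<le> (\<Sum>n\<in>{1..Suc N}. 1 / h n)"
    using h_pos by (intro sum_mono2) (auto intro: less_imp_le)
  moreover have "(\<Sum>n\<in>{1..N}. 1 / (1 + (ln (m / n))\<^sup>2) / real n) = (\<Sum>n\<in>{1..N}. 1 / h n)"
  proof (intro sum.cong refl)
    fix n assume n: "n \<in> {1..N}"
    have "(ln (real m / real n))\<^sup>2 = (L n)\<^sup>2" using n m by (simp add: L_def ln_div power2_commute)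
    thus "1 / (1 + (ln (m / n))\<^sup>2) / real n = 1 / h n" by (simp add: h_def mult.commute)
  qed
  ultimately show ?thesis by linarith
qed

text \<open>Schur's test: the kernel is nonnegative and symmetric, and its row sums are at most 25/m
  by the decay of the Fejer kernel. Combined with \<open>has_integral_dirichlet\<close> this is a
  mean value theorem for Dirichlet polynomials on an interval of fixed length.\<close>

lemma fejer_quadratic_form_le:
  fixes c :: "nat \<Rightarrow> complex"
  shows "(\<Sum>m\<in>{1..N}. \<Sum>n\<in>{1..N}. Re (c m * cnj (c n)) * (fejer (ln (m / n)) / (real m * real n)))
     \<le> 25 * (\<Sum>m\<in>{1..N}. (cmod (c m))\<^sup>2 / m)"
proof -
  let ?K = "\<lambda>m n::nat. fejer (ln (m / n)) / (real m * real n)"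
  have sym: "?K m n = ?K n m" if "m \<in> {1..N}" "n \<in> {1..N}" for m n
    using that fejer_minus[of "ln (m / n)"] by (simp add: ln_div mult.commute)
  have K0: "?K m n \<ge> 0" for m n by (simp add: fejer_nonneg)
  have "(\<Sum>m\<in>{1..N}. \<Sum>n\<in>{1..N}. Re (c m * cnj (c n)) * ?K m n) \<le>
        (\<Sum>m\<in>{1..N}. \<Sum>n\<in>{1..N}. ((cmod (c m))\<^sup>2 / 2) * ?K m n + ((cmod (c n))\<^sup>2 / 2) * ?K m n)"
  proof (intro sum_mono)
    fix m n :: nat
    have "Re (c m * cnj (c n)) \<le> cmod (c m) * cmod (c n)"
      using complex_Re_le_cmod[of "c m * cnj (c n)"] by (simp add: norm_mult)
    also have "\<dots> \<le> (cmod (c m))\<^sup>2 / 2 + (cmod (c n))\<^sup>2 / 2"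
      using sum_squares_bound[of "cmod (c m)" "cmod (c n)"] by simp
    finally show "Re (c m * cnj (c n)) * ?K m n \<le> ((cmod (c m))\<^sup>2 / 2) * ?K m n + ((cmod (c n))\<^sup>2 / 2) * ?K m n"
      using K0[of m n] by (simp only: mult_right_mono flip: distrib_right)
  qed
  also have "\<dots> = (\<Sum>m\<in>{1..N}. \<Sum>n\<in>{1..N}. ((cmod (c m))\<^sup>2 / 2) * ?K m n) + (\<Sum>m\<in>{1..N}. \<Sum>n\<in>{1..N}. ((cmod (c n))\<^sup>2 / 2) * ?K m n)"
    by (simp only: sum.distrib)
  also have "(\<Sum>m\<in>{1..N}. \<Sum>n\<in>{1..N}. ((cmod (c n))\<^sup>2 / 2) * ?K m n) = (\<Sum>n\<in>{1..N}. \<Sum>m\<in>{1..N}. ((cmod (c n))\<^sup>2 / 2) * ?K m n)"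
    by (rule sum.swap)
  also have "\<dots> = (\<Sum>n\<in>{1..N}. \<Sum>m\<in>{1..N}. ((cmod (c n))\<^sup>2 / 2) * ?K n m)"
    by (intro sum.cong refl) (subst sym, auto)
  also have "(\<Sum>m\<in>{1..N}. \<Sum>n\<in>{1..N}. ((cmod (c m))\<^sup>2 / 2) * ?K m n) + (\<Sum>n\<in>{1..N}. \<Sum>m\<in>{1..N}. ((cmod (c n))\<^sup>2 / 2) * ?K n m) =
      (\<Sum>m\<in>{1..N}. (cmod (c m))\<^sup>2 / m * (\<Sum>n\<in>{1..N}. fejer (ln (m / n)) / n))"
    by (simp add: sum_distrib_left flip: sum.distrib)
  also have "\<dots> \<le> (\<Sum>m\<in>{1..N}. (cmod (c m))\<^sup>2 / m * 25)"
  proof (intro sum_mono mult_left_mono)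
    fix m assume m: "m \<in> {1..N}"
    have "(\<Sum>n\<in>{1..N}. fejer (ln (m / n)) / n) \<le> (\<Sum>n\<in>{1..N}. 5 / (1 + (ln (m / n))\<^sup>2) / real n)"
      by (intro sum_mono divide_right_mono fejer_le) auto
    also have "\<dots> = 5 * (\<Sum>n\<in>{1..N}. 1 / (1 + (ln (m / n))\<^sup>2) / real n)" by (simp add: sum_distrib_left)
    also have "\<dots> \<le> 5 * 5" using m by (intro mult_left_mono sum_cauchy_kernel_le) auto
    finally show "(\<Sum>n\<in>{1..N}. fejer (ln (m / n)) / n) \<le> 25" by simp
  qed auto
  also have "\<dots> = 25 * (\<Sum>m\<in>{1..N}. (cmod (c m))\<^sup>2 / m)" by (simp add: sum_distrib_left mult.commute)
  finally show ?thesis .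
qed

section \<open>A Turan-Kubilius inequality for Dirichlet polynomials\<close>

definition hsum :: "nat \<Rightarrow> real" where
  "hsum n = (\<Sum>k\<in>{1..n}. 1 / real k)"

lemma hsum_eq_harm: "hsum n = harm n"
  by (simp add: hsum_def harm_def divide_inverse)

lemma hsum_le: "n \<ge> 1 \<Longrightarrow> hsum n \<le> ln n + 1"
  unfolding hsum_def
proof (induction n rule: nat_induct_at_least)
  case (Suc n)
  have "1 / real (Suc n) \<le> ln (real (Suc n)) - ln n"
  proof -
    have "ln (real n / real (Suc n)) \<le> real n / real (Suc n) - 1"
      using Suc.hyps by (intro ln_le_minus_one) auto
    also have "real n / real (Suc n) - 1 = - (1 / real (Suc n))"
      by (simp add: field_simps)
    finally show ?thesis using Suc.hyps by (simp add: ln_div)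
  qed
  thus ?case using Suc.IH by simp
qed auto

lemma sum_multiples:
  assumes "q \<ge> (1::nat)"
  shows "(\<Sum>k\<in>{1..N}. if q dvd k then 1 / real k else 0) = 1 / q * hsum (N div q)"
proof -
  have "(\<Sum>k\<in>{1..N}. if q dvd k then 1 / real k else 0) = (\<Sum>k\<in>{k\<in>{1..N}. q dvd k}. 1 / real k)"
    by (rule sum.inter_filter[symmetric]) auto
  also have "\<dots> = (\<Sum>j\<in>{1..N div q}. 1 / real (q * j))"
  proof (rule sum.reindex_bij_witness[of _ "\<lambda>j. q * j" "\<lambda>k. k div q"])
    fix k assume k: "k \<in> {k \<in> {1..N}. q dvd k}"
    hence "k div q \<noteq> 0" by (auto simp: dvd_div_eq_0_iff)
    thus "k div q \<in> {1..N div q}" using k by (auto intro!: div_le_mono)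
  qed (use assms in \<open>auto simp: less_eq_div_iff_mult_less_eq mult.commute\<close>)
  also have "\<dots> = 1 / q * hsum (N div q)"
    by (simp add: hsum_def sum_distrib_left)
  finally show ?thesis .
qed

locale prime_set =
  fixes P :: "nat set" and z :: real
  assumes finite_P: "finite P" and primes: "\<And>p. p \<in> P \<Longrightarrow> prime p"
    and P_le: "\<And>p. p \<in> P \<Longrightarrow> real p \<le> z"
begin

definition rsum :: real where "rsum = (\<Sum>p\<in>P. 1 / real p)"

text \<open>The number of ways to write n = p k with p \<in> P and k \<le> N, that is, the
  coefficient of n in the product of the polynomials over P and over {1..N}. For n \<le> N it counts
  the prime divisors of n in P.\<close>

definition r :: "nat \<Rightarrow> nat \<Rightarrow> nat" where
  "r N n = card {p\<in>P. p dvd n \<and> n div p \<le> N}"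

lemma P_ge: "p \<in> P \<Longrightarrow> p \<ge> 1"
  using primes[of p] prime_ge_1_nat by blast

lemma sum_products:
  fixes h :: "nat \<Rightarrow> 'b::real_vector"
  shows "(\<Sum>p\<in>P. \<Sum>k\<in>{1..N}. h (p * k)) = (\<Sum>n\<in>{1..N * nat \<lfloor>z\<rfloor>}. real (r N n) *\<^sub>R h n)"
proof -
  let ?A = "{1..N * nat \<lfloor>z\<rfloor>}"
  have "(\<Sum>n\<in>?A. real (r N n) *\<^sub>R h n) = (\<Sum>n\<in>?A. \<Sum>p\<in>{p\<in>P. p dvd n \<and> n div p \<le> N}. h n)"
    by (intro sum.cong refl) (simp add: r_def sum_constant_scaleR)
  also have "\<dots> = (\<Sum>(n,p)\<in>Sigma ?A (\<lambda>n. {p\<in>P. p dvd n \<and> n div p \<le> N}). h n)"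
    using finite_P by (subst sum.Sigma) auto
  also have "\<dots> = (\<Sum>(p,k)\<in>P \<times> {1..N}. h (p * k))"
  proof (rule sum.reindex_bij_witness[of _ "\<lambda>(p,k). (p * k, p)" "\<lambda>(n,p). (p, n div p)"], goal_cases)
    case (2 a)
    then obtain n p where a: "a = (n, p)" "n \<in> ?A" "p \<in> P" "p dvd n" "n div p \<le> N" by auto
    have "n div p \<noteq> 0" using a by (auto simp: dvd_div_eq_0_iff)
    thus ?case using a by auto
  next
    case (3 b)
    then obtain p k where b: "b = (p, k)" "p \<in> P" "k \<in> {1..N}" by auto
    thus ?case using P_ge[of p] by auto
  next
    case (4 b)
    then obtain p k where b: "b = (p, k)" "p \<in> P" "k \<in> {1..N}" by auto
    have "p \<le> nat \<lfloor>z\<rfloor>" using P_le[OF b(2)] by (simp add: le_nat_floor)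
    hence "k * p \<le> N * nat \<lfloor>z\<rfloor>" using b by (intro mult_mono) auto
    thus ?case using b P_ge[of p] by (auto simp: mult.commute Suc_le_eq)
  qed auto
  also have "\<dots> = (\<Sum>p\<in>P. \<Sum>k\<in>{1..N}. h (p * k))"
    using finite_P by (subst sum.cartesian_product) auto
  finally show ?thesis by simp
qed

text \<open>A prime of P dividing p k is p itself or divides k.\<close>

lemma r_product_le:
  assumes "p \<in> P" "k \<in> {1..N}"
  shows "real (r N (p * k)) \<le> 1 + (\<Sum>q\<in>P. if q dvd k then 1 else 0)"
proof -
  have "{q\<in>P. q dvd p * k \<and> p * k div q \<le> N} \<subseteq> insert p {q\<in>P. q dvd k}"
  proof
    fix q assume q: "q \<in> {q\<in>P. q dvd p * k \<and> p * k div q \<le> N}"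
    hence "q dvd p \<or> q dvd k" using primes[of q] by (simp add: prime_dvd_mult_iff)
    thus "q \<in> insert p {q\<in>P. q dvd k}"
      using primes_dvd_imp_eq[of q p] primes[of q] primes[of p] assms q by auto
  qed
  hence "r N (p * k) \<le> card (insert p {q\<in>P. q dvd k})"
    unfolding r_def using finite_P by (intro card_mono) auto
  also have "\<dots> \<le> 1 + card {q\<in>P. q dvd k}"
    using finite_P by (simp add: card_insert_if)
  finally have "real (r N (p * k)) \<le> 1 + real (card {q\<in>P. q dvd k})"
    by (simp flip: of_nat_Suc)
  also have "real (card {q\<in>P. q dvd k}) = (\<Sum>q\<in>{q\<in>P. q dvd k}. 1)" by simp
  also have "\<dots> = (\<Sum>q\<in>P. if q dvd k then 1 else 0)"
    using finite_P by (rule sum.inter_filter)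
  finally show ?thesis .
qed

text \<open>A Turan-Kubilius variance with logarithmic weights. Writing H for the harmonic sum, E
  for \<open>rsum\<close> and T for the first moment of r, the second moment is at most E (H + T),
  so the expanded square is at most H - T/E + H/E. Since T is about E H the main terms cancel; ln z
  is the boundary effect of the range from N to N z.\<close>

lemma weight_square_sum_le:
  assumes N: "N \<ge> 1" and E: "rsum > 0" and z: "z \<ge> 1"
  shows "(\<Sum>n\<in>{1..N * nat \<lfloor>z\<rfloor>}. ((if n \<le> N then 1 else 0) - r N n / rsum)\<^sup>2 / n) \<le> (ln N + 1) / rsum + ln z + 1"
proof -
  let ?A = "{1..N * nat \<lfloor>z\<rfloor>}"
  define T where "T = (\<Sum>p\<in>P. 1 / p * hsum (N div p))"
  have "1 \<le> nat \<lfloor>z\<rfloor>" using z by (simp add: le_nat_floor)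
  hence sub: "{1..N} \<subseteq> ?A" by (simp add: atLeastatMost_subset_iff)
  have T_eq: "(\<Sum>k\<in>{1..N}. \<Sum>q\<in>P. if q dvd k then 1 / real k else 0) = T"
    unfolding T_def using P_ge by (subst sum.swap) (intro sum.cong refl sum_multiples)
  have "(\<Sum>n\<in>?A. (real (r N n))\<^sup>2 / n) = (\<Sum>n\<in>?A. real (r N n) *\<^sub>R (real (r N n) / n))"
    by (simp add: power2_eq_square)
  also have "\<dots> = (\<Sum>p\<in>P. \<Sum>k\<in>{1..N}. real (r N (p * k)) / real (p * k))"
    by (rule sum_products[symmetric])
  also have "\<dots> \<le> (\<Sum>p\<in>P. \<Sum>k\<in>{1..N}. (1 + (\<Sum>q\<in>P. if q dvd k then 1 else 0)) / real (p * k))"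
    by (intro sum_mono divide_right_mono r_product_le) auto
  also have "\<dots> = (\<Sum>p\<in>P. 1 / p * (\<Sum>k\<in>{1..N}. 1 / real k + (\<Sum>q\<in>P. if q dvd k then 1 / real k else 0)))"
    unfolding sum_distrib_left
  proof (intro sum.cong refl)
    fix p k
    have "(\<Sum>q\<in>P. if q dvd k then 1 / real k else 0) = (\<Sum>q\<in>P. if q dvd k then 1 else 0) / real k"
      unfolding sum_divide_distrib by (intro sum.cong refl) auto
    thus "(1 + (\<Sum>q\<in>P. if q dvd k then 1 else 0)) / real (p * k) = 1 / p * (1 / real k + (\<Sum>q\<in>P. if q dvd k then 1 / real k else 0))"
      by (simp only:) (simp add: add_divide_distrib distrib_left)
  qed
  also have "\<dots> = rsum * (hsum N + T)"
    unfolding sum.distrib T_eq by (simp add: rsum_def hsum_def sum_distrib_right)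
  finally have r2: "(\<Sum>n\<in>?A. (real (r N n))\<^sup>2 / n) \<le> rsum * (hsum N + T)" .
  have r1: "(\<Sum>n\<in>{1..N}. real (r N n) / n) = T"
  proof -
    have "(\<Sum>n\<in>{1..N}. real (r N n) / n) = (\<Sum>k\<in>{1..N}. \<Sum>q\<in>P. if q dvd k then 1 / real k else 0)"
    proof (intro sum.cong refl)
      fix n assume n: "n \<in> {1..N}"
      have "n div p \<le> N" for p using n div_le_dividend[of n p] by (meson atLeastAtMost_iff le_trans)
      hence "{p\<in>P. p dvd n \<and> n div p \<le> N} = {p\<in>P. p dvd n}" by auto
      hence "real (r N n) / n = (\<Sum>q\<in>{p\<in>P. p dvd n}. 1 / real n)" by (simp add: r_def)
      also have "\<dots> = (\<Sum>q\<in>P. if q dvd n then 1 / real n else 0)" using finite_P by (rule sum.inter_filter)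
      finally show "real (r N n) / n = \<dots>" .
    qed
    thus ?thesis using T_eq by simp
  qed
  \<comment> \<open>Each prime shortens the harmonic sum by at most ln p \<le> ln z. A lower bound
    is what is called for, because T is left with the coefficient -1/E.\<close>
  have T_low: "T \<ge> rsum * (hsum N - (ln z + 1))"
    unfolding T_def rsum_def sum_distrib_right
  proof (intro sum_mono mult_left_mono)
    fix p assume p: "p \<in> P"
    have p1: "p \<ge> 1" using P_ge[OF p] .
    have "ln (real N) - ln p = ln (real N / p)" using N p1 by (simp add: ln_div)
    also have "\<dots> \<le> ln (real (N div p) + 1)"
    proof (subst ln_le_cancel_iff)
      have "N < (N div p + 1) * p" using p1 by (simp add: dividend_less_times_div mult.commute)
      hence "real N \<le> (real (N div p) + 1) * p"
        by (metis less_imp_le of_nat_1 of_nat_add of_nat_le_iff of_nat_mult)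
      thus "real N / p \<le> real (N div p) + 1" using p1 by (simp add: divide_le_eq)
    qed (use N p1 in auto)
    also have "\<dots> \<le> hsum (N div p)" unfolding hsum_eq_harm by (rule ln_le_harm)
    finally have "ln (real N) - ln p \<le> hsum (N div p)" .
    moreover have "ln p \<le> ln z" using P_le[OF p] p1 by (subst ln_le_cancel_iff) auto
    ultimately show "hsum N - (ln z + 1) \<le> hsum (N div p)" using hsum_le[OF N] by linarith
  qed auto
  have "(\<Sum>n\<in>?A. ((if n \<le> N then 1 else 0) - r N n / rsum)\<^sup>2 / n) =
        (\<Sum>n\<in>?A. (if n \<le> N then 1 / n - 2 / rsum * (r N n / n) else 0) + (1 / rsum\<^sup>2) * ((real (r N n))\<^sup>2 / n))"
    using E by (intro sum.cong refl) (auto simp: power2_eq_square field_simps)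
  also have "\<dots> = (\<Sum>n\<in>?A. if n \<le> N then 1 / n - 2 / rsum * (r N n / n) else 0) + (1 / rsum\<^sup>2) * (\<Sum>n\<in>?A. (real (r N n))\<^sup>2 / n)"
    by (simp add: sum.distrib sum_distrib_left)
  also have "(\<Sum>n\<in>?A. if n \<le> N then 1 / n - 2 / rsum * (r N n / n) else 0) = (\<Sum>n\<in>{n\<in>?A. n \<le> N}. 1 / n - 2 / rsum * (r N n / n))"
    by (rule sum.inter_filter[symmetric]) auto
  also have "{n\<in>?A. n \<le> N} = {1..N}" using subsetD[OF sub] by auto
  also have "(\<Sum>n\<in>{1..N}. 1 / n - 2 / rsum * (r N n / n)) = hsum N - 2 / rsum * T"
    unfolding sum_subtractf r1[symmetric] by (simp add: hsum_def sum_distrib_left)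
  also have "hsum N - 2 / rsum * T + (1 / rsum\<^sup>2) * (\<Sum>n\<in>?A. (real (r N n))\<^sup>2 / n) \<le> hsum N - 2 / rsum * T + (1 / rsum\<^sup>2) * (rsum * (hsum N + T))"
    using r2 by (intro add_left_mono mult_left_mono) auto
  also have "\<dots> = hsum N - T / rsum + hsum N / rsum"
    using E by (simp add: field_simps power2_eq_square)
  also have "T / rsum \<ge> hsum N - (ln z + 1)"
    using T_low E by (simp add: pos_le_divide_eq mult.commute)
  hence "hsum N - T / rsum + hsum N / rsum \<le> (ln N + 1) / rsum + ln z + 1"
    using divide_right_mono[OF hsum_le[OF N], of rsum] E by linarith
  finally show ?thesis .
qed

text \<open>By complete multiplicativity the product is again a Dirichlet polynomial, whose
  coefficient at n is c(n) times the deviation of r(n) / E from the indicator of n \<le> N. The mean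
  value bound reduces the integral to the variance.\<close>

lemma turan_kubilius_integral:
  fixes c :: "nat \<Rightarrow> complex"
  assumes mult: "\<And>m n. m \<ge> 1 \<Longrightarrow> n \<ge> 1 \<Longrightarrow> c (m * n) = c m * c n"
    and bound: "\<And>n. n \<ge> 1 \<Longrightarrow> cmod (c n) \<le> 1"
    and N: "N \<ge> 1" and E: "rsum > 0" and z: "z \<ge> 1"
  obtains I where "((\<lambda>t. (1 - \<bar>t\<bar>) * (cmod (dirichlet c {1..N} t * (1 - dirichlet c P t / rsum)))\<^sup>2) has_integral I) {-1..1}"
    "I \<le> 25 * ((ln N + 1) / rsum + ln z + 1)"
proof -
  let ?A = "{1..N * nat \<lfloor>z\<rfloor>}"
  define a where "a = (\<lambda>n. (if n \<le> N then 1 else 0) - r N n / rsum)"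
  have "1 \<le> nat \<lfloor>z\<rfloor>" using z by (simp add: le_nat_floor)
  hence sub: "{1..N} \<subseteq> ?A" by (simp add: atLeastatMost_subset_iff)
  have eq: "dirichlet c {1..N} t * (1 - dirichlet c P t / rsum) = dirichlet (\<lambda>n. of_real (a n) * c n) ?A t" for t
  proof -
    have "dirichlet c P t * dirichlet c {1..N} t = (\<Sum>p\<in>P. \<Sum>k\<in>{1..N}. c (p * k) * npow (Complex 1 t) (p * k))"
      unfolding dirichlet_def sum_product
      using P_ge by (intro sum.cong refl) (simp add: mult npow_mult)
    also have "\<dots> = (\<Sum>n\<in>?A. real (r N n) *\<^sub>R (c n * npow (Complex 1 t) n))"
      by (rule sum_products)
    finally have 1: "dirichlet c P t * dirichlet c {1..N} t / rsum = (\<Sum>n\<in>?A. of_real (r N n / rsum) * (c n * npow (Complex 1 t) n))"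
      by (simp add: sum_divide_distrib scaleR_conv_of_real)
    have 2: "dirichlet c {1..N} t = (\<Sum>n\<in>?A. of_real (if n \<le> N then 1 else 0) * (c n * npow (Complex 1 t) n))"
    proof -
      have "dirichlet c {1..N} t = (\<Sum>n\<in>{n\<in>?A. n \<le> N}. c n * npow (Complex 1 t) n)"
        unfolding dirichlet_def using subsetD[OF sub] by (intro sum.cong) auto
      also have "\<dots> = (\<Sum>n\<in>?A. if n \<le> N then c n * npow (Complex 1 t) n else 0)"
        by (rule sum.inter_filter) auto
      finally show ?thesis by (simp add: if_distrib if_distribR cong: if_cong)
    qed
    have "dirichlet c {1..N} t * (1 - dirichlet c P t / rsum) = dirichlet c {1..N} t - dirichlet c P t * dirichlet c {1..N} t / rsum"
      by (simp add: algebra_simps)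
    also have "\<dots> = (\<Sum>n\<in>?A. of_real (if n \<le> N then 1 else 0) * (c n * npow (Complex 1 t) n)) - (\<Sum>n\<in>?A. of_real (r N n / rsum) * (c n * npow (Complex 1 t) n))"
      using 1 2 by simp
    also have "\<dots> = dirichlet (\<lambda>n. of_real (a n) * c n) ?A t"
      unfolding dirichlet_def sum_subtractf[symmetric] a_def
      by (intro sum.cong refl) (simp only: of_real_diff left_diff_distrib mult.assoc)
    finally show ?thesis .
  qed
  let ?c = "\<lambda>n. of_real (a n) * c n"
  let ?I = "\<Sum>m\<in>?A. \<Sum>n\<in>?A. Re (?c m * cnj (?c n)) * (fejer (ln (m / n)) / (real m * real n))"
  have int: "((\<lambda>t. (1 - \<bar>t\<bar>) * (cmod (dirichlet c {1..N} t * (1 - dirichlet c P t / rsum)))\<^sup>2) has_integral ?I) {-1..1}"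
    unfolding eq by (rule has_integral_dirichlet) auto
  have "?I \<le> 25 * (\<Sum>m\<in>?A. (cmod (?c m))\<^sup>2 / m)"
    by (rule fejer_quadratic_form_le)
  also have "\<dots> \<le> 25 * (\<Sum>m\<in>?A. (a m)\<^sup>2 / m)"
  proof (intro mult_left_mono sum_mono divide_right_mono)
    fix m assume "m \<in> ?A"
    hence "\<bar>a m\<bar> * cmod (c m) \<le> \<bar>a m\<bar>" using bound[of m] by (intro mult_left_le) auto
    hence "(cmod (?c m))\<^sup>2 \<le> \<bar>a m\<bar>\<^sup>2" by (intro power_mono) (auto simp: norm_mult)
    thus "(cmod (?c m))\<^sup>2 \<le> (a m)\<^sup>2" by simp
  qed auto
  also have "\<dots> \<le> 25 * ((ln N + 1) / rsum + ln z + 1)"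
    unfolding a_def by (intro mult_left_mono weight_square_sum_le N E z) auto
  finally show ?thesis using that int by blast
qed

end

section \<open>Energies of the Dirichlet polynomials attached to the exponents l\<close>

context root_valued
begin

definition energy :: "nat \<Rightarrow> nat \<Rightarrow> real" where
  "energy N l = integral {-1..1} (\<lambda>t. (1 - \<bar>t\<bar>) * (cmod (dirichlet (fchar f (int l)) {1..N} t))\<^sup>2)"

lemma has_integral_energy:
  "((\<lambda>t. (1 - \<bar>t\<bar>) * (cmod (dirichlet (fchar f (int l)) {1..N} t))\<^sup>2) has_integral energy N l) {-1..1}"
  unfolding energy_def by (rule integrable_integral, rule has_integral_integrable, rule has_integral_dirichlet) auto

lemma energy_eq:
  "energy N l = (\<Sum>m\<in>{1..N}. \<Sum>n\<in>{1..N}. Re (fchar f (int l) m * cnj (fchar f (int l) n)) * (fejer (ln (m / n)) / (real m * real n)))"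
  unfolding energy_def by (rule integral_unique, rule has_integral_dirichlet) auto

lemma energy_le:
  assumes "N \<ge> 1" shows "energy N l \<le> 25 * (ln N + 1)"
proof -
  have "energy N l \<le> 25 * (\<Sum>m\<in>{1..N}. (cmod (fchar f (int l) m))\<^sup>2 / m)"
    unfolding energy_eq by (rule fejer_quadratic_form_le)
  also have "\<dots> \<le> 25 * hsum N"
    unfolding hsum_def using norm_fchar_le
    by (intro mult_left_mono sum_mono divide_right_mono) (auto simp: abs_square_le_1)
  also have "\<dots> \<le> 25 * (ln N + 1)" using hsum_le[OF assms] by simp
  finally show ?thesis .
qed

text \<open>Summing over l leaves only pairs with f m = f n \<noteq> 0. As the Fejer kernel is
  nonnegative, those that are not close may be dropped; the close ones have kernel at least
  1/2.\<close>

lemma close_pairs_le_energy: "d * close_pairs N \<le> 2 * (\<Sum>l<d. energy N l)"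
proof -
  let ?K = "\<lambda>m n::nat. fejer (ln (m / n)) / (real m * real n)"
  have "(\<Sum>l<d. energy N l) = (\<Sum>m\<in>{1..N}. \<Sum>n\<in>{1..N}. \<Sum>l<d. Re (fchar f (int l) m * cnj (fchar f (int l) n)) * ?K m n)"
    unfolding energy_eq
    by (subst sum.swap, rule sum.cong[OF refl], rule sum.swap)
  also have "\<dots> = (\<Sum>m\<in>{1..N}. \<Sum>n\<in>{1..N}. (if f m = f n \<and> f m \<noteq> 0 then d else 0) * ?K m n)"
  proof (intro sum.cong refl)
    fix m n assume mn: "m \<in> {1..N}" "n \<in> {1..N}"
    have "(\<Sum>l<d. Re (fchar f (int l) m * cnj (fchar f (int l) n)) * ?K m n) =
            Re (\<Sum>l<d. fchar f (int l) m * cnj (fchar f (int l) n)) * ?K m n"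
      by (simp only: Re_sum sum_distrib_right)
    also have "(\<Sum>l<d. fchar f (int l) m * cnj (fchar f (int l) n)) = (if f m = f n \<and> f m \<noteq> 0 then of_nat d else 0)"
      using mn by (intro orthogonality) auto
    finally show "(\<Sum>l<d. Re (fchar f (int l) m * cnj (fchar f (int l) n)) * ?K m n) = (if f m = f n \<and> f m \<noteq> 0 then d else 0) * ?K m n"
      by (simp only: if_distrib[of Re] complex_Re_of_nat zero_complex.sel if_distrib[of real] of_nat_0 cong: if_cong)
  qed
  also have "\<dots> \<ge> (\<Sum>m\<in>{1..N}. \<Sum>n\<in>{1..N}. d / 2 * (if f m = f n \<and> f m \<noteq> 0 \<and> \<bar>ln (real m / real n)\<bar> \<le> 1 then 1 / (real m * real n) else 0))"
  proof (intro sum_mono)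
    fix m n assume mn: "m \<in> {1..N}" "n \<in> {1..N}"
    show "d / 2 * (if f m = f n \<and> f m \<noteq> 0 \<and> \<bar>ln (real m / real n)\<bar> \<le> 1 then 1 / (real m * real n) else 0) \<le> (if f m = f n \<and> f m \<noteq> 0 then d else 0) * ?K m n"
    proof (cases "f m = f n \<and> f m \<noteq> 0 \<and> \<bar>ln (real m / real n)\<bar> \<le> 1")
      case True
      have "real d * (1/2) * (1 / (real m * real n)) \<le> real d * fejer (ln (m / n)) * (1 / (real m * real n))"
        using fejer_ge_half[of "ln (m / n)"] True by (intro mult_right_mono mult_left_mono) auto
      moreover from True have T: "f m = f n" "f n \<noteq> 0" "\<bar>ln (real m / real n)\<bar> \<le> 1" by auto
      hence "d / 2 * (if f m = f n \<and> f m \<noteq> 0 \<and> \<bar>ln (real m / real n)\<bar> \<le> 1 then 1 / (real m * real n) else 0) = real d * (1/2) * (1 / (real m * real n))"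
        by simp
      moreover from T have "real (if f m = f n \<and> f m \<noteq> 0 then d else 0) * ?K m n = real d * fejer (ln (m / n)) * (1 / (real m * real n))"
        by simp
      ultimately show ?thesis by (simp only:)
    next
      case False
      thus ?thesis by (auto simp: fejer_nonneg)
    qed
  qed
  finally have "d / 2 * close_pairs N \<le> (\<Sum>l<d. energy N l)"
    unfolding close_pairs_def sum_distrib_left .
  thus ?thesis by simp
qed

end

section \<open>Exceptional exponents\<close>

lemma power_ne_1_of_coprime:
  fixes g :: complex
  assumes "g ^ d = 1" "g \<noteq> 1" "coprime k d" "d > 0"
  shows "g ^ k \<noteq> 1"
proof
  assume k: "g ^ k = 1"
  show False
  proof (cases "k = 0")
    case True
    hence "d = 1" using assms by simp
    thus False using assms by simp
  next
    case False
    obtain x y where "k * x = d * y + gcd k d"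
      using bezout_nat[OF False] by blast
    hence "g ^ (k * x) = g ^ (d * y + 1)" using assms(3) by simp
    thus False using assms k by (simp add: power_mult power_add)
  qed
qed

lemma coprime_below_least_prime_factor:
  assumes "d \<ge> 2" "0 < k" "k < least_prime_factor d"
  shows "coprime k d"
proof (rule ccontr)
  assume "\<not> coprime k d"
  hence "gcd k d \<noteq> 1" using coprime_iff_gcd_eq_1 by blast
  then obtain p where p: "prime p" "p dvd gcd k d"
    using prime_factor_nat by blast
  hence "least_prime_factor d \<le> p" unfolding least_prime_factor_def by (intro Least_le) auto
  moreover have "p \<le> k" using p assms by (auto intro: dvd_imp_le)
  ultimately show False using assms by linarith
qed

text \<open>The first J powers of g are distinct, so by orthogonality the square of |1 + g^l + ... +
  g^(l(J-1))| summed over l is J d. If g^l is within 1/J of 1 this geometric sum has modulus at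
  least J/2, which limits the number of such l.\<close>

lemma card_near_one_le:
  fixes g :: complex
  assumes g: "g ^ d = 1" and d: "d > 0" and J: "J \<ge> 1" and ne: "\<And>j. 0 < j \<Longrightarrow> j < J \<Longrightarrow> g ^ j \<noteq> 1"
  shows "card {l\<in>{..<d}. cmod (1 - g ^ l) < 1 / J} * J \<le> 4 * d"
proof -
  define A where "A = {l\<in>{..<d}. cmod (1 - g ^ l) < 1 / J}"
  have g0: "g \<noteq> 0" using g d by (metis power_eq_0_iff zero_neq_one zero_power)
  have ng: "cmod g = 1" using g d by (metis norm_one norm_power norm_ge_zero power_eq_1_iff less_numeral_extra(3))
  have cg: "cnj g = inverse g" using ng by (metis complex_mod_cnj divide_conv_cnj inverse_eq_divide mult_1)
  have inj: "g ^ i = g ^ j \<longleftrightarrow> i = j" if "i < J" "j < J" for i j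
  proof
    assume eq: "g ^ i = g ^ j"
    show "i = j"
    proof (rule ccontr)
      assume "i \<noteq> j"
      then consider "i < j" | "j < i" by linarith
      thus False
      proof cases
        case 1
        hence "g ^ j = g ^ i * g ^ (j - i)" by (simp flip: power_add)
        thus False using eq g0 ne[of "j - i"] 1 that by simp
      next
        case 2
        hence "g ^ i = g ^ j * g ^ (i - j)" by (simp flip: power_add)
        thus False using eq g0 ne[of "i - j"] 2 that by simp
      qed
    qed
  qed auto
  have "complex_of_real (\<Sum>l<d. (cmod (\<Sum>j<J. (g ^ l) ^ j))\<^sup>2) = (\<Sum>l<d. (\<Sum>j<J. (g ^ l) ^ j) * cnj (\<Sum>j<J. (g ^ l) ^ j))"
    by (simp only: of_real_sum complex_norm_square)
  also have "\<dots> = (\<Sum>l<d. \<Sum>i<J. \<Sum>j<J. (g ^ i / g ^ j) ^ l)"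
    unfolding cnj_sum sum_product
    by (intro sum.cong refl) (simp add: cg power_inverse divide_inverse power_mult_distrib mult.commute flip: power_mult)
  also have "\<dots> = (\<Sum>i<J. \<Sum>j<J. \<Sum>l<d. (g ^ i / g ^ j) ^ l)"
    by (subst sum.swap, rule sum.cong[OF refl], rule sum.swap)
  also have "\<dots> = (\<Sum>i<J. \<Sum>j<J. if i = j then of_nat d else 0)"
  proof (intro sum.cong refl)
    fix i j assume ij: "i \<in> {..<J}" "j \<in> {..<J}"
    have "(g ^ n) ^ d = 1" for n
      by (metis g mult.commute power_mult power_one)
    hence "(g ^ i / g ^ j) ^ d = 1" by (simp add: power_divide)
    hence "(\<Sum>l<d. (g ^ i / g ^ j) ^ l) = (if g ^ i / g ^ j = 1 then of_nat d else 0)"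
      by (auto simp: geometric_sum)
    thus "(\<Sum>l<d. (g ^ i / g ^ j) ^ l) = (if i = j then of_nat d else 0)"
      using inj[of i j] ij g0 by auto
  qed
  also have "\<dots> = of_real (real J * real d)" by simp
  finally have total: "(\<Sum>l<d. (cmod (\<Sum>j<J. (g ^ l) ^ j))\<^sup>2) = real J * real d"
    using of_real_eq_iff by blast
  have "real (card A) * (real J / 2)\<^sup>2 = (\<Sum>l\<in>A. (real J / 2)\<^sup>2)" by simp
  also have "\<dots> \<le> (\<Sum>l\<in>A. (cmod (\<Sum>j<J. (g ^ l) ^ j))\<^sup>2)"
  proof (intro sum_mono power_mono)
    fix l assume l: "l \<in> A"
    have dev: "cmod (1 - (g ^ l) ^ j) \<le> j * (1 / J)" for j
    proof (induction j)
      case (Suc j)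
      have "1 - (g ^ l) ^ Suc j = (1 - g ^ l) + g ^ l * (1 - (g ^ l) ^ j)" by (simp add: algebra_simps)
      also have "cmod \<dots> \<le> cmod (1 - g ^ l) + cmod (1 - (g ^ l) ^ j)"
        using norm_triangle_ineq[of "1 - g ^ l" "g ^ l * (1 - (g ^ l) ^ j)"] by (simp add: norm_mult norm_power ng)
      also have "\<dots> \<le> 1 / J + j * (1 / J)" using Suc.IH l by (auto simp: A_def)
      also have "\<dots> = Suc j * (1 / J)" by (simp add: add_divide_distrib)
      finally show ?case .
    qed auto
    have "(\<Sum>j<J. (g ^ l) ^ j) = of_nat J - (\<Sum>j<J. 1 - (g ^ l) ^ j)" by (simp add: sum_subtractf)
    hence "cmod (\<Sum>j<J. (g ^ l) ^ j) \<ge> J - cmod (\<Sum>j<J. 1 - (g ^ l) ^ j)"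
      using norm_triangle_ineq2[of "of_nat J" "\<Sum>j<J. 1 - (g ^ l) ^ j"] by simp
    moreover have "cmod (\<Sum>j<J. 1 - (g ^ l) ^ j) \<le> (\<Sum>j<J. j * (1 / J))"
      by (intro sum_norm_le dev)
    moreover have "(\<Sum>j<J. real j * (1 / J)) = (\<Sum>j<J. real j) / J" by (simp add: sum_divide_distrib)
    moreover have "(\<Sum>j<J. real j) \<le> J * J / 2"
      by (induction J) (auto simp: field_simps)
    hence "(\<Sum>j<J. real j) / J \<le> J / 2" using J by (simp add: field_simps)
    ultimately show "J / 2 \<le> cmod (\<Sum>j<J. (g ^ l) ^ j)" by linarith
  qed auto
  also have "\<dots> \<le> (\<Sum>l<d. (cmod (\<Sum>j<J. (g ^ l) ^ j))\<^sup>2)"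
    by (intro sum_mono2) (auto simp: A_def)
  finally have "real (card A) * (real J / 2)\<^sup>2 \<le> real J * real d" using total by simp
  hence "real J * (real (card A) * real J) \<le> real J * (4 * real d)"
    by (simp add: power2_eq_square algebra_simps)
  hence "real (card A) * real J \<le> 4 * real d" using J by simp
  hence "real (card A * J) \<le> real (4 * d)" by simp
  thus ?thesis unfolding A_def by (simp only: of_nat_le_iff)
qed

section \<open>The twists p^(-it) and the deviation of f(p)^l from p^(it)\<close>

definition rot :: "real \<Rightarrow> nat \<Rightarrow> complex" where
  "rot t p = cis (- (t * ln p))"

lemma rot_add: "rot (s + t) p = rot s p * rot t p"
  by (simp add: rot_def cis_mult algebra_simps)

lemma rot_minus: "rot (- t) p = cnj (rot t p)"
  by (simp add: rot_def cis_cnj)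

lemma norm_rot [simp]: "cmod (rot t p) = 1"
  by (simp add: rot_def)

lemma rot_0 [simp]: "rot 0 p = 1"
  by (simp add: rot_def)

lemma npow_eq_rot: "p \<ge> 1 \<Longrightarrow> npow (Complex 1 t) p = rot t p / p"
proof -
  assume p: "p \<ge> 1"
  have "npow (Complex 1 t) p = exp (of_real (- ln p) + \<i> * of_real (- (t * ln p)))"
    unfolding npow_def by (rule arg_cong[of _ _ exp]) (simp add: complex_eq_iff)
  also have "\<dots> = of_real (exp (- ln p)) * rot t p"
    by (simp only: exp_add exp_of_real rot_def cis_conv_exp)
  finally show ?thesis using p by (simp add: exp_minus divide_inverse mult.commute)
qed

lemma norm_one_minus_rot_square: "(cmod (1 - rot t p))\<^sup>2 = 2 * (1 - cos (t * ln p))"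
  using sin_cos_squared_add[of "t * ln p"] unfolding cmod_power2 rot_def
  by (simp add: power2_eq_square algebra_simps)

lemma norm_one_minus_rot_le: "p \<ge> 1 \<Longrightarrow> cmod (1 - rot t p) \<le> \<bar>t\<bar> * ln p"
proof -
  assume p: "p \<ge> 1"
  have "(cmod (1 - rot t p))\<^sup>2 \<le> (t * ln p)\<^sup>2"
    unfolding norm_one_minus_rot_square by (rule one_minus_cos_le)
  thus ?thesis using p by (simp add: abs_le_square_iff[symmetric] abs_mult)
qed

context root_valued
begin

text \<open>A pretentious distance over P with weights 1/p, in the variant built from |1 - z|
  instead of 1 - Re z, so that it is an L2 norm and subadditive in (l, t). A prime with f p = 0
  contributes 1/p.\<close>

definition dev :: "nat set \<Rightarrow> int \<Rightarrow> real \<Rightarrow> real" where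
  "dev P l t = L2_set (\<lambda>p. cmod (1 - fchar f l p * rot t p) / sqrt p) P"

lemma dev_nonneg [simp]: "dev P l t \<ge> 0" by (simp add: dev_def)

text \<open>For |z| \<le> 1 one has |1 - z w| \<le> |1 - z| + |1 - w|, to which Minkowski's
  inequality is applied.\<close>

lemma dev_add:
  assumes P: "\<And>p. p \<in> P \<Longrightarrow> p \<ge> 1"
  shows "dev P (k + l) (s + t) \<le> dev P k s + dev P l t"
proof -
  have "dev P (k + l) (s + t) \<le>
     L2_set (\<lambda>p. cmod (1 - fchar f k p * rot s p) / sqrt p + cmod (1 - fchar f l p * rot t p) / sqrt p) P"
    unfolding dev_def
  proof (intro L2_set_mono)
    fix p assume p: "p \<in> P"
    let ?z = "fchar f k p * rot s p" and ?w = "fchar f l p * rot t p"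
    have "1 - fchar f (k + l) p * rot (s + t) p = (1 - ?z) + ?z * (1 - ?w)"
      by (simp add: fchar_add rot_add algebra_simps)
    also have "cmod \<dots> \<le> cmod (1 - ?z) + cmod ?z * cmod (1 - ?w)"
      by (metis norm_mult norm_triangle_ineq)
    also have "\<dots> \<le> cmod (1 - ?z) + 1 * cmod (1 - ?w)"
      using norm_fchar_le[OF P[OF p]] by (intro add_left_mono mult_right_mono) (auto simp: norm_mult)
    finally show "cmod (1 - fchar f (k + l) p * rot (s + t) p) / sqrt p \<le> cmod (1 - ?z) / sqrt p + cmod (1 - ?w) / sqrt p"
      by (simp add: divide_right_mono flip: add_divide_distrib)
  qed auto
  also have "\<dots> \<le> dev P k s + dev P l t"
    unfolding dev_def by (rule L2_set_triangle_ineq)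
  finally show ?thesis .
qed

lemma dev_minus:
  assumes P: "\<And>p. p \<in> P \<Longrightarrow> p \<ge> 1"
  shows "dev P (- l) (- t) = dev P l t"
  unfolding dev_def
proof (intro L2_set_cong refl)
  fix p assume p: "p \<in> P"
  have "1 - fchar f (- l) p * rot (- t) p = cnj (1 - fchar f l p * rot t p)"
    using P[OF p] by (simp add: fchar_minus rot_minus)
  thus "cmod (1 - fchar f (- l) p * rot (- t) p) / sqrt p = cmod (1 - fchar f l p * rot t p) / sqrt p"
    by (simp only: complex_mod_cnj)
qed

lemma dev_mult:
  assumes P: "\<And>p. p \<in> P \<Longrightarrow> p \<ge> 1" and "k \<ge> (1::nat)"
  shows "dev P (int k * l) (real k * t) \<le> k * dev P l t"
  using assms(2)
proof (induction k rule: nat_induct_at_least)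
  case (Suc k)
  have "dev P (int k * l + l) (real k * t + t) \<le> dev P (int k * l) (real k * t) + dev P l t"
    by (rule dev_add[OF P])
  thus ?case using Suc.IH by (simp add: algebra_simps)
qed auto

lemma dev_cong:
  assumes P: "\<And>p. p \<in> P \<Longrightarrow> p \<ge> 1" and "[k = l] (mod int d)"
  shows "dev P k t = dev P l t"
  unfolding dev_def using assms by (intro L2_set_cong refl) (simp add: fchar_cong[OF P assms(2)])

lemma dev_square:
  "(dev P l t)\<^sup>2 = (\<Sum>p\<in>P. (cmod (1 - fchar f l p * rot t p))\<^sup>2 / p)"
  unfolding dev_def L2_set_def by (subst real_sqrt_pow2) (auto intro!: sum_nonneg simp: power_divide)

text \<open>Exponent 0 leaves the bare twist except where f p = 0; there 1 - cos \<le> 2 while the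
  deviation term is 1, which explains the factor 2.\<close>

lemma cos_sum_ge_dev:
  shows "(\<Sum>p\<in>P. 1 / p) - 2 * (dev P 0 u)\<^sup>2 \<le> (\<Sum>p\<in>P. cos (u * ln p) / p)"
proof -
  have "(\<Sum>p\<in>P. 1 / p) - (\<Sum>p\<in>P. cos (u * ln p) / p) = (\<Sum>p\<in>P. (1 - cos (u * ln p)) / p)"
    by (simp add: sum_subtractf diff_divide_distrib)
  also have "\<dots> \<le> (\<Sum>p\<in>P. 2 * ((cmod (1 - fchar f 0 p * rot u p))\<^sup>2 / p))"
  proof (intro sum_mono)
    fix p
    have "1 - cos (u * ln p) \<le> 2 * (cmod (1 - fchar f 0 p * rot u p))\<^sup>2"
    proof (cases "f p = 0")
      case True
      have "1 - cos (u * ln p) \<le> 1 - (-1)" by (intro diff_left_mono cos_ge_minus_one)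
      thus ?thesis using True by (simp add: fchar_def)
    next
      case False
      have "1 - cos (u * ln p) \<ge> 1 - 1" by (intro diff_left_mono cos_le_one)
      thus ?thesis using False by (simp add: fchar_def norm_one_minus_rot_square)
    qed
    from divide_right_mono[OF this, of "real p"]
    show "(1 - cos (u * ln p)) / p \<le> 2 * ((cmod (1 - fchar f 0 p * rot u p))\<^sup>2 / p)" by simp
  qed
  also have "\<dots> = 2 * (dev P 0 u)\<^sup>2" by (simp add: dev_square sum_distrib_left)
  finally show ?thesis by simp
qed

text \<open>From |1 - z|^2 \<le> 2 (1 - Re z) for |z| \<le> 1. A large deviation thus keeps the
  factor of the Turan-Kubilius inequality away from 0.\<close>

lemma dev_square_le_dirichlet:
  assumes P: "\<And>p. p \<in> P \<Longrightarrow> p \<ge> 1" and E: "(\<Sum>p\<in>P. 1 / real p) > 0"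
  shows "(dev P l t)\<^sup>2 \<le> 2 * (\<Sum>p\<in>P. 1 / real p) * cmod (1 - dirichlet (fchar f l) P t / of_real (\<Sum>p\<in>P. 1 / real p))"
proof -
  define E where "E = (\<Sum>p\<in>P. 1 / real p)"
  have "(dev P l t)\<^sup>2 \<le> (\<Sum>p\<in>P. 2 * (1 - Re (fchar f l p * rot t p)) / p)"
    unfolding dev_square
  proof (intro sum_mono divide_right_mono)
    fix p assume p: "p \<in> P"
    define z where "z = fchar f l p * rot t p"
    have "cmod z \<le> 1" using norm_fchar_le[OF P[OF p]] by (simp add: z_def norm_mult)
    hence "(Re z)\<^sup>2 + (Im z)\<^sup>2 \<le> 1" by (simp add: cmod_def)
    thus "(cmod (1 - z))\<^sup>2 \<le> 2 * (1 - Re z)"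
      unfolding cmod_power2 by (simp add: power2_eq_square algebra_simps)
  qed auto
  also have "\<dots> = 2 * (E - Re (dirichlet (fchar f l) P t))"
  proof -
    have "Re (dirichlet (fchar f l) P t) = (\<Sum>p\<in>P. Re (fchar f l p * rot t p) / p)"
      unfolding dirichlet_def Re_sum using P by (intro sum.cong refl) (simp add: npow_eq_rot)
    thus ?thesis by (simp add: E_def sum_subtractf diff_divide_distrib right_diff_distrib sum_distrib_left)
  qed
  also have "\<dots> = 2 * E * Re (1 - dirichlet (fchar f l) P t / of_real E)"
    using E by (simp add: E_def[symmetric] field_simps)
  also have "\<dots> \<le> 2 * E * cmod (1 - dirichlet (fchar f l) P t / of_real E)"
    using E by (intro mult_left_mono complex_Re_le_cmod) (auto simp: E_def)
  finally show ?thesis by (simp add: E_def)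
qed

end

text \<open>The multiplier may depend on l, so all m values j are excluded together. For i < 8 m the
  exponent j i is coprime to d, so the powers of g^j do not return to 1 before 8 m; the l with
  (g^j)^l within 1/(8m) of 1 number at most d/(2m). Over all j at most d/2 values of l are lost, and
  each other contributes at least (1/(8m))^2.\<close>

lemma sum_square_near_one_ge:
  fixes g :: complex and k :: "nat \<Rightarrow> nat"
  assumes g: "g ^ d = 1" "g \<noteq> 1" and d: "d \<ge> 2" and m: "m \<ge> 1" "8 * m \<le> least_prime_factor d"
    and k: "\<And>l. l < d \<Longrightarrow> 1 \<le> k l \<and> k l \<le> m"
  shows "real d / (128 * (real m)\<^sup>2) \<le> (\<Sum>l<d. (cmod (1 - g ^ (k l * l)))\<^sup>2)"
proof -
  define J where "J = 8 * m"
  define A where "A = (\<lambda>j. {l\<in>{..<d}. cmod (1 - (g ^ j) ^ l) < 1 / J})"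
  define B where "B = {l\<in>{..<d}. cmod (1 - g ^ (k l * l)) < 1 / J}"
  have cardA: "2 * m * card (A j) \<le> d" if j: "j \<in> {1..m}" for j
  proof -
    have "card (A j) * J \<le> 4 * d"
      unfolding A_def
    proof (rule card_near_one_le)
      show "(g ^ j) ^ d = 1" by (metis g(1) mult.commute power_mult power_one)
      fix i assume i: "0 < i" "i < J"
      have "coprime j d" "coprime i d"
        using i j m d by (auto intro!: coprime_below_least_prime_factor simp: J_def)
      hence "coprime (j * i) d" by simp
      hence "g ^ (j * i) \<noteq> 1" using g d by (intro power_ne_1_of_coprime) auto
      thus "(g ^ j) ^ i \<noteq> 1" by (simp add: power_mult)
    qed (use d m in \<open>auto simp: J_def\<close>)
    thus ?thesis by (simp add: J_def)
  qed
  have "B \<subseteq> (\<Union>j\<in>{1..m}. A j)"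
    using k by (force simp: B_def A_def power_mult)
  hence "card B \<le> card (\<Union>j\<in>{1..m}. A j)"
    by (intro card_mono) (auto simp: A_def)
  also have "\<dots> \<le> (\<Sum>j\<in>{1..m}. card (A j))" by (intro card_UN_le) auto
  finally have "2 * m * card B \<le> (\<Sum>j\<in>{1..m}. 2 * m * card (A j))"
    by (simp flip: sum_distrib_left)
  also have "\<dots> \<le> (\<Sum>j\<in>{1..m}. d)" by (intro sum_mono cardA)
  finally have "m * (2 * card B) \<le> m * d" by simp
  hence cardB: "2 * card B \<le> d" using m by simp
  have Bsub: "B \<subseteq> {..<d}" by (auto simp: B_def)
  have "card ({..<d} - B) = d - card B" using Bsub by (subst card_Diff_subset) (auto intro: finite_subset)
  hence "real d / 2 \<le> real (card ({..<d} - B))" using cardB by simp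
  hence "real d / 2 * (1 / J)\<^sup>2 \<le> real (card ({..<d} - B)) * (1 / J)\<^sup>2" by (intro mult_right_mono) auto
  also have "\<dots> = (\<Sum>l\<in>{..<d} - B. (1 / J)\<^sup>2)" by simp
  also have "\<dots> \<le> (\<Sum>l\<in>{..<d} - B. (cmod (1 - g ^ (k l * l)))\<^sup>2)"
    by (intro sum_mono power_mono) (auto simp: B_def)
  also have "\<dots> \<le> (\<Sum>l<d. (cmod (1 - g ^ (k l * l)))\<^sup>2)" by (intro sum_mono2) auto
  also have "real d / 2 * (1 / J)\<^sup>2 = real d / (128 * (real m)\<^sup>2)"
    by (simp add: J_def power2_eq_square)
  finally show ?thesis .
qed

text \<open>The m + 1 translates of L by 0, l, ..., m l cannot be disjoint modulo d.\<close>

lemma pigeonhole_translates: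
  fixes L :: "nat set" and l :: int
  assumes L: "L \<subseteq> {..<d}" "d < (m + 1) * card L" and d: "d > 0"
  obtains k a b where "1 \<le> k" "k \<le> m" "a \<in> L" "b \<in> L" "[int k * l = int a - int b] (mod int d)"
proof -
  define \<phi> where "\<phi> = (\<lambda>(j::nat, a::nat). nat ((int j * l + int a) mod int d))"
  have "\<phi> ` ({..m} \<times> L) \<subseteq> {..<d}" using d by (auto simp: \<phi>_def nat_less_iff)
  hence "card (\<phi> ` ({..m} \<times> L)) \<le> d" using card_mono[of "{..<d}"] by fastforce
  also have "d < card ({..m} \<times> L)" using L by (simp add: card_cartesian_product)
  finally have "\<not> inj_on \<phi> ({..m} \<times> L)" by (rule pigeonhole)
  then obtain i a j b where ij: "i \<le> m" "j \<le> m" "a \<in> L" "b \<in> L" "(i, a) \<noteq> (j, b)" "\<phi> (i, a) = \<phi> (j, b)"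
    unfolding inj_on_def by force
  have cong: "[int i * l + int a = int j * l + int b] (mod int d)"
  proof -
    have "(int i * l + int a) mod int d = (int j * l + int b) mod int d"
      using ij(6) d by (simp add: \<phi>_def eq_nat_nat_iff)
    thus ?thesis by (simp add: cong_def)
  qed
  have ne: "i \<noteq> j"
  proof
    assume "i = j"
    hence "[int a = int b] (mod int d)" using cong by (simp add: cong_add_lcancel)
    moreover have "a < d" "b < d" using ij L by auto
    ultimately have "a = b" by (simp add: cong_def)
    thus False using ij \<open>i = j\<close> by simp
  qed
  note result = that
  have gen: thesis if c: "i < j" "j \<le> m" "a \<in> L" "b \<in> L" "[int i * l + int a = int j * l + int b] (mod int d)" for i j a b
  proof (rule result[of "j - i" a b])
    have "[int i * l + int a - (int i * l + int b) = int j * l + int b - (int i * l + int b)] (mod int d)"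
      by (rule cong_diff[OF c(5) cong_refl])
    thus "[int (j - i) * l = int a - int b] (mod int d)"
      using c(1) by (simp add: of_nat_diff algebra_simps cong_sym)
  qed (use c in auto)
  show thesis
  proof (cases "i < j")
    case True
    thus thesis using gen ij cong by blast
  next
    case False
    hence "j < i" using ne by simp
    thus thesis using gen[of j i b a] ij cong_sym[OF cong] by blast
  qed
qed

context root_valued
begin

text \<open>The same t has to serve both sets: this is how information about twists passes from Q to
  P. The range of t is the support of the tent.\<close>

definition exceptional :: "nat set \<Rightarrow> nat set \<Rightarrow> real \<Rightarrow> nat set" where
  "exceptional P Q \<delta> = {l\<in>{..<d}. \<exists>t. \<bar>t\<bar> \<le> 1 \<and> (dev P (int l) t)\<^sup>2 \<le> \<delta> * (\<Sum>p\<in>P. 1 / real p)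
      \<and> (dev Q (int l) t)\<^sup>2 \<le> \<delta> * (\<Sum>p\<in>Q. 1 / real p)}"

text \<open>If there are many exceptional \<open>l\<close>, then every \<open>l\<close> has a small multiple \<open>k l\<close> that is a difference
  of exceptional ones, with twist \<open>t\<close>. The quotient \<open>t / k\<close> is then additive in \<open>l\<close> up to an error \<open>e\<close>;
  comparing the largest value with the value at twice its argument shows that it never exceeds \<open>e\<close>.
  So the twists are negligible on \<open>P\<close>, which forces \<open>f p = 1\<close> for most \<open>p \<in> P\<close>.\<close>

lemma card_exceptional_le:
  assumes P: "finite P" "\<And>p. p \<in> P \<Longrightarrow> prime p" "\<And>p. p \<in> P \<Longrightarrow> f p \<noteq> 0 \<and> f p \<noteq> 1"
    and Pk: "\<And>p. p \<in> P \<Longrightarrow> real m * e * ln p \<le> \<kappa>" and P0: "(\<Sum>p\<in>P. 1 / real p) > 0"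
    and Q: "finite Q" "\<And>p. p \<in> Q \<Longrightarrow> prime p"
    and Qcos: "\<And>u. \<bar>u\<bar> \<le> 6 * m \<Longrightarrow> (\<Sum>p\<in>Q. cos (u * ln p) / p) \<ge> (\<Sum>p\<in>Q. 1 / real p) / 2 \<Longrightarrow> \<bar>u\<bar> \<le> e"
    and d: "d \<ge> 2" and m: "m \<ge> 1" "8 * m \<le> least_prime_factor d"
    and \<delta>: "\<delta> > 0" "144 * (real m)\<^sup>2 * \<delta> \<le> 1"
    and \<kappa>: "2 * (4 * \<delta> + \<kappa>\<^sup>2) < 1 / (128 * (real m)\<^sup>2)"
  shows "(m + 1) * card (exceptional P Q \<delta>) \<le> d"
proof (rule ccontr)
  assume "\<not> (m + 1) * card (exceptional P Q \<delta>) \<le> d"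
  hence big: "d < (m + 1) * card (exceptional P Q \<delta>)" by simp
  define EP where "EP = (\<Sum>p\<in>P. 1 / real p)"
  define EQ where "EQ = (\<Sum>p\<in>Q. 1 / real p)"
  define sP where "sP = sqrt (\<delta> * EP)"
  define sQ where "sQ = sqrt (\<delta> * EQ)"
  have EQ0: "EQ \<ge> 0" by (auto simp: EQ_def intro: sum_nonneg)
  have EP0: "EP > 0" using P0 by (simp add: EP_def)
  have P1: "p \<ge> 1" if "p \<in> P" for p using P(2)[OF that] prime_ge_1_nat by blast
  have Q1: "p \<ge> 1" if "p \<in> Q" for p using Q(2)[OF that] prime_ge_1_nat by blast
  have L: "\<exists>t. \<bar>t\<bar> \<le> 1 \<and> dev P (int l) t \<le> sP \<and> dev Q (int l) t \<le> sQ" if "l \<in> exceptional P Q \<delta>" for l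
    using that by (auto simp: exceptional_def sP_def sQ_def EP_def EQ_def intro!: real_le_rsqrt)
  have sub: "exceptional P Q \<delta> \<subseteq> {..<d}" by (auto simp: exceptional_def)
  \<comment> \<open>Subtracting two exceptional exponents subtracts their twists and at most doubles
    the bounds.\<close>
  have "\<exists>k t. 1 \<le> k \<and> k \<le> m \<and> \<bar>t\<bar> \<le> 2 \<and> dev P (int k * l) t \<le> 2 * sP \<and> dev Q (int k * l) t \<le> 2 * sQ" for l :: int
  proof -
    from pigeonhole_translates[OF sub big d_pos]
    obtain k a b where k: "1 \<le> k" "k \<le> m" "a \<in> exceptional P Q \<delta>" "b \<in> exceptional P Q \<delta>" "[int k * l = int a - int b] (mod int d)"
      by metis
    obtain s where s: "\<bar>s\<bar> \<le> 1" "dev P (int a) s \<le> sP" "dev Q (int a) s \<le> sQ" using L[OF k(3)] by blast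
    obtain t where t: "\<bar>t\<bar> \<le> 1" "dev P (int b) t \<le> sP" "dev Q (int b) t \<le> sQ" using L[OF k(4)] by blast
    have "dev R (int k * l) (s - t) \<le> dev R (int a) s + dev R (int b) t" if R: "\<And>p. p \<in> R \<Longrightarrow> p \<ge> 1" for R
    proof -
      have "dev R (int k * l) (s - t) = dev R (int a + (- int b)) (s + (- t))"
        using dev_cong[OF R k(5)] by simp
      also have "\<dots> \<le> dev R (int a) s + dev R (- int b) (- t)" by (rule dev_add[OF R])
      also have "dev R (- int b) (- t) = dev R (int b) t" by (rule dev_minus[OF R])
      finally show ?thesis .
    qed
    from this[of P, OF P1] this[of Q, OF Q1] show ?thesis using k s t
      by (intro exI[of _ k] exI[of _ "s - t"]) auto
  qed
  then obtain k t where kt: "\<And>l. 1 \<le> k l" "\<And>l. k l \<le> m" "\<And>l. \<bar>t l\<bar> \<le> (2::real)"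
    "\<And>l. dev P (int (k l) * l) (t l) \<le> 2 * sP" "\<And>l. dev Q (int (k l) * l) (t l) \<le> 2 * sQ"
    by metis
  define T where "T = (\<lambda>l. \<bar>t l\<bar> / k l)"
  have T_bound: "T l \<le> e" if l: "l \<in> {0..<int d}" for l
  proof -
    have fin: "finite (T ` {0..<int d})" "T ` {0..<int d} \<noteq> {}" using d_pos by auto
    obtain w where w: "w \<in> {0..<int d}" "Max (T ` {0..<int d}) = T w"
      using Max_in[OF fin] by auto
    have Tw: "T v \<le> T w" if "v \<in> {0..<int d}" for v using Max_ge[OF fin(1), of "T v"] that w by auto
    define v where "v = (2 * w) mod int d"
    have v: "v \<in> {0..<int d}" using d_pos by (simp add: v_def)
    \<comment> \<open>The exponents 2 k(v) (k(w) w) and k(w) (k(v) v) agree modulo d, so u is a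
      twist for exponent 0. On Q it makes p^(iu) close to 1, which \<open>Qcos\<close> permits only
      for |u| \<le> e.\<close>
    define u where "u = real (2 * k v) * t w + real (k w) * (- t v)"
    have kk: "1 \<le> real (k w)" "1 \<le> real (k v)" "real (k w) \<le> m" "real (k v) \<le> m" using kt(1,2) by auto
    have "dev Q 0 u \<le> 6 * m * sQ"
    proof -
      have c: "[0 = int (2 * k v) * (int (k w) * w) + int (k w) * (- (int (k v) * v))] (mod int d)"
      proof -
        have "[v = 2 * w] (mod int d)" by (simp add: v_def cong_def)
        hence "[int (2 * k v) * (int (k w) * w) + int (k w) * (- (int (k v) * v)) = int (2 * k v) * (int (k w) * w) + int (k w) * (- (int (k v) * (2 * w)))] (mod int d)"
          by (intro cong_add cong_mult cong_refl cong_minus_minus_iff[THEN iffD2])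
        thus ?thesis by (simp add: algebra_simps cong_sym)
      qed
      have "dev Q 0 u = dev Q (int (2 * k v) * (int (k w) * w) + int (k w) * (- (int (k v) * v))) u"
        by (rule dev_cong[OF Q1 c])
      also have "\<dots> \<le> dev Q (int (2 * k v) * (int (k w) * w)) (real (2 * k v) * t w) + dev Q (int (k w) * (- (int (k v) * v))) (real (k w) * (- t v))"
        unfolding u_def by (rule dev_add[OF Q1])
      also have "\<dots> \<le> real (2 * k v) * dev Q (int (k w) * w) (t w) + real (k w) * dev Q (- (int (k v) * v)) (- t v)"
        using kt(1)[of v] kt(1)[of w] by (intro add_mono dev_mult[OF Q1]) auto
      also have "\<dots> = real (2 * k v) * dev Q (int (k w) * w) (t w) + real (k w) * dev Q (int (k v) * v) (t v)"
        by (simp only: dev_minus[OF Q1])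
      also have "\<dots> \<le> (2 * m) * (2 * sQ) + m * (2 * sQ)"
        using kk kt(5) by (intro add_mono mult_mono) auto
      also have "\<dots> = 6 * m * sQ" by simp
      finally show ?thesis .
    qed
    hence "(dev Q 0 u)\<^sup>2 \<le> (6 * m * sQ)\<^sup>2" by (intro power_mono) auto
    also have "\<dots> = 36 * (real m)\<^sup>2 * \<delta> * EQ" using \<delta> EQ0 by (simp add: sQ_def power_mult_distrib)
    finally have "2 * (dev Q 0 u)\<^sup>2 \<le> (144 * (real m)\<^sup>2 * \<delta>) * (EQ / 2)" by (simp add: mult_ac)
    also have "\<dots> \<le> 1 * (EQ / 2)" using \<delta> EQ0 by (intro mult_right_mono) auto
    finally have cosu: "(\<Sum>p\<in>Q. cos (u * ln p) / p) \<ge> EQ / 2"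
      using cos_sum_ge_dev[of Q u] by (simp add: EQ_def)
    have "\<bar>u\<bar> \<le> real (2 * k v) * \<bar>t w\<bar> + real (k w) * \<bar>t v\<bar>"
      unfolding u_def by (rule order.trans[OF abs_triangle_ineq]) (simp add: abs_mult)
    also have "\<dots> \<le> (2 * real m) * 2 + real m * 2" using kk kt(3) by (intro add_mono mult_mono) auto
    finally have "\<bar>u\<bar> \<le> 6 * m" by simp
    hence ue: "\<bar>u\<bar> \<le> e" using Qcos cosu by (simp add: EQ_def)
    have "2 * real (k v) * \<bar>t w\<bar> = \<bar>u + real (k w) * t v\<bar>"
      unfolding u_def by (simp add: abs_mult)
    also have "\<dots> \<le> \<bar>u\<bar> + real (k w) * \<bar>t v\<bar>"
      by (rule order.trans[OF abs_triangle_ineq]) (simp add: abs_mult)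
    \<comment> \<open>Inflating the error by k(w) k(v) \<ge> 1 leaves exactly e after the
      division.\<close>
    also have "\<dots> \<le> e * (real (k w) * real (k v)) + real (k w) * \<bar>t v\<bar>"
    proof -
      have "1 \<le> real (k w) * real (k v)" using kk mult_mono[of 1 "real (k w)" 1 "real (k v)"] by simp
      moreover have "e \<ge> 0" using ue by linarith
      ultimately have "e * 1 \<le> e * (real (k w) * real (k v))" by (intro mult_left_mono)
      thus ?thesis using ue by linarith
    qed
    finally have "2 * real (k v) * \<bar>t w\<bar> / (real (k w) * real (k v)) \<le> (e * (real (k w) * real (k v)) + real (k w) * \<bar>t v\<bar>) / (real (k w) * real (k v))"
      by (rule divide_right_mono) auto
    hence "2 * T w \<le> e + T v"
      using kk by (simp add: T_def add_divide_distrib)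
    \<comment> \<open>By maximality T(v) \<le> T(w), so 2 T(w) \<le> e + T(w).\<close>
    hence "T w \<le> e" using Tw[OF v] by linarith
    thus ?thesis using Tw[OF l] by linarith
  qed
  have \<kappa>0: "\<kappa> \<ge> 0"
  proof -
    have "P \<noteq> {}" using EP0 by (auto simp: EP_def)
    then obtain p where p: "p \<in> P" by blast
    have "0 \<le> T 0" by (simp add: T_def)
    also have "T 0 \<le> e" using d_pos by (intro T_bound) auto
    finally have "0 \<le> e" .
    hence "0 \<le> real m * e * ln p" using P1[OF p] by (intro mult_nonneg_nonneg) auto
    thus ?thesis using Pk[OF p] by linarith
  qed
  \<comment> \<open>Now |t| \<le> m e, so removing the twist changes each term on P by at most
    \<kappa>, and f(p)^(kl) itself is close to 1 in mean square.\<close>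
  have small: "(\<Sum>p\<in>P. (cmod (1 - fchar f (int (k (int l)) * int l) p))\<^sup>2 / p) \<le> 2 * (4 * \<delta> + \<kappa>\<^sup>2) * EP" if l: "l < d" for l
  proof -
    let ?l = "int l"
    let ?j = "int (k ?l) * ?l"
    have "dev P ?j 0 \<le> L2_set (\<lambda>p. cmod (1 - fchar f ?j p * rot (t ?l) p) / sqrt p + \<kappa> / sqrt p) P"
      unfolding dev_def
    proof (intro L2_set_mono)
      fix p assume p: "p \<in> P"
      have "1 - fchar f ?j p * rot 0 p = (1 - fchar f ?j p * rot (t ?l) p) - fchar f ?j p * (1 - rot (t ?l) p)"
        by (simp add: algebra_simps)
      also have "cmod \<dots> \<le> cmod (1 - fchar f ?j p * rot (t ?l) p) + cmod (fchar f ?j p) * cmod (1 - rot (t ?l) p)"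
        by (metis norm_mult norm_triangle_ineq4)
      also have "cmod (fchar f ?j p) * cmod (1 - rot (t ?l) p) \<le> 1 * (\<bar>t ?l\<bar> * ln p)"
        using norm_fchar_le[OF P1[OF p]] norm_one_minus_rot_le[OF P1[OF p]] by (intro mult_mono) auto
      also have "\<bar>t ?l\<bar> \<le> real m * e"
      proof -
        have k1: "real (k ?l) \<ge> 1" "real (k ?l) \<le> m" using kt by auto
        have "T ?l \<le> e" using l by (intro T_bound) auto
        hence "\<bar>t ?l\<bar> \<le> e * real (k ?l)" using k1 by (simp add: T_def divide_le_eq)
        also have "\<dots> \<le> e * real m"
        proof (rule mult_left_mono)
          have "0 \<le> T ?l" by (simp add: T_def)
          thus "0 \<le> e" using \<open>T ?l \<le> e\<close> by linarith
        qed (use k1 in auto)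
        finally show ?thesis by (simp add: mult.commute)
      qed
      hence "1 * (\<bar>t ?l\<bar> * ln p) \<le> real m * e * ln p"
        using P1[OF p] by (simp add: mult_right_mono)
      also have "real m * e * ln p \<le> \<kappa>" by (rule Pk[OF p])
      finally show "cmod (1 - fchar f ?j p * rot 0 p) / sqrt p \<le> cmod (1 - fchar f ?j p * rot (t ?l) p) / sqrt p + \<kappa> / sqrt p"
        by (simp add: divide_right_mono flip: add_divide_distrib)
    qed auto
    also have "\<dots> \<le> dev P ?j (t ?l) + L2_set (\<lambda>p. \<kappa> / sqrt p) P"
      unfolding dev_def by (rule L2_set_triangle_ineq)
    also have "L2_set (\<lambda>p. \<kappa> / sqrt p) P = sqrt (\<kappa>\<^sup>2 * EP)"
      by (simp add: L2_set_def EP_def power_divide sum_distrib_left)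
    finally have "dev P ?j 0 \<le> 2 * sP + sqrt (\<kappa>\<^sup>2 * EP)" using kt(4)[of ?l] by linarith
    hence "(dev P ?j 0)\<^sup>2 \<le> (2 * sP + sqrt (\<kappa>\<^sup>2 * EP))\<^sup>2" by (intro power_mono) auto
    also have "\<dots> \<le> 2 * (2 * sP)\<^sup>2 + 2 * (sqrt (\<kappa>\<^sup>2 * EP))\<^sup>2" by (rule power2_sum_le)
    also have "\<dots> = 2 * (4 * \<delta> + \<kappa>\<^sup>2) * EP"
      using \<delta> EP0 by (simp add: sP_def power_mult_distrib algebra_simps)
    finally show ?thesis by (simp add: dev_square)
  qed
  \<comment> \<open>Double counting over p and l: each p requires at least d / (128 m^2) from the
    sum over l, whereas each l supplies at most 2 (4 \<delta> + \<kappa>^2) EP.\<close>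
  have "real d / (128 * (real m)\<^sup>2) * EP = (\<Sum>p\<in>P. real d / (128 * (real m)\<^sup>2) / p)"
    by (simp add: EP_def sum_distrib_left)
  also have "\<dots> \<le> (\<Sum>p\<in>P. (\<Sum>l<d. (cmod (1 - f p ^ (k (int l) * l)))\<^sup>2) / p)"
  proof (intro sum_mono divide_right_mono)
    fix p assume p: "p \<in> P"
    show "real d / (128 * (real m)\<^sup>2) \<le> (\<Sum>l<d. (cmod (1 - f p ^ (k (int l) * l)))\<^sup>2)"
      using P(3)[OF p] f_power_d[OF P1[OF p]] kt d m by (intro sum_square_near_one_ge) auto
  qed auto
  also have "\<dots> = (\<Sum>p\<in>P. \<Sum>l<d. (cmod (1 - fchar f (int (k (int l)) * int l) p))\<^sup>2 / p)"
    using P(3) by (intro sum.cong refl) (auto simp: fchar_def sum_divide_distrib simp flip: of_nat_mult)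
  also have "\<dots> = (\<Sum>l<d. \<Sum>p\<in>P. (cmod (1 - fchar f (int (k (int l)) * int l) p))\<^sup>2 / p)"
    by (rule sum.swap)
  also have "\<dots> \<le> (\<Sum>l<d. 2 * (4 * \<delta> + \<kappa>\<^sup>2) * EP)" by (intro sum_mono small) auto
  also have "\<dots> = real d * EP * (2 * (4 * \<delta> + \<kappa>\<^sup>2))" by simp
  also have "\<dots> < real d * EP * (1 / (128 * (real m)\<^sup>2))"
    using \<kappa> d_pos EP0 by (intro mult_strict_left_mono) auto
  finally show False by simp
qed

end

section \<open>The mean square bound\<close>

context root_valued
begin

text \<open>At every t the deviation is large on P or on Q. There the factor 1 - avg f(p)^l p^(-it)
  has modulus above \<delta>/2, so the polynomial is at most 2/\<delta> times the product estimated
  by Turan-Kubilius; adding both products avoids splitting the interval.\<close>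

lemma energy_unexceptional_le:
  assumes P: "prime_set P z" and P0: "(\<Sum>p\<in>P. 1 / real p) \<ge> c" and Q: "prime_set Q z" and Q0: "(\<Sum>p\<in>Q. 1 / real p) \<ge> c"
    and c: "c > 0" and N: "N \<ge> 1" and z: "z \<ge> 1" and \<delta>: "\<delta> > 0" and l: "l < d" "l \<notin> exceptional P Q \<delta>"
  shows "energy N l \<le> 200 / \<delta>\<^sup>2 * ((ln N + 1) / c + ln z + 1)"
proof -
  interpret P: prime_set P z by (rule P)
  interpret Q: prime_set Q z by (rule Q)
  let ?c = "fchar f (int l)"
  let ?F = "dirichlet ?c {1..N}"
  have lnN: "ln N + 1 \<ge> 0" using N by (simp add: add_nonneg_nonneg)
  have PE: "P.rsum \<ge> c" and QE: "Q.rsum \<ge> c" using P0 Q0 by (auto simp: P.rsum_def Q.rsum_def)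
  have Ppos: "P.rsum > 0" and Qpos: "Q.rsum > 0" using PE QE c by auto
  obtain IP where IP: "((\<lambda>t. (1 - \<bar>t\<bar>) * (cmod (?F t * (1 - dirichlet ?c P t / P.rsum)))\<^sup>2) has_integral IP) {-1..1}"
    "IP \<le> 25 * ((ln N + 1) / P.rsum + ln z + 1)"
    using P.turan_kubilius_integral[of ?c N] fchar_mult norm_fchar_le N Ppos z by blast
  obtain IQ where IQ: "((\<lambda>t. (1 - \<bar>t\<bar>) * (cmod (?F t * (1 - dirichlet ?c Q t / Q.rsum)))\<^sup>2) has_integral IQ) {-1..1}"
    "IQ \<le> 25 * ((ln N + 1) / Q.rsum + ln z + 1)"
    using Q.turan_kubilius_integral[of ?c N] fchar_mult norm_fchar_le N Qpos z by blast
  have "energy N l \<le> 4 / \<delta>\<^sup>2 * (IP + IQ)"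
  proof (rule has_integral_le[OF has_integral_energy has_integral_mult_right[OF has_integral_add[OF IP(1) IQ(1)]]])
    fix t :: real assume t: "t \<in> {-1..1}"
    hence t1: "\<bar>t\<bar> \<le> 1" by auto
    have gen: "(cmod (?F t))\<^sup>2 \<le> 4 / \<delta>\<^sup>2 * (cmod (?F t * (1 - dirichlet ?c S t / of_real (\<Sum>p\<in>S. 1 / real p))))\<^sup>2"
      if S: "\<And>p. p \<in> S \<Longrightarrow> p \<ge> 1" and E: "(\<Sum>p\<in>S. 1 / real p) > 0" and big: "\<not> (dev S (int l) t)\<^sup>2 \<le> \<delta> * (\<Sum>p\<in>S. 1 / real p)" for S
    proof -
      let ?E = "\<Sum>p\<in>S. 1 / real p"
      let ?w = "cmod (1 - dirichlet ?c S t / of_real ?E)"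
      have "\<delta> * ?E < 2 * ?E * ?w" using big dev_square_le_dirichlet[OF S E, of "int l" t] by linarith
      hence "?E * \<delta> < ?E * (2 * ?w)" by (simp only: mult_ac)
      hence "\<delta> < 2 * ?w" using E by (simp only: mult_less_cancel_left_pos)
      hence "\<delta>\<^sup>2 \<le> (2 * ?w)\<^sup>2" using \<delta> by (intro power_mono) auto
      hence "1 \<le> 4 / \<delta>\<^sup>2 * ?w\<^sup>2" using \<delta> by (simp add: field_simps power_mult_distrib)
      from mult_right_mono[OF this, of "(cmod (?F t))\<^sup>2"]
      show ?thesis by (simp add: norm_mult power_mult_distrib mult_ac)
    qed
    have "(cmod (?F t))\<^sup>2 \<le> 4 / \<delta>\<^sup>2 * ((cmod (?F t * (1 - dirichlet ?c P t / P.rsum)))\<^sup>2 + (cmod (?F t * (1 - dirichlet ?c Q t / Q.rsum)))\<^sup>2)"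
    proof (cases "(dev P (int l) t)\<^sup>2 \<le> \<delta> * P.rsum")
      case False
      hence "(cmod (?F t))\<^sup>2 \<le> 4 / \<delta>\<^sup>2 * (cmod (?F t * (1 - dirichlet ?c P t / P.rsum)))\<^sup>2"
        using gen[of P] P.P_ge Ppos unfolding P.rsum_def by blast
      also have "\<dots> \<le> 4 / \<delta>\<^sup>2 * ((cmod (?F t * (1 - dirichlet ?c P t / P.rsum)))\<^sup>2 + (cmod (?F t * (1 - dirichlet ?c Q t / Q.rsum)))\<^sup>2)"
        by (intro mult_left_mono) auto
      finally show ?thesis .
    next
      case True
      hence "\<not> (dev Q (int l) t)\<^sup>2 \<le> \<delta> * Q.rsum"
        using l t1 by (auto simp: exceptional_def P.rsum_def Q.rsum_def)
      hence "(cmod (?F t))\<^sup>2 \<le> 4 / \<delta>\<^sup>2 * (cmod (?F t * (1 - dirichlet ?c Q t / Q.rsum)))\<^sup>2"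
        using gen[of Q] Q.P_ge Qpos unfolding Q.rsum_def by blast
      also have "\<dots> \<le> 4 / \<delta>\<^sup>2 * ((cmod (?F t * (1 - dirichlet ?c P t / P.rsum)))\<^sup>2 + (cmod (?F t * (1 - dirichlet ?c Q t / Q.rsum)))\<^sup>2)"
        by (intro mult_left_mono) auto
      finally show ?thesis .
    qed
    from mult_left_mono[OF this, of "1 - \<bar>t\<bar>"] t1
    show "(1 - \<bar>t\<bar>) * (cmod (?F t))\<^sup>2 \<le> 4 / \<delta>\<^sup>2 * ((1 - \<bar>t\<bar>) * (cmod (?F t * (1 - dirichlet ?c P t / P.rsum)))\<^sup>2 + (1 - \<bar>t\<bar>) * (cmod (?F t * (1 - dirichlet ?c Q t / Q.rsum)))\<^sup>2)"
      by (simp only: distrib_left mult.left_commute)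
  qed
  also have "\<dots> \<le> 4 / \<delta>\<^sup>2 * (25 * ((ln N + 1) / c + ln z + 1) + 25 * ((ln N + 1) / c + ln z + 1))"
  proof (intro mult_left_mono add_mono)
    have *: "(ln N + 1) / P.rsum \<le> (ln N + 1) / c" "(ln N + 1) / Q.rsum \<le> (ln N + 1) / c"
      using PE QE c lnN by (intro divide_left_mono; simp)+
    show "IP \<le> 25 * ((ln N + 1) / c + ln z + 1)"
      by (rule order.trans[OF IP(2)], intro mult_left_mono add_right_mono *(1)) simp
    show "IQ \<le> 25 * ((ln N + 1) / c + ln z + 1)"
      by (rule order.trans[OF IQ(2)], intro mult_left_mono add_right_mono *(2)) simp
  qed auto
  also have "\<dots> = 200 / \<delta>\<^sup>2 * ((ln N + 1) / c + ln z + 1)" by (simp add: field_simps)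
  finally show ?thesis .
qed

lemma sum_energy_le:
  assumes P: "prime_set P z" and P0: "(\<Sum>p\<in>P. 1 / real p) \<ge> c" and Q: "prime_set Q z" and Q0: "(\<Sum>p\<in>Q. 1 / real p) \<ge> c"
    and c: "c > 0" and N: "N \<ge> 1" and z: "z \<ge> 1" and \<delta>: "\<delta> > 0" and card: "real (card (exceptional P Q \<delta>)) \<le> \<rho> * real d"
  shows "(\<Sum>l<d. energy N l) \<le> d * (25 * \<rho> * (ln N + 1) + 200 / \<delta>\<^sup>2 * ((ln N + 1) / c + ln z + 1))"
proof -
  let ?L = "exceptional P Q \<delta>"
  let ?B = "200 / \<delta>\<^sup>2 * ((ln N + 1) / c + ln z + 1)"
  have lnN: "ln N + 1 \<ge> 0" using N by (simp add: add_nonneg_nonneg)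
  have B0: "?B \<ge> 0" using lnN c z by (intro mult_nonneg_nonneg add_nonneg_nonneg) auto
  have sub: "?L \<subseteq> {..<d}" by (auto simp: exceptional_def)
  have "(\<Sum>l<d. energy N l) = (\<Sum>l\<in>{..<d} - ?L. energy N l) + (\<Sum>l\<in>?L. energy N l)"
    using sub by (intro sum.subset_diff) auto
  also have "\<dots> \<le> (\<Sum>l\<in>{..<d} - ?L. ?B) + (\<Sum>l\<in>?L. 25 * (ln N + 1))"
    using energy_unexceptional_le[OF P P0 Q Q0 c N z \<delta>] energy_le[OF N] by (intro add_mono sum_mono) auto
  also have "\<dots> \<le> (\<Sum>l<d. ?B) + real (card ?L) * (25 * (ln N + 1))"
    using B0 by (intro add_mono sum_mono2) auto
  also have "\<dots> \<le> d * ?B + (\<rho> * d) * (25 * (ln N + 1))"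
    using card lnN by (intro add_mono mult_right_mono) auto
  also have "\<dots> = d * (25 * \<rho> * (ln N + 1) + ?B)" by (simp add: algebra_simps)
  finally show ?thesis .
qed

lemma fnorm_trivial: "(fnorm {1..N})\<^sup>2 \<le> d * (real N)\<^sup>2"
proof -
  have "(\<Sum>m\<in>{1..N}. \<Sum>n\<in>{1..N}. if f m = f n \<and> f m \<noteq> 0 then 1 else (0::real)) \<le> (\<Sum>m\<in>{1..N}. \<Sum>n\<in>{1..N}. 1)"
    by (intro sum_mono) auto
  also have "\<dots> = (real N)\<^sup>2" by (simp add: power2_eq_square)
  finally show ?thesis by (subst fnorm_square) (auto intro: mult_left_mono)
qed

end

lemma eventually_parameters:
  fixes C Y :: real
  shows "\<forall>\<^sub>F R in at_top. R \<ge> 4 \<and> R / 8 \<ge> C + ln (ln Y) \<and> R / 2 > C + ln (ln Y) \<and> R / 2 \<ge> 8 * C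
     \<and> R / 32 > C + 2 * ln (3 + 12 * R)
     \<and> 16 * R powr (1/11) \<le> R \<and> 8192 * R powr (-3/11) \<le> (1::real) \<and> 8192 * R * exp (- R / 4) < 1"
  by (intro eventually_conj) real_asymp+

lemma mean_square_bound:
  obtains C R0 where "C > 0" "R0 > 0"
    "\<And>f d N (R::real). root_valued f d \<Longrightarrow> d \<ge> 2 \<Longrightarrow> N \<ge> 1 \<Longrightarrow> R \<ge> R0 \<Longrightarrow> R \<le> least_prime_factor d \<Longrightarrow>
       R \<le> 2 + (\<Sum>p | prime p \<and> p \<le> N \<and> f p \<noteq> 0 \<and> f p \<noteq> 1. 1 / real p) \<Longrightarrow>
       (root_valued.fnorm f d {1..N})\<^sup>2 \<le> d * (C * (real N)\<^sup>2 * R powr (-1/11))"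
proof -
  obtain C Y where CY: "C \<ge> 0" "Y > exp 1"
    "\<And>y z. Y \<le> y \<Longrightarrow> y \<le> z \<Longrightarrow> \<bar>(\<Sum>p\<in>primes_le z - primes_le y. 1 / p) - ln (ln z / ln y)\<bar> \<le> C"
    "\<And>y. Y \<le> y \<Longrightarrow> (\<Sum>p\<in>primes_le y. 1 / p) \<le> ln (ln y) + C"
    "\<And>y z t. Y \<le> y \<Longrightarrow> y \<le> z \<Longrightarrow> 1 / ln y \<le> \<bar>t\<bar> \<Longrightarrow>
       (\<Sum>p\<in>primes_le z - primes_le y. cos (t * ln p) / p) \<le> C + 2 * ln (3 + \<bar>t\<bar>)"
    by (rule prime_sum_estimates) (rule that; assumption)
  obtain R0 where R0: "\<And>R. R \<ge> R0 \<Longrightarrow> R \<ge> 4 \<and> R / 8 \<ge> C + ln (ln Y) \<and> R / 2 > C + ln (ln Y) \<and> R / 2 \<ge> 8 * C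
     \<and> R / 32 > C + 2 * ln (3 + 12 * R)
     \<and> 16 * R powr (1/11) \<le> R \<and> 8192 * R powr (-3/11) \<le> (1::real) \<and> 8192 * R * exp (- R / 4) < 1"
    using eventually_parameters[of C Y] unfolding eventually_at_top_linorder by blast
  have Y: "Y > 0" "ln Y > 1" "ln (ln Y) > 0"
  proof -
    show "Y > 0" using CY(2) less_trans[OF exp_gt_zero] by blast
    thus "ln Y > 1" using CY(2) by (metis exp_gt_zero ln_exp ln_less_cancel_iff)
    thus "ln (ln Y) > 0" by simp
  qed
  have main: "(root_valued.fnorm f d {1..N})\<^sup>2 \<le> d * (20000000 * (real N)\<^sup>2 * R powr (-1/11))"
    if rv: "root_valued f d" and d: "d \<ge> 2" and N: "N \<ge> 1" and RR: "R \<ge> max 1 R0" and Rl: "R \<le> least_prime_factor d"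
      and RE: "R \<le> 2 + (\<Sum>p | prime p \<and> p \<le> N \<and> f p \<noteq> 0 \<and> f p \<noteq> 1. 1 / real p)" for f d N and R :: real
  proof -
    interpret root_valued f d by (rule rv)
    define S where "S = {p. prime p \<and> p \<le> N \<and> f p \<noteq> 0 \<and> f p \<noteq> 1}"
    define E where "E = (\<Sum>p\<in>S. 1 / real p)"
    have par: "R \<ge> 4" "R / 8 \<ge> C + ln (ln Y)" "R / 2 > C + ln (ln Y)" "R / 2 \<ge> 8 * C"
      "R / 32 > C + 2 * ln (3 + 12 * R)" "16 * R powr (1/11) \<le> R" "8192 * R powr (-3/11) \<le> 1" "8192 * R * exp (- R / 4) < 1"
      using R0[of R] RR by auto
    have ER: "E \<ge> R / 2" using RE par(1) by (simp add: E_def S_def)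
    have E0: "E > 0" "E \<ge> 2" using ER par(1) by auto
    have S_sub: "S \<subseteq> primes_le (real N)" by (auto simp: S_def primes_le_def)
    hence finS: "finite S" by (rule finite_subset) simp
    \<comment> \<open>For N < Y all of S lies below Y, where the reciprocal sum is bounded, against
      E \<ge> R/2.\<close>
    have NY: "real N \<ge> Y"
    proof (rule ccontr)
      assume "\<not> real N \<ge> Y"
      hence "S \<subseteq> primes_le Y" by (auto simp: S_def primes_le_def)
      hence "E \<le> (\<Sum>p\<in>primes_le Y. 1 / real p)" unfolding E_def by (intro sum_mono2) auto
      also have "\<dots> \<le> ln (ln Y) + C" by (rule CY(4)) simp
      finally show False using ER par(3) by linarith
    qed
    have lnN1: "ln N \<ge> ln Y" using NY Y N by (subst ln_le_cancel_iff) auto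
    hence lnN: "ln N > 1" using Y by linarith
    have "E \<le> (\<Sum>p\<in>primes_le (real N). 1 / real p)" unfolding E_def using S_sub by (intro sum_mono2) auto
    also have "\<dots> \<le> ln (ln N) + C" by (rule CY(4)[OF NY])
    \<comment> \<open>Mertens gives E \<le> ln ln N + C; a quarter of E, at least R/8, pays for the
      constants. This ensures that the lowest cut point \<open>y1\<close> exceeds Y.\<close>
    finally have "ln (ln N) \<ge> 3 * E / 4 + ln (ln Y)" using ER par(2) by linarith
    moreover have "0 < ln Y" using Y by linarith
    ultimately have lnlnN: "ln N \<ge> exp (3 * E / 4) * ln Y"
      using lnN by (simp add: ln_ge_iff exp_add)
    define w where "w = (\<lambda>a. exp (ln N * exp (- a * E)))"
    have ln_w: "ln (w a) = ln N * exp (- a * E)" for a by (simp add: w_def)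
    have w_mono: "w a \<le> w b" if "b \<le> a" for a b
      unfolding w_def using that lnN E0 by (simp add: mult_left_mono)
    define y1 where "y1 = w (3/4)"
    define y where "y = w (1/2)"
    define z where "z = w (1/4)"
    have order: "Y \<le> y1" "y1 \<le> y" "y \<le> z" "z \<le> real N" "1 \<le> z"
    proof -
      have "ln Y \<le> ln N * exp (- (3/4) * E)"
        using lnlnN by (simp add: exp_minus field_simps)
      hence "exp (ln Y) \<le> exp (ln N * exp (- (3/4) * E))" by (simp only: exp_le_cancel_iff)
      thus "Y \<le> y1" using Y by (simp add: y1_def w_def)
      show "y1 \<le> y" "y \<le> z" unfolding y1_def y_def z_def by (auto intro!: w_mono)
      have "w (1/4) \<le> w 0" by (rule w_mono) auto
      thus "z \<le> real N" using N by (simp add: z_def w_def)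
      show "1 \<le> z" unfolding z_def w_def using lnN by simp
    qed
    have Yy: "Y \<le> y" "Y \<le> z" using order by auto
    define P where "P = {p\<in>S. real p \<le> y1}"
    define Q where "Q = primes_le z - primes_le y"
    have finP: "finite P" using finS by (simp add: P_def)
    have P_sum: "(\<Sum>p\<in>P. 1 / real p) \<ge> E / 8"
    proof -
      have "E = (\<Sum>p\<in>S - P. 1 / real p) + (\<Sum>p\<in>P. 1 / real p)"
        unfolding E_def using finS by (intro sum.subset_diff) (auto simp: P_def)
      also have "(\<Sum>p\<in>S - P. 1 / real p) \<le> (\<Sum>p\<in>primes_le (real N) - primes_le y1. 1 / real p)"
        by (intro sum_mono2) (auto simp: S_def P_def primes_le_def)
      also have "\<dots> \<le> ln (ln N / ln y1) + C"
        using CY(3)[of y1 "real N"] order by linarith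
      also have "ln (ln N / ln y1) = 3 * E / 4"
        using lnN by (simp add: y1_def ln_w exp_minus field_simps)
      finally show ?thesis using par(4) ER by linarith
    qed
    have Q_sum: "(\<Sum>p\<in>Q. 1 / real p) \<ge> E / 8"
    proof -
      have "ln z / ln y = exp (E / 4)"
        using lnN by (simp add: z_def y_def ln_w exp_diff[symmetric])
      hence "ln (ln z / ln y) = E / 4" by simp
      thus ?thesis using CY(3)[OF Yy(1) order(3)] par(4) ER unfolding Q_def by linarith
    qed
    have psP: "prime_set P z"
      using finP order by unfold_locales (auto simp: P_def S_def)
    have psQ: "prime_set Q z"
    proof unfold_locales
      show "finite Q" by (simp add: Q_def)
    qed (auto simp: Q_def primes_le_def)
    \<comment> \<open>The count of exceptional l asks for m about 1/\<rho>. With \<delta> = \<rho>^5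
      the product m^2 \<delta> is at most 4 \<rho>^3, small enough for
      \<open>card_exceptional_le\<close> once R is large.\<close>
    define \<rho> where "\<rho> = R powr (-1/11)"
    define \<delta> where "\<delta> = \<rho> ^ 5"
    define m where "m = nat \<lceil>1 / \<rho>\<rceil>"
    have R1: "R \<ge> 1" "R > 0" using par(1) by auto
    have \<rho>: "\<rho> > 0" "\<rho> \<le> 1" "1 / \<rho> = R powr (1/11)"
      using R1 powr_mono[of "-1/11" 0 R] by (auto simp: \<rho>_def powr_minus_divide)
    have \<rho>_pow: "\<rho> ^ k = R powr (- real k / 11)" for k
      using R1 by (simp add: \<rho>_def powr_powr flip: powr_realpow)
    have m: "m \<ge> 1" "real m \<ge> 1 / \<rho>" "real m \<le> 2 / \<rho>"
    proof -
      have 1: "1 / \<rho> \<ge> 1" using \<rho>(1,2) by simp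
      thus "m \<ge> 1" by (simp add: m_def) linarith
      show "real m \<ge> 1 / \<rho>" unfolding m_def by (rule real_nat_ceiling_ge)
      have "real m < 1 / \<rho> + 1" unfolding m_def using 1 by linarith
      also have "\<dots> \<le> 2 / \<rho>" using 1 by simp
      finally show "real m \<le> 2 / \<rho>" by simp
    qed
    have m2: "(real m)\<^sup>2 \<le> 4 / \<rho>\<^sup>2"
      using power_mono[OF m(3), of 2] by (simp add: power_divide)
    define \<kappa> where "\<kappa> = real m * exp (- E / 4)"
    have "(m + 1) * card (exceptional P Q \<delta>) \<le> d"
    proof (rule card_exceptional_le[where e = "1 / ln y" and \<kappa> = \<kappa>])
      have lny: "ln y > 0" using lnN by (simp add: y_def ln_w)
      show "finite P" "finite Q" using finP by (auto simp: Q_def)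
      show "prime p" "f p \<noteq> 0 \<and> f p \<noteq> 1" if "p \<in> P" for p using that by (auto simp: P_def S_def)
      show "prime p" if "p \<in> Q" for p using that by (auto simp: Q_def primes_le_def)
      show "real m * (1 / ln y) * ln p \<le> \<kappa>" if p: "p \<in> P" for p
      proof -
        have "p \<ge> 1" using p prime_ge_1_nat by (auto simp: P_def S_def)
        hence "ln p \<le> ln y1" using p order by (subst ln_le_cancel_iff) (auto simp: P_def)
        hence "real m * (1 / ln y) * ln p \<le> real m * (1 / ln y) * ln y1"
          using lny by (intro mult_left_mono) auto
        also have "\<dots> = real m * (ln y1 / ln y)" by simp
        also have "ln y1 / ln y = exp (- E / 4)"
          using lnN by (simp add: y1_def y_def ln_w exp_diff[symmetric])
        finally show ?thesis by (simp add: \<kappa>_def)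
      qed
      show "(\<Sum>p\<in>P. 1 / real p) > 0" using P_sum E0 by linarith
      \<comment> \<open>Beyond 1 / ln y the cosine sum is only logarithmic in |u| \<le> 12 R,
        whereas half the reciprocal sum of Q is at least R/32.\<close>
      show "\<bar>u\<bar> \<le> 1 / ln y" if u: "\<bar>u\<bar> \<le> real (6 * m)" "(\<Sum>p\<in>Q. cos (u * ln p) / p) \<ge> (\<Sum>p\<in>Q. 1 / real p) / 2" for u
      proof (rule ccontr)
        assume "\<not> \<bar>u\<bar> \<le> 1 / ln y"
        hence "(\<Sum>p\<in>Q. cos (u * ln p) / p) \<le> C + 2 * ln (3 + \<bar>u\<bar>)"
          unfolding Q_def using CY(5)[OF Yy(1) order(3), of u] by simp
        also have "ln (3 + \<bar>u\<bar>) \<le> ln (3 + 12 * R)"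
        proof (subst ln_le_cancel_iff)
          have "R powr (1/11) \<le> R" using R1 powr_mono[of "1/11" 1 R] by simp
          hence "real m \<le> 2 * R" using m(3) \<rho>(3) by simp
          thus "3 + \<bar>u\<bar> \<le> 3 + 12 * R" using u(1) by simp
        qed (use R1 in auto)
        finally show False using u(2) Q_sum ER par(5) by linarith
      qed
      show "d \<ge> 2" "m \<ge> 1" by (fact d, fact m)
      have "8 * real m \<le> R" using m(3) \<rho>(3) par(6) by simp
      hence "real (8 * m) \<le> real (least_prime_factor d)" using Rl by simp
      thus "8 * m \<le> least_prime_factor d" by (simp only: of_nat_le_iff)
      show "\<delta> > 0" using \<rho> by (simp add: \<delta>_def)
      have r3: "8192 * \<rho> ^ 3 \<le> 1" using par(7) \<rho>_pow[of 3] by simp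
      have md: "(real m)\<^sup>2 * \<delta> \<le> 4 * \<rho> ^ 3"
      proof -
        have "(real m)\<^sup>2 * \<delta> \<le> 4 / \<rho>\<^sup>2 * \<delta>" using m2 \<rho> by (intro mult_right_mono) (auto simp: \<delta>_def)
        also have "\<dots> = 4 * \<rho> ^ 3" using \<rho> by (simp add: \<delta>_def field_simps eval_nat_numeral)
        finally show ?thesis .
      qed
      show "144 * (real m)\<^sup>2 * \<delta> \<le> 1" using md r3 by simp
      \<comment> \<open>The factor m^4 is of order \<rho>^(-4) = R^(4/11), which e^(-E/2) \<le>
        e^(-R/4) outweighs.\<close>
      have mk: "256 * ((real m)\<^sup>2 * \<kappa>\<^sup>2) < 1 / 2"
      proof -
        have "256 * ((real m)\<^sup>2 * \<kappa>\<^sup>2) = 256 * ((real m)\<^sup>2 * (real m)\<^sup>2) * exp (- E / 2)"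
          by (simp add: \<kappa>_def power_mult_distrib flip: exp_of_nat_mult)
        also have "\<dots> \<le> 256 * (4 / \<rho>\<^sup>2 * (4 / \<rho>\<^sup>2)) * exp (- R / 4)"
          using m2 ER by (intro mult_mono) auto
        also have "4 / \<rho>\<^sup>2 * (4 / \<rho>\<^sup>2) = 16 * (1 / \<rho>) ^ 4" by (simp add: power_divide flip: power_add)
        also have "(1 / \<rho>) ^ 4 = R powr (4/11)" unfolding \<rho>(3) using R1 by (simp add: powr_powr flip: powr_realpow)
        also have "256 * (16 * R powr (4/11)) * exp (- R / 4) \<le> 256 * (16 * R) * exp (- R / 4)"
          using R1 powr_mono[of "4/11" 1 R] by (intro mult_right_mono mult_left_mono) auto
        also have "\<dots> < 1 / 2" using par(8) by simp
        finally show ?thesis .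
      qed
      have "256 * (real m)\<^sup>2 * (4 * \<delta> + \<kappa>\<^sup>2) < 1"
        using md r3 mk by (simp add: distrib_left)
      thus "2 * (4 * \<delta> + \<kappa>\<^sup>2) < 1 / (128 * (real m)\<^sup>2)"
        using m(1) by (simp add: field_simps)
    qed
    hence "real ((m + 1) * card (exceptional P Q \<delta>)) \<le> real d" by (simp only: of_nat_le_iff)
    hence "real m * real (card (exceptional P Q \<delta>)) \<le> real d" by (simp add: distrib_right)
    moreover have "1 / \<rho> * real (card (exceptional P Q \<delta>)) \<le> real m * real (card (exceptional P Q \<delta>))"
      using m by (intro mult_right_mono) auto
    ultimately have "1 / \<rho> * real (card (exceptional P Q \<delta>)) \<le> real d" by linarith
    hence card: "real (card (exceptional P Q \<delta>)) \<le> \<rho> * real d"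
      using \<rho>(1) by (simp add: field_simps)
    have \<delta>0: "\<delta> > 0" using \<rho> by (simp add: \<delta>_def)
    have en: "(\<Sum>l<d. energy N l) \<le> d * (25 * \<rho> * (ln N + 1) + 200 / \<delta>\<^sup>2 * ((ln N + 1) / (E / 8) + ln z + 1))"
      using psP P_sum psQ Q_sum E0(1) N order(5) \<delta>0 card by (intro sum_energy_le) auto
    \<comment> \<open>Since ln N is exponentially large in E, both the constant and ln z = e^(-E/4)
      ln N are absorbed into ln N / E.\<close>
    have lnE: "1 \<le> 2 * ln N / E" "ln z \<le> 4 * ln N / E"
    proof -
      have "3 * E / 4 \<le> exp (3 * E / 4)" using exp_ge_add_one_self[of "3 * E / 4"] by linarith
      also have "\<dots> \<le> exp (3 * E / 4) * ln Y" using Y by simp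
      also have "\<dots> \<le> ln N" by (rule lnlnN)
      finally show "1 \<le> 2 * ln N / E" using E0 by (simp add: field_simps)
      have "E / 4 \<le> exp (E / 4)" using exp_ge_add_one_self[of "E / 4"] by linarith
      hence "exp (- (E / 4)) \<le> 4 / E" using E0 by (simp add: exp_minus field_simps)
      hence "ln N * exp (- (E / 4)) \<le> ln N * (4 / E)" using lnN by (intro mult_left_mono) auto
      thus "ln z \<le> 4 * ln N / E" by (simp add: z_def ln_w mult.commute)
    qed
    have "(ln N + 1) / (E / 8) + ln z + 1 \<le> 22 * ln N / E"
    proof -
      have "(ln N + 1) / (E / 8) \<le> (2 * ln N) / (E / 8)" using lnN E0 by (intro divide_right_mono) auto
      also have "\<dots> = 16 * ln N / E" by simp
      finally show ?thesis using lnE by (simp add: field_simps)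
    qed
    also have "\<dots> \<le> 44 * ln N / R"
    proof -
      have "22 * ln N / E \<le> 22 * ln N / (R / 2)" using ER R1 lnN by (intro divide_left_mono) auto
      thus ?thesis by simp
    qed
    also have "44 * ln N / R = 44 * ln N * \<rho> ^ 11"
      using \<rho>_pow[of 11] R1 by (simp add: powr_minus_divide)
    finally have "200 / \<delta>\<^sup>2 * ((ln N + 1) / (E / 8) + ln z + 1) \<le> 200 / \<delta>\<^sup>2 * (44 * ln N * \<rho> ^ 11)"
      by (intro mult_left_mono) auto
    \<comment> \<open>The balance of exponents: \<rho>^11 / \<delta>^2 = \<rho>.\<close>
    also have "\<dots> = 8800 * ln N * \<rho>"
      using \<rho> by (simp add: \<delta>_def field_simps eval_nat_numeral)
    finally have "25 * \<rho> * (ln N + 1) + 200 / \<delta>\<^sup>2 * ((ln N + 1) / (E / 8) + ln z + 1) \<le> 25 * \<rho> * (2 * ln N) + 8800 * ln N * \<rho>"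
      using lnN \<rho> by (intro add_mono mult_left_mono) auto
    also have "\<dots> = 8850 * \<rho> * ln N" by simp
    finally have "d * (25 * \<rho> * (ln N + 1) + 200 / \<delta>\<^sup>2 * ((ln N + 1) / (E / 8) + ln z + 1)) \<le> d * (8850 * \<rho> * ln N)"
      by (intro mult_left_mono) auto
    hence "real d * close_pairs N \<le> real d * (17700 * \<rho> * ln N)"
      using en close_pairs_le_energy[of N] by simp
    hence cp: "close_pairs N \<le> 17700 * \<rho> * ln N" using d by simp
    have N2: "N \<ge> 2"
    proof (rule ccontr)
      assume "\<not> N \<ge> 2"
      hence "N = 1" using N by simp
      thus False using lnN by simp
    qed
    have "(fnorm {1..N})\<^sup>2 \<le> d * (real N)\<^sup>2 * (600 / ln N * close_pairs N + 2 / (ln N)\<^sup>2)"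
      by (rule fnorm_bound_close_pairs[OF N2])
    also have "\<dots> \<le> d * (real N)\<^sup>2 * (600 / ln N * (17700 * \<rho> * ln N) + 16 * \<rho>)"
    proof (intro mult_left_mono add_mono cp)
      have "1 / ln N \<le> 4 / R"
      proof -
        have "E \<le> 2 * ln N" using lnE(1) E0 by (simp add: field_simps)
        hence "R \<le> 4 * ln N" using ER by linarith
        thus ?thesis using lnN R1 by (simp add: field_simps)
      qed
      also have "\<dots> = 4 * \<rho> ^ 11" using \<rho>_pow[of 11] R1 by (simp add: powr_minus_divide)
      also have "\<dots> \<le> 4 * \<rho> ^ 1" using \<rho> by (intro mult_left_mono power_decreasing) auto
      finally have "1 / ln N \<le> 4 * \<rho>" by simp
      moreover have "2 / (ln N)\<^sup>2 \<le> 2 / ln N" using lnN by (simp add: power2_eq_square field_simps)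
      ultimately show "2 / (ln N)\<^sup>2 \<le> 16 * \<rho>" using \<rho> by simp
    qed (use lnN in auto)
    also have "\<dots> = d * (real N)\<^sup>2 * (10620016 * \<rho>)" using lnN by simp
    also have "\<dots> \<le> d * (real N)\<^sup>2 * (20000000 * \<rho>)" using \<rho> by (intro mult_left_mono) auto
    finally show ?thesis by (simp add: \<rho>_def mult_ac)
  qed
  show ?thesis
    by (rule that[of 20000000 "max 1 R0"]) (use main in auto)
qed

theorem theorem1p2:
  shows "\<exists>C>0. \<forall>(d::nat) (x0::real) f (x::real).
     d \<ge> 2 \<longrightarrow> x0 \<ge> 3 \<longrightarrow> f \<in> M_class x0 d \<longrightarrow> 1 \<le> x \<longrightarrow> x \<le> x0 \<longrightarrow>
     (let \<Sigma> = min (real (least_prime_factor d))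
                  (2 + (\<Sum>p\<in>{p::nat. prime p \<and> real p \<le> x \<and> f p \<noteq> 0 \<and> f p \<noteq> 1}. 1 / real p))
      in (1 / real d) * (\<Sum>l<d. (cmod (\<Sum>n\<in>{1..nat \<lfloor>x\<rfloor>}. fpow f l n))\<^sup>2)
           \<le> C * x\<^sup>2 * (ln \<Sigma>)\<^sup>2 / \<Sigma> powr (1/11))"
proof -
  obtain C R0 where C: "C > 0" "R0 > 0"
    "\<And>f d N (R::real). root_valued f d \<Longrightarrow> d \<ge> 2 \<Longrightarrow> N \<ge> 1 \<Longrightarrow> R \<ge> R0 \<Longrightarrow> R \<le> least_prime_factor d \<Longrightarrow>
       R \<le> 2 + (\<Sum>p | prime p \<and> p \<le> N \<and> f p \<noteq> 0 \<and> f p \<noteq> 1. 1 / real p) \<Longrightarrow>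
       (root_valued.fnorm f d {1..N})\<^sup>2 \<le> d * (C * (real N)\<^sup>2 * R powr (-1/11))"
    by (rule mean_square_bound) (rule that; assumption)
  \<comment> \<open>The summand with R0 makes the trivial bound suffice when Sigma < R0, and the
    division by (ln 2)^2 matches ln Sigma \<ge> ln 2.\<close>
  define D where "D = (C + R0 powr (1/11)) / (ln 2)\<^sup>2"
  have ln2: "(ln 2 :: real)\<^sup>2 > 0" by simp
  have D0: "D > 0" unfolding D_def using C ln2 by (intro divide_pos_pos add_pos_nonneg) auto
  have "(1 / real d) * (\<Sum>l<d. (cmod (\<Sum>n\<in>{1..nat \<lfloor>x\<rfloor>}. fpow f l n))\<^sup>2) \<le> D * x\<^sup>2 * (ln R)\<^sup>2 / R powr (1/11)"
    if d: "d \<ge> 2" and f: "f \<in> M_class x0 d" and x: "1 \<le> x"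
      and R: "R = min (real (least_prime_factor d)) (2 + (\<Sum>p\<in>{p::nat. prime p \<and> real p \<le> x \<and> f p \<noteq> 0 \<and> f p \<noteq> 1}. 1 / real p))"
    for d x0 f x R
  proof -
    interpret root_valued f d
      using f d by unfold_locales (auto simp: M_class_def)
    define N where "N = nat \<lfloor>x\<rfloor>"
    have N: "N \<ge> 1" "real N \<le> x" using x by (auto simp: N_def le_nat_floor)
    have le_iff: "real p \<le> x \<longleftrightarrow> p \<le> N" for p :: nat
      using x by (simp add: N_def le_nat_iff le_floor_iff)
    have R1: "R \<le> least_prime_factor d" "R \<le> 2 + (\<Sum>p | prime p \<and> p \<le> N \<and> f p \<noteq> 0 \<and> f p \<noteq> 1. 1 / real p)"
      using R by (auto simp: le_iff)
    have "\<exists>p. prime p \<and> p dvd d" using d prime_factor_nat[of d] by auto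
    hence "prime (least_prime_factor d)"
      unfolding least_prime_factor_def by (rule LeastI2_ex) auto
    hence R2: "R \<ge> 2" unfolding R using prime_ge_2_nat by (auto intro!: sum_nonneg)
    have "(fnorm {1..N})\<^sup>2 \<le> d * ((C + R0 powr (1/11)) * (real N)\<^sup>2 * R powr (-1/11))"
    proof (cases "R \<ge> R0")
      case True
      have "(fnorm {1..N})\<^sup>2 \<le> d * (C * (real N)\<^sup>2 * R powr (-1/11))"
        by (rule C(3)[OF root_valued_axioms d N(1) True R1])
      also have "\<dots> \<le> d * ((C + R0 powr (1/11)) * (real N)\<^sup>2 * R powr (-1/11))"
        by (intro mult_left_mono mult_right_mono) auto
      finally show ?thesis .
    next
      case False
      have "1 = R powr (1/11) * R powr (-1/11)" using R2 by (simp flip: powr_add)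
      also have "\<dots> \<le> R0 powr (1/11) * R powr (-1/11)"
        using False R2 by (intro mult_right_mono powr_mono2) auto
      also have "\<dots> \<le> (C + R0 powr (1/11)) * R powr (-1/11)" using C by (intro mult_right_mono) auto
      finally have "(real N)\<^sup>2 * 1 \<le> (real N)\<^sup>2 * ((C + R0 powr (1/11)) * R powr (-1/11))"
        by (intro mult_left_mono) auto
      hence "real d * (real N)\<^sup>2 \<le> real d * ((C + R0 powr (1/11)) * (real N)\<^sup>2 * R powr (-1/11))"
        by (intro mult_left_mono) (auto simp: mult_ac)
      thus ?thesis using fnorm_trivial[of N] by linarith
    qed
    hence "(1 / real d) * (fnorm {1..N})\<^sup>2 \<le> (C + R0 powr (1/11)) * (real N)\<^sup>2 * R powr (-1/11)"
      using d by (simp add: field_simps)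
    also have "\<dots> \<le> (C + R0 powr (1/11)) * x\<^sup>2 * R powr (-1/11)"
      using N C by (intro mult_right_mono mult_left_mono power_mono) auto
    also have "\<dots> = (D * x\<^sup>2 * R powr (-1/11)) * (ln 2)\<^sup>2"
      using ln2 by (simp add: D_def)
    also have "\<dots> \<le> (D * x\<^sup>2 * R powr (-1/11)) * (ln R)\<^sup>2"
      using D0 R2 by (intro mult_left_mono power_mono) auto
    also have "\<dots> = D * x\<^sup>2 * (ln R)\<^sup>2 / R powr (1/11)"
      using powr_minus_divide[of R "1/11"] by simp
    also have "(fnorm {1..N})\<^sup>2 = (\<Sum>l<d. (cmod (\<Sum>n\<in>{1..nat \<lfloor>x\<rfloor>}. fpow f l n))\<^sup>2)"
      unfolding fnorm_def L2_set_def N_def fpow_eq_fchar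
      by (subst real_sqrt_pow2) (auto intro!: sum_nonneg)
    finally show ?thesis .
  qed
  thus ?thesis using D0 unfolding Let_def by blast
qed

end
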